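(* For any finite signature $\sigma$, the families $\mathrm{MP}^\sigma$ and $\mathrm{MP}^\sigma_\star$ are polynomial-time equivalent.
   Context: A signature $\sigma$ is a finite set of symbols with arities. Given a poset $(P,\preceq)$, a $(P,\sigma)$-structure $\mathbf G$ consists of a finite domain $G$ and, for each $R\in\sigma$ of arity $k$, a map $R^{\mathbf G}\colon G^k\to P$. A homomorphism $h\colon\mathbf G\to\mathbf H$ is a map $h\colon G\to H$ with $R^{\mathbf G}(\mathbf t)\preceq R^{\mathbf H}(h(\mathbf t))$ for all $R\in\sigma$ of arity $k$ and $\mathbf t\in G^k$. Let $P_{01}=\{0,1\}$ with $0,1$ incomparable, and $P_\star=\{0,1,\star\}$ with $0\preceq\star$, $1\preceq\star$, $0,1$ incomparable; $(P_{01},\sigma)$-structures are $01$-structures and $(P_\star,\sigma)$-structures are $\star$-structures (every $01$-structure is a $\star$-structure). For a $\star$-structure $\mathbf H$, $\mathrm{MP}^\sigma(\mathbf H)$ is the decision problem: given a $01$-structure $\mathbf G$, is there a homomorphism $\mathbf G\to\mathbf H$?; $\mathrm{MP}^\sigma_\star(\mathbf H)$ is the same problem with $\star$-structures as inputs. $\mathrm{MP}^\sigma$ and $\mathrm{MP}^\sigma_\star$ are the families of these problems over all $\star$-structures $\mathbf H$. Standing assumption: targets $\mathbf H$ have no element $x$ with $R^{\mathbf H}(x,\dots,x)=\star$ for all $R\in\sigma$. Two decision problems are polynomial-time equivalent if each polynomial-time reduces to the other; two families $\mathcal C,\mathcal C'$ are polynomial-time equivalent if for every problem in $\mathcal C$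 one can find in polynomial time a polynomial-time equivalent problem in $\mathcal C'$, and vice versa. *)

theory Defs
  imports "HOL-Computational_Algebra.Polynomial"
begin

section \<open>Structures over a poset\<close>

text \<open>
  A signature is a finite set \<open>\<sigma>\<close> of symbols together with an arity function \<open>ar\<close>; a \<open>k\<close>-tuple over
  a set is a list of length \<open>k\<close>. The poset \<open>P\<close> is a subset of an ordered type, with the induced
  order. Values of \<open>rel\<close> at symbols outside \<open>\<sigma>\<close> or at lists that are not tuples over the domain
  of the right length are irrelevant to every definition below.
\<close>

record ('a, 'r, 'p) struct =
  univ :: "'a set"
  rel :: "'r \<Rightarrow> 'a list \<Rightarrow> 'p"

definition tuples :: "'a set \<Rightarrow> nat \<Rightarrow> 'a list set" where
  "tuples A k = {t. length t = k \<and> set t \<subseteq> A}"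

definition is_structure ::
  "'p set \<Rightarrow> 'r set \<Rightarrow> ('r \<Rightarrow> nat) \<Rightarrow> ('a, 'r, 'p::order) struct \<Rightarrow> bool" where
  "is_structure P \<sigma> ar G \<longleftrightarrow>
     finite (univ G) \<and> (\<forall>R\<in>\<sigma>. \<forall>t\<in>tuples (univ G) (ar R). rel G R t \<in> P)"

definition is_hom ::
  "'r set \<Rightarrow> ('r \<Rightarrow> nat) \<Rightarrow> ('a, 'r, 'p::order) struct \<Rightarrow> ('b, 'r, 'p) struct \<Rightarrow> ('a \<Rightarrow> 'b) \<Rightarrow> bool" where
  "is_hom \<sigma> ar G H h \<longleftrightarrow>
     h ` univ G \<subseteq> univ H \<and>
     (\<forall>R\<in>\<sigma>. \<forall>t\<in>tuples (univ G) (ar R). rel G R t \<le> rel H R (map h t))"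

definition homomorphic ::
  "'r set \<Rightarrow> ('r \<Rightarrow> nat) \<Rightarrow> ('a, 'r, 'p::order) struct \<Rightarrow> ('b, 'r, 'p) struct \<Rightarrow> bool" where
  "homomorphic \<sigma> ar G H \<longleftrightarrow> (\<exists>h. is_hom \<sigma> ar G H h)"

datatype label = Zero | One | Star

instantiation label :: order
begin

definition less_eq_label :: "label \<Rightarrow> label \<Rightarrow> bool" where
  "less_eq_label a b \<longleftrightarrow> a = b \<or> b = Star"

definition less_label :: "label \<Rightarrow> label \<Rightarrow> bool" where
  "less_label a b \<longleftrightarrow> a \<noteq> b \<and> b = Star"

instance
  by standard (auto simp: less_eq_label_def less_label_def)

end

definition P01 :: "label set" where
  "P01 = {Zero, One}"

definition Pstar :: "label set" where
  "Pstar = {Zero, One, Star}"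

definition is_target :: "'r set \<Rightarrow> ('r \<Rightarrow> nat) \<Rightarrow> ('a, 'r, label) struct \<Rightarrow> bool" where
  "is_target \<sigma> ar H \<longleftrightarrow>
     is_structure Pstar \<sigma> ar H \<and>
     \<not> (\<exists>x\<in>univ H. \<forall>R\<in>\<sigma>. rel H R (replicate (ar R) x) = Star)"


section \<open>Polynomial time\<close>

text \<open>
  Deterministic Turing machines with finitely many two-way infinite tapes. States and tape symbols
  are natural numbers; symbol 0 is the blank, 1 and 2 represent the bits \<open>False\<close> and \<open>True\<close>. The
  input is written on tape 0; the output is what stands on the last tape from cell 0 up to the
  first blank when the halting state is reached. A machine in its halting state does not move, so
  being halted after \<open>T\<close> iterations of \<open>step\<close> means having halted within \<open>T\<close> steps.
\<close>

datatype move = Left | Stay | Right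

record tm =
  states :: "nat set"
  symbols :: "nat set"
  ntapes :: nat
  start :: nat
  halt :: nat
  delta :: "nat \<Rightarrow> nat list \<Rightarrow> nat \<times> (nat \<times> move) list"

definition wf_tm :: "tm \<Rightarrow> bool" where
  "wf_tm M \<longleftrightarrow>
     finite (states M) \<and> start M \<in> states M \<and> halt M \<in> states M \<and>
     finite (symbols M) \<and> {0, 1, 2} \<subseteq> symbols M \<and>
     ntapes M \<ge> 1 \<and>
     (\<forall>q\<in>states M. \<forall>v\<in>tuples (symbols M) (ntapes M).
        fst (delta M q v) \<in> states M \<and>
        length (snd (delta M q v)) = ntapes M \<and>
        fst ` set (snd (delta M q v)) \<subseteq> symbols M)"

type_synonym tape = "(int \<Rightarrow> nat) \<times> int"
type_synonym config = "nat \<times> tape list"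

fun shift :: "move \<Rightarrow> int \<Rightarrow> int" where
  "shift Left i = i - 1"
| "shift Stay i = i"
| "shift Right i = i + 1"

fun scanned :: "tape \<Rightarrow> nat" where
  "scanned (c, i) = c i"

fun act :: "nat \<times> move \<Rightarrow> tape \<Rightarrow> tape" where
  "act (a, m) (c, i) = (c(i := a), shift m i)"

fun step :: "tm \<Rightarrow> config \<Rightarrow> config" where
  "step M (q, ts) =
     (if q = halt M then (q, ts)
      else (let (q', as) = delta M q (map scanned ts) in (q', map2 act as ts)))"

definition written :: "bool list \<Rightarrow> int \<Rightarrow> nat" where
  "written w i =
     (if 0 \<le> i \<and> i < int (length w) then (if w ! nat i then 2 else 1) else 0)"

definition init :: "tm \<Rightarrow> bool list \<Rightarrow> config" where
  "init M x = (start M, (written x, 0) # replicate (ntapes M - 1) (\<lambda>_. 0, 0))"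

definition outputs :: "config \<Rightarrow> bool list \<Rightarrow> bool" where
  "outputs C y \<longleftrightarrow> (\<forall>i\<in>{0..int (length y)}. fst (last (snd C)) i = written y i)"

definition poly_time :: "(bool list \<Rightarrow> bool list) \<Rightarrow> bool" where
  "poly_time f \<longleftrightarrow>
     (\<exists>M (p :: nat poly). wf_tm M \<and>
        (\<forall>x. let C = (step M ^^ poly p (length x)) (init M x)
             in fst C = halt M \<and> outputs C (f x)))"

text \<open>A decision problem is identified with the set of the strings encoding its yes-instances.\<close>

type_synonym problem = "bool list set"

definition poly_reduces :: "problem \<Rightarrow> problem \<Rightarrow> bool" where
  "poly_reduces L L' \<longleftrightarrow> (\<exists>f. poly_time f \<and> (\<forall>x. x \<in> L \<longleftrightarrow> f x \<in> L'))"

definition poly_equiv :: "problem \<Rightarrow> problem \<Rightarrow> bool" where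
  "poly_equiv L L' \<longleftrightarrow> poly_reduces L L' \<and> poly_reduces L' L"

text \<open>
  To speak of finding a problem of a family in polynomial time, problems have to be given by finite
  descriptions: a family is a set of pairs of a description and the problem it describes.
\<close>

type_synonym family = "(bool list \<times> problem) set"

definition finds_equiv :: "family \<Rightarrow> family \<Rightarrow> bool" where
  "finds_equiv \<C> \<C>' \<longleftrightarrow>
     (\<exists>F. poly_time F \<and> (\<forall>(d, L)\<in>\<C>. \<exists>L'. (F d, L') \<in> \<C>' \<and> poly_equiv L L'))"

definition families_poly_equiv :: "family \<Rightarrow> family \<Rightarrow> bool" where
  "families_poly_equiv \<C> \<C>' \<longleftrightarrow> finds_equiv \<C> \<C>' \<and> finds_equiv \<C>' \<C>"


section \<open>The problems\<close>

text \<open>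
  A structure, with its domain enumerated by \<open>xs\<close>, is encoded by its size in unary followed by the
  value tables of the symbols in increasing order, tuples being listed lexicographically.
  The order on the type of symbols serves only to fix the order of the tables.
\<close>

fun label_bits :: "label \<Rightarrow> bool list" where
  "label_bits Zero = [False, False]"
| "label_bits One = [False, True]"
| "label_bits Star = [True, False]"

definition enumerates :: "'a list \<Rightarrow> ('a, 'r, 'p) struct \<Rightarrow> bool" where
  "enumerates xs G \<longleftrightarrow> distinct xs \<and> set xs = univ G"

definition encode ::
  "'r::linorder set \<Rightarrow> ('r \<Rightarrow> nat) \<Rightarrow> 'a list \<Rightarrow> ('a, 'r, label) struct \<Rightarrow> bool list" where
  "encode \<sigma> ar xs G =
     replicate (length xs) True @ [False] @
     concat (map (\<lambda>R. concat (map (\<lambda>t. label_bits (rel G R t))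
                                  (product_lists (replicate (ar R) xs))))
                 (sorted_list_of_set \<sigma>))"

text \<open>
  Input structures have natural numbers as elements; up to isomorphism this is no restriction. The
  problem depends on the target only up to isomorphism.
\<close>

definition hom_problem ::
  "label set \<Rightarrow> 'r::linorder set \<Rightarrow> ('r \<Rightarrow> nat) \<Rightarrow> (nat, 'r, label) struct \<Rightarrow> problem" where
  "hom_problem P \<sigma> ar H =
     {encode \<sigma> ar xs G | xs (G :: (nat, 'r, label) struct).
        is_structure P \<sigma> ar G \<and> enumerates xs G \<and> homomorphic \<sigma> ar G H}"

definition MP :: "'r::linorder set \<Rightarrow> ('r \<Rightarrow> nat) \<Rightarrow> (nat, 'r, label) struct \<Rightarrow> problem" where
  "MP \<sigma> ar H = hom_problem P01 \<sigma> ar H"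

definition MP_star :: "'r::linorder set \<Rightarrow> ('r \<Rightarrow> nat) \<Rightarrow> (nat, 'r, label) struct \<Rightarrow> problem" where
  "MP_star \<sigma> ar H = hom_problem Pstar \<sigma> ar H"

definition MP_family :: "'r::linorder set \<Rightarrow> ('r \<Rightarrow> nat) \<Rightarrow> family" where
  "MP_family \<sigma> ar = {(encode \<sigma> ar xs H, MP \<sigma> ar H) | xs H. is_target \<sigma> ar H \<and> enumerates xs H}"

definition MP_star_family :: "'r::linorder set \<Rightarrow> ('r \<Rightarrow> nat) \<Rightarrow> family" where
  "MP_star_family \<sigma> ar =
     {(encode \<sigma> ar xs H, MP_star \<sigma> ar H) | xs H. is_target \<sigma> ar H \<and> enumerates xs H}"

end

(*
  Reductions. A 01-input is a star-input, so only stars in inputs have to be simulated.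
  For symbols of arity at least two, replace every vertex by N copies and every star entry by a
  fixed 0/1 pattern on the first two copy indices that is non-constant on each product of two index
  sets of size N/(|H|+1). By pigeonhole many copies of a vertex share their image, so a star entry
  still forces a star in the target. A nullary star only asks whether the target has a star there.
  Unary symbols need a change of target. From MP to MP_star, each target element with a unary star is
  split into a 0- and a 1-copy; this does not change MP and leaves no unary star to simulate. From
  MP_star to MP, a unary symbol U is traded for a new target element marked by U: the old U-label of
  x is moved to the tuples (marked, x, ...) of a symbol of arity at least two, where stars can be
  simulated. If all arities are at most one, all problems are decidable in polynomial time and
  non-trivial, hence equivalent.

  Polynomial time. All functions needed have output bits that are bounded-arithmetic terms over the
  input: built from variables, the length, bits of the input, addition, truncated subtraction and
  bounded sums. Such terms are evaluated by a small language of structured tape programs with unary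
  counters; a program becomes a Turing machine whose states are the stacks of commands that remain
  to be executed.
*)
theory Submission
  imports Defs "HOL-Library.Countable"
begin

section \<open>Structured tape programs\<close>

text \<open>The two families are linked by the problems \<open>lang S\<close>, in which only the
  symbols of \<open>S\<close> may carry stars in the input; stars disappear one class of symbols at
  a time. Only the map between targets has to be uniform: a reduction may depend on its target, so
  the 0/1 pattern, whose existence is shown by counting, is hard-wired and never computed. Copies
  cannot simulate unary stars: any 0/1 pattern on single copies is constant on at least half of
  them. Splitting is of no use for MP_star, since an input star in \<open>U\<close> would lose its
  image. Hence the trade of \<open>U\<close> for tuples, which must also be undone for arbitrary
  inputs over the new target. Such an input may say nothing about the stored label of a vertex, and
  no label lies below both 0 and 1 to express this. A second new element takes these vertices. It
  offers only \<open>Zero\<close> in the tuples that store labels; as one of the two kinds of tuples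
  stores the negated label, a vertex whose label is demanded in both cannot be sent there. In every
  new target \<open>U\<close> takes no star, which preserves the standing assumption.\<close>

datatype cmd =
    Act nat "nat option" move
  | Seq cmd cmd
  | Cond nat nat cmd cmd
  | Loop nat nat cmd

text \<open>Machine states are natural numbers, so stacks of commands have to be coded by
  \<open>to_nat\<close>.\<close>

instance move :: countable by countable_datatype
instance cmd :: countable by countable_datatype

text \<open>The time is exact rather than a bound: expanding a \<open>Seq\<close>,
  \<open>Cond\<close> or \<open>Loop\<close> costs the machine one step in which no tape changes. A
  run of the compiled machine can therefore be stated as an iterate of \<open>step\<close>.\<close>

inductive exec :: "cmd \<Rightarrow> tape list \<Rightarrow> nat \<Rightarrow> tape list \<Rightarrow> bool" where
  exec_Act: "r < length ts \<Longrightarrow>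
    exec (Act r a m) ts 1 (ts[r := act (case a of None \<Rightarrow> scanned (ts ! r) | Some b \<Rightarrow> b, m) (ts ! r)])"
| exec_Seq: "exec c ts t ts' \<Longrightarrow> exec d ts' t' ts'' \<Longrightarrow> exec (Seq c d) ts (Suc (t + t')) ts''"
| exec_Cond_eq: "r < length ts \<Longrightarrow> scanned (ts ! r) = a \<Longrightarrow> exec c ts t ts' \<Longrightarrow>
    exec (Cond r a c d) ts (Suc t) ts'"
| exec_Cond_neq: "r < length ts \<Longrightarrow> scanned (ts ! r) \<noteq> a \<Longrightarrow> exec d ts t ts' \<Longrightarrow>
    exec (Cond r a c d) ts (Suc t) ts'"
| exec_Loop_eq: "r < length ts \<Longrightarrow> scanned (ts ! r) = a \<Longrightarrow> exec (Loop r a c) ts 1 ts"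
| exec_Loop_neq: "r < length ts \<Longrightarrow> scanned (ts ! r) \<noteq> a \<Longrightarrow> exec c ts t ts' \<Longrightarrow>
    exec (Loop r a c) ts' t' ts'' \<Longrightarrow> exec (Loop r a c) ts (Suc (t + t')) ts''"

fun next_ctl :: "cmd list \<Rightarrow> nat list \<Rightarrow> cmd list" where
  "next_ctl [] v = []"
| "next_ctl (Act r a m # cs) v = cs"
| "next_ctl (Seq c d # cs) v = c # d # cs"
| "next_ctl (Cond r a c d # cs) v = (if v ! r = a then c # cs else d # cs)"
| "next_ctl (Loop r a c # cs) v = (if v ! r = a then cs else c # Loop r a c # cs)"

fun ctl_act :: "cmd list \<Rightarrow> nat list \<Rightarrow> nat \<Rightarrow> nat \<times> move" where
  "ctl_act (Act r a m # cs) v i =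
     (if i = r then (case a of None \<Rightarrow> v ! i | Some b \<Rightarrow> b, m) else (v ! i, Stay))"
| "ctl_act cs v i = (v ! i, Stay)"

text \<open>The stacks that can arise while \<open>c\<close> runs on top of \<open>cs\<close>. A
  loop puts itself back under its body, so every round meets the same stacks; this keeps the set of
  states finite.\<close>

fun conts :: "cmd \<Rightarrow> cmd list \<Rightarrow> cmd list set" where
  "conts (Act r a m) cs = {Act r a m # cs}"
| "conts (Seq c d) cs = insert (Seq c d # cs) (conts c (d # cs) \<union> conts d cs)"
| "conts (Cond r a c d) cs = insert (Cond r a c d # cs) (conts c cs \<union> conts d cs)"
| "conts (Loop r a c) cs = insert (Loop r a c # cs) (conts c (Loop r a c # cs))"

fun written_syms :: "cmd \<Rightarrow> nat set" where
  "written_syms (Act r a m) = set_option a"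
| "written_syms (Seq c d) = written_syms c \<union> written_syms d"
| "written_syms (Cond r a c d) = written_syms c \<union> written_syms d"
| "written_syms (Loop r a c) = written_syms c"

definition machine :: "cmd \<Rightarrow> nat \<Rightarrow> tm" where
  "machine c k =
     \<lparr>states = to_nat ` insert [] (conts c []),
      symbols = {0, 1, 2} \<union> written_syms c,
      ntapes = k,
      start = to_nat [c],
      halt = to_nat ([] :: cmd list),
      delta = (\<lambda>q v. (to_nat (next_ctl (from_nat q) v),
                      map (ctl_act (from_nat q) v) [0..<length v]))\<rparr>"

lemma finite_conts: "finite (conts c cs)"
  by (induction c arbitrary: cs) auto

lemma Cons_in_conts: "c # cs \<in> conts c cs"
  by (cases c) auto

text \<open>A step either stays inside the run of \<open>c\<close> or has just popped its last
  command and exposes \<open>cs\<close>. With \<open>cs = []\<close> this closes the set of states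
  under \<open>delta\<close>.\<close>

lemma next_ctl_in_conts: "x \<in> conts c cs \<Longrightarrow> next_ctl x v \<in> insert cs (conts c cs)"
proof (induction c arbitrary: cs)
  case (Act r a m)
  then show ?case by auto
next
  case (Seq c d)
  then show ?case using Cons_in_conts[of c "d # cs"] Cons_in_conts[of d cs] by fastforce
next
  case (Cond r a c d)
  then show ?case
    using Cons_in_conts[of c cs] Cons_in_conts[of d cs] by (auto split: if_splits)
next
  case (Loop r a c)
  show ?case
    using Loop.prems Loop.IH[of "Loop r a c # cs"] Cons_in_conts[of c "Loop r a c # cs"]
    by (auto split: if_splits)
qed

lemma written_in_syms:
  assumes "x \<in> conts c cs" "x = Act r (Some b) m # xs"
  shows "b \<in> written_syms c"
  using assms by (induction c arbitrary: cs) auto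

lemma finite_written_syms: "finite (written_syms c)"
  by (induction c) auto

lemma wf_machine:
  assumes "k \<ge> 1"
  shows "wf_tm (machine c k)"
proof -
  have "fst (delta (machine c k) q v) \<in> states (machine c k) \<and>
        length (snd (delta (machine c k) q v)) = k \<and>
        fst ` set (snd (delta (machine c k) q v)) \<subseteq> symbols (machine c k)"
    if q: "q \<in> states (machine c k)" and v: "v \<in> tuples (symbols (machine c k)) k" for q v
  proof -
    from q obtain x where x: "q = to_nat x" "x \<in> insert [] (conts c [])"
      by (auto simp: machine_def)
    have nx: "next_ctl x v \<in> insert [] (conts c [])"
      using x(2) next_ctl_in_conts[of x c "[]" v] by auto
    have len: "length v = k" and vs: "\<And>i. i < k \<Longrightarrow> v ! i \<in> symbols (machine c k)"
      using v by (auto simp: tuples_def)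
    have "fst (ctl_act x v i) \<in> symbols (machine c k)" if "i < k" for i
    proof (cases "\<exists>b m xs. x = Act i (Some b) m # xs")
      case True
      then obtain b m xs where b: "x = Act i (Some b) m # xs" by blast
      then have "b \<in> written_syms c" using x(2) written_in_syms by auto
      then show ?thesis using b by (simp add: machine_def)
    next
      case False
      then have "fst (ctl_act x v i) = v ! i"
        by (cases "(x, v, i)" rule: ctl_act.cases) (auto split: option.splits)
      then show ?thesis using vs[OF that] by simp
    qed
    then have "fst ` set (map (ctl_act x v) [0..<length v]) \<subseteq> symbols (machine c k)"
      using len by (auto simp del: surjective_pairing)
    then show ?thesis
      using nx x(1) len by (auto simp: machine_def)
  qed
  then have "\<forall>q\<in>states (machine c k). \<forall>v\<in>tuples (symbols (machine c k)) k.
        fst (delta (machine c k) q v) \<in> states (machine c k) \<and>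
        length (snd (delta (machine c k) q v)) = k \<and>
        fst ` set (snd (delta (machine c k) q v)) \<subseteq> symbols (machine c k)"
    by blast
  moreover have "start (machine c k) \<in> states (machine c k)" "halt (machine c k) \<in> states (machine c k)"
    using Cons_in_conts[of c "[]"] by (auto simp: machine_def)
  moreover have "finite (states (machine c k))" "finite (symbols (machine c k))"
    "{0, 1, 2} \<subseteq> symbols (machine c k)" "ntapes (machine c k) = k"
    using finite_conts[of c "[]"] finite_written_syms[of c] by (auto simp: machine_def)
  ultimately show ?thesis
    using assms unfolding wf_tm_def by metis
qed

lemma act_scanned_Stay [simp]: "act (scanned T, Stay) T = T"
  by (cases T) auto

lemma step_machine:
  "step (machine c0 k) (to_nat (c # cs), ts) =
    (to_nat (next_ctl (c # cs) (map scanned ts)),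
     map2 act (map (ctl_act (c # cs) (map scanned ts)) [0..<length ts]) ts)"
  by (simp add: machine_def)

lemma idle_acts:
  assumes "\<And>i. i < length ts \<Longrightarrow> ctl_act cs (map scanned ts) i = (scanned (ts ! i), Stay)"
  shows "map2 act (map (ctl_act cs (map scanned ts)) [0..<length ts]) ts = ts"
  using assms by (intro nth_equalityI) auto

text \<open>The rest \<open>cs\<close> of the stack is arbitrary in the induction, since the first
  half of a \<open>Seq\<close> and the body of a \<open>Loop\<close> run above commands that are
  still pending.\<close>

lemma exec_machine:
  "exec c ts t ts' \<Longrightarrow> (step (machine c0 k) ^^ t) (to_nat (c # cs), ts) = (to_nat cs, ts')"
proof (induction arbitrary: cs rule: exec.induct)
  case (exec_Act r ts a m)
  have "map2 act (map (ctl_act (Act r a m # cs) (map scanned ts)) [0..<length ts]) ts =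
    ts[r := act (case a of None \<Rightarrow> scanned (ts ! r) | Some b \<Rightarrow> b, m) (ts ! r)]"
    using exec_Act by (intro nth_equalityI) (auto simp: nth_list_update split: option.splits)
  then show ?case by (simp add: step_machine del: step.simps)
next
  case (exec_Seq c ts t ts' d t' ts'')
  have "step (machine c0 k) (to_nat (Seq c d # cs), ts) = (to_nat (c # d # cs), ts)"
    by (simp add: step_machine idle_acts del: step.simps)
  then show ?case
    using exec_Seq.IH by (simp add: funpow_swap1 funpow_add add.commute[of t] del: step.simps funpow.simps(2) add: funpow_Suc_right)
next
  case (exec_Cond_eq r ts a c t ts' d)
  have "step (machine c0 k) (to_nat (Cond r a c d # cs), ts) = (to_nat (c # cs), ts)"
    using exec_Cond_eq by (simp add: step_machine idle_acts del: step.simps)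
  then show ?case
    using exec_Cond_eq.IH by (simp del: step.simps funpow.simps(2) add: funpow_Suc_right)
next
  case (exec_Cond_neq r ts a d t ts' c)
  have "step (machine c0 k) (to_nat (Cond r a c d # cs), ts) = (to_nat (d # cs), ts)"
    using exec_Cond_neq by (simp add: step_machine idle_acts del: step.simps)
  then show ?case
    using exec_Cond_neq.IH by (simp del: step.simps funpow.simps(2) add: funpow_Suc_right)
next
  case (exec_Loop_eq r ts a c)
  then show ?case by (simp add: step_machine idle_acts del: step.simps)
next
  case (exec_Loop_neq r ts a c t ts' t' ts'')
  have "step (machine c0 k) (to_nat (Loop r a c # cs), ts) = (to_nat (c # Loop r a c # cs), ts)"
    using exec_Loop_neq by (simp add: step_machine idle_acts del: step.simps)
  then show ?case
    using exec_Loop_neq.IH by (simp add: funpow_add add.commute[of t] del: step.simps funpow.simps(2) add: funpow_Suc_right)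
qed

lemma funpow_step_halt: "fst C = halt M \<Longrightarrow> (step M ^^ n) C = C"
  by (induction n) (cases C, auto)+

lemma poly_time_exec:
  fixes p :: "nat poly"
  assumes k: "k \<ge> 1"
    and ex: "\<And>x. \<exists>t ts. t \<le> poly p (length x) \<and>
      exec c ((written x, 0) # replicate (k - 1) (\<lambda>_. 0, 0)) t ts \<and>
      (\<forall>i\<in>{0..int (length (f x))}. fst (last ts) i = written (f x) i)"
  shows "poly_time f"
proof -
  let ?M = "machine c k"
  have "let C = (step ?M ^^ poly p (length x)) (init ?M x) in fst C = halt ?M \<and> outputs C (f x)" for x
  proof -
    obtain t ts where t: "t \<le> poly p (length x)"
      and e: "exec c ((written x, 0) # replicate (k - 1) (\<lambda>_. 0, 0)) t ts"
      and o: "\<forall>i\<in>{0..int (length (f x))}. fst (last ts) i = written (f x) i"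
      using ex by blast
    have 1: "(step ?M ^^ t) (init ?M x) = (to_nat ([] :: cmd list), ts)"
      using exec_machine[OF e, of c k "[]"] by (simp add: init_def machine_def)
    \<comment> \<open>A halted configuration is a fixed point of \<open>step\<close>, so the steps
      left over up to the polynomial bound change nothing.\<close>
    have "(step ?M ^^ poly p (length x)) (init ?M x) = (to_nat ([] :: cmd list), ts)"
    proof -
      have "(step ?M ^^ ((poly p (length x) - t) + t)) (init ?M x) = (to_nat ([] :: cmd list), ts)"
        unfolding funpow_add o_apply 1 by (rule funpow_step_halt) (simp add: machine_def)
      then show ?thesis using t by simp
    qed
    then show ?thesis using o by (simp add: outputs_def machine_def)
  qed
  then show ?thesis using wf_machine[OF k] unfolding poly_time_def by blast
qed

section \<open>Unary counters\<close>

text \<open>The head stands on the last mark and cell 0 is never marked. Reading a blank is thus the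
  zero test, and a fresh tape already represents 0.\<close>

definition counter :: "nat \<Rightarrow> tape" where
  "counter n = (\<lambda>i. if 1 \<le> i \<and> i \<le> int n then 1 else 0, int n)"

text \<open>The components are the position of the input head, the counter values and the output
  written so far. Tape 0 holds the input, so counter \<open>r\<close> lives on tape
  \<open>Suc r\<close>.\<close>

type_synonym state = "nat \<times> (nat \<Rightarrow> nat) \<times> bool list"

fun tapes :: "nat \<Rightarrow> bool list \<Rightarrow> state \<Rightarrow> tape list" where
  "tapes k w (p, s, y) =
     (written w, int p) # map (\<lambda>r. counter (s r)) [0..<k] @ [(written y, int (length y))]"

definition run :: "nat \<Rightarrow> bool list \<Rightarrow> cmd \<Rightarrow> nat \<Rightarrow> state \<Rightarrow> state \<Rightarrow> bool" where
  "run k w c T a b \<longleftrightarrow> (\<exists>t\<le>T. exec c (tapes k w a) t (tapes k w b))"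

definition skip :: cmd where "skip = Act 0 None Stay"
definition inc :: "nat \<Rightarrow> cmd" where
  "inc r = Seq (Act (Suc r) None Right) (Act (Suc r) (Some 1) Stay)"
definition dec :: "nat \<Rightarrow> cmd" where
  "dec r = Act (Suc r) (Some 0) Left"
definition for_loop :: "nat \<Rightarrow> cmd \<Rightarrow> cmd" where
  "for_loop r c = Loop (Suc r) 0 (Seq (dec r) c)"
definition if_zero :: "nat \<Rightarrow> cmd \<Rightarrow> cmd \<Rightarrow> cmd" where
  "if_zero r c d = Cond (Suc r) 0 c d"
definition input_right :: cmd where "input_right = Act 0 None Right"
definition input_left :: cmd where "input_left = Act 0 None Left"
definition emit :: "nat \<Rightarrow> bool \<Rightarrow> cmd" where
  "emit k b = Act (Suc k) (Some (if b then 2 else 1)) Right"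

lemma length_tapes [simp]: "length (tapes k w a) = k + 2"
  by (cases a) auto

lemma tapes_nth [simp]:
  "tapes k w (p, s, y) ! 0 = (written w, int p)"
  "r < k \<Longrightarrow> tapes k w (p, s, y) ! Suc r = counter (s r)"
  "tapes k w (p, s, y) ! Suc k = (written y, int (length y))"
  by (auto simp: nth_append)

lemma tapes_update:
  "(tapes k w (p, s, y))[0 := (written w, int p')] = tapes k w (p', s, y)"
  "r < k \<Longrightarrow> (tapes k w (p, s, y))[Suc r := counter n] = tapes k w (p, s(r := n), y)"
  "(tapes k w (p, s, y))[Suc k := (written y', int (length y'))] = tapes k w (p, s, y')"
  by (auto intro!: nth_equalityI simp: nth_list_update nth_append nth_Cons split: nat.splits)

lemma scanned_counter [simp]: "scanned (counter n) = 0 \<longleftrightarrow> n = 0"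
  by (auto simp: counter_def)

lemma run_mono: "run k w c T a b \<Longrightarrow> T \<le> T' \<Longrightarrow> run k w c T' a b"
  unfolding run_def by (meson le_trans)

lemma run_Seq: "run k w c T a b \<Longrightarrow> run k w d T' b b' \<Longrightarrow> run k w (Seq c d) (T + T' + 1) a b'"
  unfolding run_def using exec_Seq by (metis Suc_eq_plus1 add_le_mono Suc_le_mono)

lemma run_skip: "run k w skip 1 a a"
proof -
  obtain p s y where a: "a = (p, s, y)" by (cases a)
  show ?thesis
    using exec_Act[of 0 "tapes k w a" None Stay]
    unfolding a run_def skip_def by (auto simp: tapes_update simp del: tapes.simps)
qed

lemma run_inc:
  assumes "r < k"
  shows "run k w (inc r) 3 (p, s, y) (p, s(r := Suc (s r)), y)"
proof -
  let ?t = "tapes k w (p, s, y)"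
  let ?T = "(fst (counter (s r)), int (s r) + 1)"
  have "exec (Act (Suc r) None Right) ?t 1 (?t[Suc r := ?T])"
  proof -
    have "act (scanned (counter (s r)), Right) (counter (s r)) = ?T"
      by (simp add: counter_def fun_upd_idem)
    then show ?thesis
      using exec_Act[of "Suc r" ?t None Right] assms by (simp del: tapes.simps)
  qed
  moreover have "exec (Act (Suc r) (Some 1) Stay) (?t[Suc r := ?T]) 1 (?t[Suc r := counter (Suc (s r))])"
  proof -
    have "act (1, Stay) ?T = counter (Suc (s r))"
      by (auto simp: counter_def fun_eq_iff)
    then show ?thesis
      using exec_Act[of "Suc r" "?t[Suc r := ?T]" "Some 1" Stay] assms by (simp del: tapes.simps)
  qed
  ultimately have "exec (inc r) ?t (Suc (1 + 1)) (?t[Suc r := counter (Suc (s r))])"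
    unfolding inc_def by (rule exec_Seq)
  then show ?thesis
    unfolding run_def using assms
    by (intro exI[of _ "Suc (1 + 1)"]) (auto simp: tapes_update simp del: tapes.simps)
qed

lemma run_dec:
  assumes "r < k" "s r > 0"
  shows "run k w (dec r) 1 (p, s, y) (p, s(r := s r - 1), y)"
proof -
  let ?t = "tapes k w (p, s, y)"
  have "act (0, Left) (counter (s r)) = counter (s r - 1)"
    using assms(2) by (auto simp: counter_def fun_eq_iff)
  then have "exec (dec r) ?t 1 (?t[Suc r := counter (s r - 1)])"
    unfolding dec_def using exec_Act[of "Suc r" ?t "Some 0" Left] assms
    by (simp del: tapes.simps)
  then show ?thesis
    unfolding run_def using assms by (auto simp: tapes_update simp del: tapes.simps)
qed

lemma run_input_right: "run k w input_right 1 (p, s, y) (Suc p, s, y)"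
  using exec_Act[of 0 "tapes k w (p, s, y)" None Right] tapes_update(1)[of k w p s y "Suc p"]
  unfolding run_def input_right_def by (auto simp: add.commute simp del: tapes.simps)

lemma run_input_left: "run k w input_left 1 (Suc p, s, y) (p, s, y)"
  using exec_Act[of 0 "tapes k w (Suc p, s, y)" None Left] tapes_update(1)[of k w "Suc p" s y p]
  unfolding run_def input_left_def by (auto simp del: tapes.simps)

lemma run_emit: "run k w (emit k b) 1 (p, s, y) (p, s, y @ [b])"
proof -
  have "act (if b then 2 else 1, Right) (written y, int (length y)) =
      (written (y @ [b]), int (length (y @ [b])))"
    by (auto simp: written_def fun_eq_iff nth_append)
  then show ?thesis
    using exec_Act[of "Suc k" "tapes k w (p, s, y)" "Some (if b then 2 else 1)" Right]
      tapes_update(3)[of k w p s y "y @ [b]"]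
    unfolding run_def emit_def by (auto simp del: tapes.simps act.simps)
qed

lemma run_if_zero:
  assumes "r < k" "run k w (if s r = 0 then c else d) T (p, s, y) b"
  shows "run k w (if_zero r c d) (Suc T) (p, s, y) b"
  using assms exec_Cond_eq[of "Suc r" "tapes k w (p, s, y)" 0] exec_Cond_neq[of "Suc r" "tapes k w (p, s, y)" 0]
  unfolding run_def if_zero_def by (auto split: if_splits simp del: tapes.simps)

lemma run_Cond_input:
  assumes "run k w (if written w (int p) = a then c else d) T (p, s, y) b"
  shows "run k w (Cond 0 a c d) (Suc T) (p, s, y) b"
  using assms exec_Cond_eq[of 0 "tapes k w (p, s, y)" a] exec_Cond_neq[of 0 "tapes k w (p, s, y)" a]
  unfolding run_def by (auto split: if_splits simp del: tapes.simps)

lemma run_Loop_eq: "a = (p, s, y) \<Longrightarrow> r < k \<Longrightarrow> s r = 0 \<Longrightarrow> run k w (Loop (Suc r) 0 c) 1 a a"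
  using exec_Loop_eq[of "Suc r" "tapes k w (p, s, y)" 0]
  unfolding run_def by (auto simp del: tapes.simps)

text \<open>The loop uses up its counter, and the decrement precedes the body, so round
  \<open>i\<close> sees the value \<open>n - Suc i\<close>. The overhead 3 per round is the loop
  test, the decrement and the \<open>Seq\<close>.\<close>

lemma run_for_loop:
  assumes r: "r < k"
    and body: "\<And>i. i < n \<Longrightarrow>
      run k w c T (p i, (s i)(r := n - Suc i), y i) (p (Suc i), (s (Suc i))(r := n - Suc i), y (Suc i))"
  shows "run k w (for_loop r c) ((T + 3) * n + 1) (p 0, (s 0)(r := n), y 0) (p n, (s n)(r := 0), y n)"
proof -
  \<comment> \<open>\<open>j\<close> counts the rounds still to come, because \<open>exec\<close>
    unfolds a loop from its first round.\<close>
  have "run k w (for_loop r c) ((T + 3) * j + 1) (p (n - j), (s (n - j))(r := j), y (n - j)) (p n, (s n)(r := 0), y n)"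
    if "j \<le> n" for j
    using that
  proof (induction j)
    case 0
    have "run k w (Loop (Suc r) 0 (Seq (dec r) c)) 1 (p n, (s n)(r := 0), y n) (p n, (s n)(r := 0), y n)"
      by (rule run_Loop_eq[OF refl r]) simp
    then show ?case by (simp add: for_loop_def del: fun_upd_apply)
  next
    case (Suc j)
    let ?a = "(p (n - Suc j), (s (n - Suc j))(r := Suc j), y (n - Suc j))"
    have S: "Suc (n - Suc j) = n - j" and S': "n - Suc (n - Suc j) = j" using Suc.prems by auto
    have "run k w (dec r) 1 ?a (p (n - Suc j), (s (n - Suc j))(r := j), y (n - Suc j))"
      using run_dec[of r k "(s (n - Suc j))(r := Suc j)"] r by simp
    from run_Seq[OF this, of c T "(p (n - j), (s (n - j))(r := j), y (n - j))"]
    have "run k w (Seq (dec r) c) (1 + T + 1) ?a (p (n - j), (s (n - j))(r := j), y (n - j))"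
      using body[of "n - Suc j"] Suc.prems unfolding S S' by simp
    then obtain t where t: "t \<le> T + 2"
      "exec (Seq (dec r) c) (tapes k w ?a) t (tapes k w (p (n - j), (s (n - j))(r := j), y (n - j)))"
      unfolding run_def by auto
    moreover obtain t' where t': "t' \<le> (T + 3) * j + 1"
      "exec (for_loop r c) (tapes k w (p (n - j), (s (n - j))(r := j), y (n - j))) t' (tapes k w (p n, (s n)(r := 0), y n))"
      using Suc unfolding run_def by auto
    ultimately have "exec (for_loop r c) (tapes k w ?a) (Suc (t + t')) (tapes k w (p n, (s n)(r := 0), y n))"
      unfolding for_loop_def using r by (intro exec_Loop_neq) (auto simp del: tapes.simps)
    moreover have "Suc (t + t') \<le> (T + 3) * Suc j + 1"
      using t(1) t'(1) by simp
    ultimately show ?case unfolding run_def by blast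
  qed
  from this[of n] show ?thesis by simp
qed

text \<open>Both counters record the length; the second one is spent on bringing the input head back
  to cell 0.\<close>

definition input_len :: "nat \<Rightarrow> cmd" where
  "input_len r = Seq (Loop 0 0 (Seq input_right (Seq (inc r) (inc (Suc r))))) (for_loop (Suc r) input_left)"

lemma run_input_scan:
  assumes "Suc r < k"
  shows "run k w (Loop 0 0 (Seq input_right (Seq (inc r) (inc (Suc r))))) (10 * length w + 1)
    (0, s(r := 0, Suc r := 0), y) (length w, s(r := length w, Suc r := length w), y)"
proof -
  let ?c = "Seq input_right (Seq (inc r) (inc (Suc r)))"
  let ?s = "\<lambda>i. (i, s(r := i, Suc r := i), y)"
  have "run k w (Loop 0 0 ?c) (10 * j + 1) (?s (length w - j)) (?s (length w))" if "j \<le> length w" for j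
    using that
  proof (induction j)
    case 0
    have "exec (Loop 0 0 ?c) (tapes k w (?s (length w))) 1 (tapes k w (?s (length w)))"
      by (intro exec_Loop_eq) (auto simp: written_def simp del: tapes.simps)
    then show ?case unfolding run_def by auto
  next
    case (Suc j)
    let ?i = "length w - Suc j"
    have "run k w ?c (1 + (3 + 3 + 1) + 1) (?s ?i) (?s (Suc ?i))"
    proof (intro run_Seq)
      show "run k w input_right 1 (?s ?i) (Suc ?i, s(r := ?i, Suc r := ?i), y)"
        by (rule run_input_right)
      show "run k w (inc r) 3 (Suc ?i, s(r := ?i, Suc r := ?i), y) (Suc ?i, s(r := Suc ?i, Suc r := ?i), y)"
        using run_inc[of r k w "Suc ?i" "s(r := ?i, Suc r := ?i)" y] assms
        by (simp add: fun_upd_twist)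
      show "run k w (inc (Suc r)) 3 (Suc ?i, s(r := Suc ?i, Suc r := ?i), y) (?s (Suc ?i))"
        using run_inc[of "Suc r" k w "Suc ?i" "s(r := Suc ?i, Suc r := ?i)" y] assms
        by simp
    qed
    moreover have "Suc ?i = length w - j" using Suc.prems by simp
    ultimately obtain t where t: "t \<le> 9" "exec ?c (tapes k w (?s ?i)) t (tapes k w (?s (length w - j)))"
      unfolding run_def by auto
    moreover obtain t' where t': "t' \<le> 10 * j + 1"
      "exec (Loop 0 0 ?c) (tapes k w (?s (length w - j))) t' (tapes k w (?s (length w)))"
      using Suc unfolding run_def by auto
    ultimately have "exec (Loop 0 0 ?c) (tapes k w (?s ?i)) (Suc (t + t')) (tapes k w (?s (length w)))"
      using Suc.prems by (intro exec_Loop_neq) (auto simp: written_def simp del: tapes.simps)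
    then show ?case using t(1) t'(1) unfolding run_def by (intro exI[of _ "Suc (t + t')"]) auto
  qed
  from this[of "length w"] show ?thesis by simp
qed

lemma run_input_len:
  assumes "Suc r < k"
  shows "run k w (input_len r) (20 * length w + 3)
    (0, s(r := 0, Suc r := 0), y) (0, s(r := length w, Suc r := 0), y)"
proof -
  let ?n = "length w"
  have "run k w (for_loop (Suc r) input_left) ((1 + 3) * ?n + 1)
     (?n - 0, (s(r := ?n))(Suc r := ?n), y) (?n - ?n, (s(r := ?n))(Suc r := 0), y)"
  proof (rule run_for_loop)
    fix i assume "i < ?n"
    then have "?n - i = Suc (?n - Suc i)" by simp
    then show "run k w input_left 1 (?n - i, (s(r := ?n))(Suc r := ?n - Suc i), y)
      (?n - Suc i, (s(r := ?n))(Suc r := ?n - Suc i), y)"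
      by (metis run_input_left)
  qed (use assms in auto)
  then have "run k w (for_loop (Suc r) input_left) ((1 + 3) * ?n + 1)
     (?n, s(r := ?n, Suc r := ?n), y) (0, s(r := ?n, Suc r := 0), y)"
    by simp
  from run_Seq[OF run_input_scan[OF assms, of w s y] this]
  have "run k w (input_len r) (10 * ?n + 1 + ((1 + 3) * ?n + 1) + 1)
    (0, s(r := 0, Suc r := 0), y) (0, s(r := ?n, Suc r := 0), y)"
    unfolding input_len_def .
  then show ?thesis by (rule run_mono) simp
qed

section \<open>Definable functions\<close>

lemma run_for_loop':
  assumes r: "r < k" and n: "s r = n" and s: "s = (S 0)(r := n)" "p = P 0" "y = Y 0"
    and body: "\<And>i. i < n \<Longrightarrow>
      run k w c T (P i, (S i)(r := n - Suc i), Y i) (P (Suc i), (S (Suc i))(r := n - Suc i), Y (Suc i))"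
    and fin: "p' = P n" "s' = (S n)(r := 0)" "y' = Y n" and T': "(T + 3) * n + 1 \<le> T'"
  shows "run k w (for_loop r c) T' (p, s, y) (p', s', y')"
  unfolding s fin by (rule run_mono[OF run_for_loop[OF r body] T'])

lemma run_add:
  assumes "r < k" "b < k" "r \<noteq> b" "6 * s r + 1 \<le> T"
  shows "run k w (for_loop r (inc b)) T (p, s, y) (p, s(b := s b + s r, r := 0), y)"
proof (rule run_for_loop'[where S = "\<lambda>i. s(b := s b + i)" and P = "\<lambda>_. p" and Y = "\<lambda>_. y" and T = 3])
  fix i assume "i < s r"
  show "run k w (inc b) 3 (p, (s(b := s b + i))(r := s r - Suc i), y)
      (p, (s(b := s b + Suc i))(r := s r - Suc i), y)"
    using run_inc[of b k w p "(s(b := s b + i))(r := s r - Suc i)" y] assms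
    by (simp add: fun_upd_twist)
qed (use assms in \<open>auto simp: fun_eq_iff\<close>)

lemma run_clear:
  assumes "r < k" "4 * s r + 1 \<le> T"
  shows "run k w (for_loop r skip) T (p, s, y) (p, s(r := 0), y)"
proof (rule run_for_loop'[where S = "\<lambda>i. s" and P = "\<lambda>_. p" and Y = "\<lambda>_. y" and T = 1])
  fix i assume "i < s r"
  show "run k w skip 1 (p, s(r := s r - Suc i), y) (p, s(r := s r - Suc i), y)"
    by (rule run_skip)
qed (use assms in \<open>auto simp: fun_eq_iff\<close>)

lemma run_sub:
  assumes "r < k" "b < k" "r \<noteq> b" "5 * s r + 1 \<le> T"
  shows "run k w (for_loop r (if_zero b skip (dec b))) T (p, s, y) (p, s(b := s b - s r, r := 0), y)"
proof (rule run_for_loop'[where S = "\<lambda>i. s(b := s b - i)" and P = "\<lambda>_. p" and Y = "\<lambda>_. y" and T = "Suc 1"])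
  fix i assume "i < s r"
  let ?s = "(s(b := s b - i))(r := s r - Suc i)"
  let ?s' = "(s(b := s b - Suc i))(r := s r - Suc i)"
  show "run k w (if_zero b skip (dec b)) (Suc 1) (p, ?s, y) (p, ?s', y)"
  proof (rule run_if_zero)
    show "run k w (if ?s b = 0 then skip else dec b) 1 (p, ?s, y) (p, ?s', y)"
    proof (cases "?s b = 0")
      case True
      then have "?s' = ?s" using assms by (auto simp: fun_eq_iff)
      then show ?thesis using True run_skip[of k w "(p, ?s, y)"] by simp
    next
      case False
      then have "?s' = ?s(b := ?s b - 1)" using assms by (auto simp: fun_eq_iff)
      then show ?thesis using False run_dec[of b k ?s w p y] assms by simp
    qed
  qed (use assms in auto)
qed (use assms in \<open>auto simp: fun_eq_iff\<close>)

text \<open>Reading a counter destroys it. It is therefore emptied into two counters, one of which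
  is then emptied back.\<close>

lemma run_copy:
  assumes "r < b" "Suc b < k" "s b = 0" "s (Suc b) = 0"
  shows "run k w (Seq (for_loop r (Seq (inc b) (inc (Suc b)))) (for_loop (Suc b) (inc r)))
    (16 * s r + 3) (p, s, y) (p, s(b := s r), y)"
proof -
  let ?s = "s(b := s r, Suc b := s r, r := 0)"
  have "run k w (for_loop r (Seq (inc b) (inc (Suc b)))) (10 * s r + 1) (p, s, y) (p, ?s, y)"
  proof (rule run_for_loop'[where S = "\<lambda>i. s(b := i, Suc b := i)" and P = "\<lambda>_. p" and Y = "\<lambda>_. y" and T = "3 + 3 + 1"])
    fix i assume "i < s r"
    let ?u = "\<lambda>i j. (s(b := i, Suc b := j))(r := s r - Suc i)"
    have "run k w (inc b) 3 (p, (s(b := i, Suc b := i))(r := s r - Suc i), y)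
       (p, (s(b := Suc i, Suc b := i))(r := s r - Suc i), y)"
      using run_inc[of b k w p "(s(b := i, Suc b := i))(r := s r - Suc i)" y] assms
      by (simp add: fun_upd_twist)
    moreover have "run k w (inc (Suc b)) 3 (p, (s(b := Suc i, Suc b := i))(r := s r - Suc i), y)
       (p, (s(b := Suc i, Suc b := Suc i))(r := s r - Suc i), y)"
      using run_inc[of "Suc b" k w p "(s(b := Suc i, Suc b := i))(r := s r - Suc i)" y] assms
      by (simp add: fun_upd_twist)
    ultimately show "run k w (Seq (inc b) (inc (Suc b))) (3 + 3 + 1) (p, (s(b := i, Suc b := i))(r := s r - Suc i), y)
       (p, (s(b := Suc i, Suc b := Suc i))(r := s r - Suc i), y)"
      by (rule run_Seq)
  qed (use assms in \<open>auto simp: fun_eq_iff\<close>)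
  moreover have "run k w (for_loop (Suc b) (inc r)) (6 * s r + 1) (p, ?s, y) (p, s(b := s r), y)"
  proof -
    have "?s(r := ?s r + ?s (Suc b), Suc b := 0) = s(b := s r)"
      using assms by (auto simp: fun_eq_iff)
    then show ?thesis
      using run_add[of "Suc b" k r ?s "6 * s r + 1" w p y] assms by (simp del: fun_upd_apply add: fun_upd_same fun_upd_other)
  qed
  ultimately have "run k w (Seq (for_loop r (Seq (inc b) (inc (Suc b)))) (for_loop (Suc b) (inc r)))
    (10 * s r + 1 + (6 * s r + 1) + 1) (p, s, y) (p, s(b := s r), y)"
    by (rule run_Seq)
  then show ?thesis by (rule run_mono) simp
qed

text \<open>The index in \<open>b\<close> is used up while the head walks to the bit, and counter
  \<open>Suc b\<close> remembers the way back. Beyond the input the head sees a blank, which counts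
  as 0.\<close>

lemma run_input_bit:
  assumes "Suc b < k" "s (Suc b) = 0"
  shows "run k w
     (Seq (for_loop b (Seq (inc (Suc b)) input_right))
       (Seq (Cond 0 2 (inc b) skip) (for_loop (Suc b) input_left)))
     (12 * s b + 9) (0, s, y) (0, s(b := of_bool (s b < length w \<and> w ! s b)), y)"
proof -
  let ?n = "s b" and ?v = "of_bool (s b < length w \<and> w ! s b) :: nat"
  have 1: "run k w (for_loop b (Seq (inc (Suc b)) input_right)) (8 * ?n + 1) (0, s, y)
      (?n, s(Suc b := ?n, b := 0), y)"
  proof (rule run_for_loop'[where S = "\<lambda>i. s(Suc b := i)" and P = "\<lambda>i. i" and Y = "\<lambda>_. y" and T = "3 + 1 + 1"])
    fix i assume "i < ?n"
    have "run k w (inc (Suc b)) 3 (i, (s(Suc b := i))(b := ?n - Suc i), y)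
       (i, (s(Suc b := Suc i))(b := ?n - Suc i), y)"
      using run_inc[of "Suc b" k w i "(s(Suc b := i))(b := ?n - Suc i)" y] assms
      by (simp add: fun_upd_twist)
    from run_Seq[OF this run_input_right]
    show "run k w (Seq (inc (Suc b)) input_right) (3 + 1 + 1) (i, (s(Suc b := i))(b := ?n - Suc i), y)
       (Suc i, (s(Suc b := Suc i))(b := ?n - Suc i), y)" .
  qed (use assms in \<open>auto simp: fun_eq_iff\<close>)
  have 2: "run k w (Cond 0 2 (inc b) skip) (Suc 3) (?n, s(Suc b := ?n, b := 0), y)
      (?n, s(Suc b := ?n, b := ?v), y)"
  proof (rule run_Cond_input)
    let ?s = "s(Suc b := ?n, b := 0)"
    have *: "(written w (int ?n) = 2) = (s b < length w \<and> w ! s b)"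
      by (simp add: written_def)
    show "run k w (if written w (int ?n) = 2 then inc b else skip) 3 (?n, ?s, y) (?n, s(Suc b := ?n, b := ?v), y)"
      unfolding *
      using run_inc[of b k w ?n ?s y] run_mono[OF run_skip[of k w "(?n, ?s, y)"], of 3] assms
      by (simp add: fun_upd_twist)
  qed
  have 3: "run k w (for_loop (Suc b) input_left) (4 * ?n + 1) (?n, s(Suc b := ?n, b := ?v), y)
      (0, s(b := ?v), y)"
  proof (rule run_for_loop'[where S = "\<lambda>i. s(b := ?v)" and P = "\<lambda>i. ?n - i" and Y = "\<lambda>_. y" and T = 1])
    fix i assume "i < (s(Suc b := ?n, b := ?v)) (Suc b)"
    then have "?n - i = Suc (?n - Suc i)" by auto
    then show "run k w input_left 1
        (?n - i, (s(b := ?v))(Suc b := (s(Suc b := ?n, b := ?v)) (Suc b) - Suc i), y)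
        (?n - Suc i, (s(b := ?v))(Suc b := (s(Suc b := ?n, b := ?v)) (Suc b) - Suc i), y)"
      using run_input_left by metis
  qed (use assms in \<open>auto simp: fun_eq_iff\<close>)
  show ?thesis
    by (rule run_mono[OF run_Seq[OF 1 run_Seq[OF 2 3]]]) simp
qed

text \<open>The bounded-arithmetic terms in a shallow embedding: \<open>w\<close> is the input and
  \<open>e\<close> the environment of de Bruijn variables. A sum binds variable 0, which
  \<open>case_nat\<close> pushes onto the environment.\<close>

inductive definable :: "(bool list \<Rightarrow> (nat \<Rightarrow> nat) \<Rightarrow> nat) \<Rightarrow> bool" where
  definable_var: "definable (\<lambda>w e. e i)"
| definable_one: "definable (\<lambda>w e. 1)"
| definable_length: "definable (\<lambda>w e. length w)"
| definable_bit: "definable f \<Longrightarrow> definable (\<lambda>w e. of_bool (f w e < length w \<and> w ! f w e))"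
| definable_add: "definable f \<Longrightarrow> definable g \<Longrightarrow> definable (\<lambda>w e. f w e + g w e)"
| definable_diff: "definable f \<Longrightarrow> definable g \<Longrightarrow> definable (\<lambda>w e. f w e - g w e)"
| definable_sum: "definable f \<Longrightarrow> definable g \<Longrightarrow>
    definable (\<lambda>w e. \<Sum>i<f w e. g w (case_nat i e))"

text \<open>Counters are unary, so running times are governed by the values of terms. These stay
  polynomial because the length of a sum is itself a bounded term and the term is fixed.\<close>

lemma definable_bound:
  "definable f \<Longrightarrow>
    \<exists>q :: nat poly. \<forall>w e m. length w \<le> m \<longrightarrow> (\<forall>i. e i \<le> m) \<longrightarrow> f w e \<le> poly q m"
proof (induction rule: definable.induct)
  case (definable_var i)
  show ?case by (rule exI[of _ "[:0, 1:]"]) auto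
next
  case definable_one
  show ?case by (rule exI[of _ "[:1:]"]) auto
next
  case definable_length
  show ?case by (rule exI[of _ "[:0, 1:]"]) auto
next
  case (definable_bit f)
  show ?case by (rule exI[of _ "[:1:]"]) auto
next
  case (definable_add f g)
  then obtain p q :: "nat poly" where "\<forall>w e m. length w \<le> m \<longrightarrow> (\<forall>i. e i \<le> m) \<longrightarrow> f w e \<le> poly p m"
    "\<forall>w e m. length w \<le> m \<longrightarrow> (\<forall>i. e i \<le> m) \<longrightarrow> g w e \<le> poly q m" by blast
  then show ?case by (intro exI[of _ "p + q"]) (auto intro: add_mono)
next
  case (definable_diff f g)
  then obtain p :: "nat poly" where "\<forall>w e m. length w \<le> m \<longrightarrow> (\<forall>i. e i \<le> m) \<longrightarrow> f w e \<le> poly p m"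
    by blast
  then show ?case by (intro exI[of _ p]) (meson diff_le_self le_trans)
next
  case (definable_sum f g)
  then obtain p q :: "nat poly" where p: "\<And>w e m. length w \<le> m \<Longrightarrow> (\<forall>i. e i \<le> m) \<Longrightarrow> f w e \<le> poly p m"
    and q: "\<And>w e m. length w \<le> m \<Longrightarrow> (\<forall>i. e i \<le> m) \<Longrightarrow> g w e \<le> poly q m" by meson
  \<comment> \<open>Inside the sum the bound variable may be as large as \<open>poly p m\<close>, so
    the bound for \<open>g\<close> is evaluated at \<open>m + poly p m\<close>.\<close>
  have "(\<Sum>i<f w e. g w (case_nat i e)) \<le> poly (p * pcompose q ([:0, 1:] + p)) m"
    if w: "length w \<le> m" and e: "\<forall>i. e i \<le> m" for w e m
  proof -
    have f: "f w e \<le> poly p m" by (rule p[OF w e])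
    have "(\<Sum>i<f w e. g w (case_nat i e)) \<le> (\<Sum>i<f w e. poly q (m + poly p m))"
    proof (rule sum_mono)
      fix i assume "i \<in> {..<f w e}"
      then show "g w (case_nat i e) \<le> poly q (m + poly p m)"
        using w e f by (intro q) (auto split: nat.split intro: trans_le_add1)
    qed
    also have "\<dots> \<le> poly p m * poly q (m + poly p m)" using f by simp
    finally show ?thesis by (simp add: poly_pcompose)
  qed
  then show ?case by blast
qed

text \<open>Variable \<open>i\<close> is stored in counter \<open>loc i\<close>. The counters from
  \<open>b\<close> on are free scratch space; the result lands in \<open>b\<close>, and everything
  else is restored. \<open>K\<close> is the number of counters that suffice.\<close>

definition computes ::
  "(bool list \<Rightarrow> (nat \<Rightarrow> nat) \<Rightarrow> nat) \<Rightarrow> (nat \<Rightarrow> nat) \<Rightarrow> nat \<Rightarrow> cmd \<Rightarrow> nat \<Rightarrow> nat poly \<Rightarrow> bool" where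
  "computes f loc b c K q \<longleftrightarrow>
     (\<forall>k\<ge>K. \<forall>w s y m. (\<forall>r\<ge>b. s r = 0) \<longrightarrow> length w \<le> m \<longrightarrow> (\<forall>i. s (loc i) \<le> m) \<longrightarrow>
        run k w c (poly q m) (0, s, y) (0, s(b := f w (\<lambda>i. s (loc i))), y))"

lemma computesD:
  assumes "computes f loc b c K q" "K \<le> k" "\<And>r. r \<ge> b \<Longrightarrow> s r = 0" "length w \<le> m" "\<And>i. s (loc i) \<le> m"
    "poly q m \<le> T"
  shows "run k w c T (0, s, y) (0, s(b := f w (\<lambda>i. s (loc i))), y)"
proof -
  have "run k w c (poly q m) (0, s, y) (0, s(b := f w (\<lambda>i. s (loc i))), y)"
    using assms(1-5) unfolding computes_def by simp
  then show ?thesis using assms(6) by (rule run_mono)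
qed

text \<open>Counter \<open>b\<close> accumulates the sum, \<open>b + 1\<close> holds the rounds
  left, \<open>b + 2\<close> the bound variable, and \<open>b + 3\<close> receives each summand
  before it is added to \<open>b\<close>.\<close>

lemma computes_sum:
  assumes loc: "\<And>i. loc i < b"
    and cf: "computes f loc (b + 1) cf Kf qf"
    and cg: "computes g (case_nat (b + 2) loc) (b + 3) cg Kg qg"
    and vf: "\<And>w e m. length w \<le> m \<Longrightarrow> (\<And>i. e i \<le> m) \<Longrightarrow> f w e \<le> poly pf m"
    and vg: "\<And>w e m. length w \<le> m \<Longrightarrow> (\<And>i. e i \<le> m) \<Longrightarrow> g w e \<le> poly pg m"
  shows "computes (\<lambda>w e. \<Sum>i<f w e. g w (case_nat i e)) loc b
    (Seq cf (Seq (for_loop (b + 1) (Seq cg (Seq (for_loop (b + 3) (inc b)) (inc (b + 2)))))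
      (for_loop (b + 2) skip)))
    (Kf + Kg + b + 4)
    (qf + (pcompose qg ([:0, 1:] + pf) + [:6:] * pcompose pg ([:0, 1:] + pf) + [:9:]) * pf + [:4:] * pf + [:4:])"
  unfolding computes_def
proof (intro allI impI)
  fix k and w :: "bool list" and s :: "nat \<Rightarrow> nat" and y m
  assume k: "Kf + Kg + b + 4 \<le> k" and z: "\<forall>r\<ge>b. s r = 0" and w: "length w \<le> m" and sm: "\<forall>i. s (loc i) \<le> m"
  let ?e = "\<lambda>i. s (loc i)"
  let ?n = "f w ?e" and ?m = "m + poly pf m"
  let ?S = "\<lambda>i. s(b := \<Sum>j<i. g w (case_nat j ?e), b + 2 := i)"
  let ?T = "poly qg ?m + (6 * poly pg ?m + 1 + 3 + 1) + 1"
  have n: "?n \<le> poly pf m" by (rule vf[OF w]) (use sm in simp)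
  have 1: "run k w cf (poly qf m) (0, s, y) (0, s(b + 1 := ?n), y)"
    using computesD[OF cf, of k s w m "poly qf m" y] k z w sm by simp
  have 2: "run k w (for_loop (b + 1) (Seq cg (Seq (for_loop (b + 3) (inc b)) (inc (b + 2)))))
      ((?T + 3) * poly pf m + 1) (0, s(b + 1 := ?n), y) (0, (?S ?n)(b + 1 := 0), y)"
  proof (rule run_for_loop'[where S = ?S and P = "\<lambda>_. 0" and Y = "\<lambda>_. y" and T = ?T])
    fix i assume i: "i < ?n"
    let ?s = "(?S i)(b + 1 := ?n - Suc i)"
    have env: "(\<lambda>j. ?s (case_nat (b + 2) loc j)) = case_nat i ?e"
    proof
      fix j show "?s (case_nat (b + 2) loc j) = case_nat i ?e j"
        using loc[of "j - 1"] by (cases j) auto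
    qed
    have env_le: "case_nat i ?e j \<le> ?m" for j
      using sm i n by (cases j) (auto intro: trans_le_add1)
    let ?v = "g w (case_nat i ?e)"
    have v: "?v \<le> poly pg ?m" by (rule vg) (use w env_le in \<open>auto intro: trans_le_add1\<close>)
    have A: "run k w cg (poly qg ?m) (0, ?s, y) (0, ?s(b + 3 := ?v), y)"
      using computesD[OF cg, of k ?s w ?m "poly qg ?m" y] k z w env_le unfolding fun_cong[OF env] env
      by (auto intro: trans_le_add1)
    have B: "run k w (for_loop (b + 3) (inc b)) (6 * poly pg ?m + 1) (0, ?s(b + 3 := ?v), y)
        (0, ?s(b := ?s b + ?v), y)"
    proof -
      have *: "(?s(b + 3 := ?v))(b := (?s(b + 3 := ?v)) b + (?s(b + 3 := ?v)) (b + 3), b + 3 := 0) =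
          ?s(b := ?s b + ?v)"
        using z by (auto simp: fun_eq_iff)
      show ?thesis
        using run_add[of "b + 3" k b "?s(b + 3 := ?v)" "6 * poly pg ?m + 1" w 0 y] k v
        unfolding * by simp
    qed
    have C: "run k w (inc (b + 2)) 3 (0, ?s(b := ?s b + ?v), y) (0, (?S (Suc i))(b + 1 := ?n - Suc i), y)"
    proof -
      let ?u = "?s(b := ?s b + ?v)"
      have *: "?u(b + 2 := Suc (?u (b + 2))) = (?S (Suc i))(b + 1 := ?n - Suc i)"
        by (auto simp: fun_eq_iff)
      show ?thesis using run_inc[of "b + 2" k w 0 ?u y] k unfolding * by simp
    qed
    have "?n = (s(b + 1 := ?n)) (b + 1)" by simp
    show "run k w (Seq cg (Seq (for_loop (b + 3) (inc b)) (inc (b + 2)))) ?T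
        (0, (?S i)(b + 1 := ?n - Suc i), y) (0, (?S (Suc i))(b + 1 := ?n - Suc i), y)"
      using run_Seq[OF A run_Seq[OF B C]] .
  qed (use k z n in \<open>auto simp: fun_eq_iff intro!: mult_le_mono2\<close>)
  let ?u = "(?S ?n)(b + 1 := 0)"
  have 3: "run k w (for_loop (b + 2) skip) (4 * poly pf m + 1) (0, ?u, y) (0, ?u(b + 2 := 0), y)"
    using k n by (intro run_clear) auto
  have *: "?u(b + 2 := 0) = s(b := \<Sum>j<?n. g w (case_nat j ?e))"
    using z by (auto simp: fun_eq_iff)
  show "run k w (Seq cf (Seq (for_loop (b + 1) (Seq cg (Seq (for_loop (b + 3) (inc b)) (inc (b + 2)))))
      (for_loop (b + 2) skip)))
     (poly (qf + (pcompose qg ([:0, 1:] + pf) + [:6:] * pcompose pg ([:0, 1:] + pf) + [:9:]) * pf + [:4:] * pf + [:4:]) m)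
     (0, s, y) (0, s(b := \<Sum>j<?n. g w (case_nat j ?e)), y)"
    by (rule run_mono[OF run_Seq[OF 1 run_Seq[OF 2 3[unfolded *]]]]) (simp add: poly_pcompose algebra_simps)
qed

text \<open>Common to addition and truncated subtraction: the operands are placed in
  \<open>b\<close> and \<open>b + 1\<close>, and \<open>d'\<close> combines them into
  \<open>b\<close> while using up \<open>b + 1\<close>.\<close>

lemma computes_binary:
  assumes loc: "\<And>i. loc i < b" and g: "definable g"
    and "\<exists>c K q. computes f loc b c K q" "\<exists>c K q. computes g loc (b + 1) c K q"
    and op: "\<And>k w s y. b + 2 \<le> k \<Longrightarrow>
      run k w d' (a * s (b + 1) + 1) (0, s, y) (0, s(b := h (s b) (s (b + 1)), b + 1 := 0), y)"
  shows "\<exists>c K q. computes (\<lambda>w e. h (f w e) (g w e)) loc b c K q"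
proof -
  obtain c K q where c: "computes f loc b c K q" using assms(3) by blast
  obtain d L r where d: "computes g loc (b + 1) d L r" using assms(4) by blast
  obtain p :: "nat poly" where p: "\<And>w e m. length w \<le> m \<Longrightarrow> (\<And>i. e i \<le> m) \<Longrightarrow> g w e \<le> poly p m"
    using definable_bound[OF g] by meson
  have "computes (\<lambda>w e. h (f w e) (g w e)) loc b (Seq c (Seq d d')) (K + L + b + 2)
     (q + r + [:a:] * p + [:3:])"
    unfolding computes_def
  proof (intro allI impI)
    fix k and w :: "bool list" and s :: "nat \<Rightarrow> nat" and y m
    assume k: "K + L + b + 2 \<le> k" and z: "\<forall>r\<ge>b. s r = 0" and w: "length w \<le> m" and sm: "\<forall>i. s (loc i) \<le> m"
    let ?e = "\<lambda>i. s (loc i)"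
    have v: "g w ?e \<le> poly p m" by (rule p[OF w]) (use sm in simp)
    have 1: "run k w c (poly q m) (0, s, y) (0, s(b := f w ?e), y)"
      using computesD[OF c] k z w sm by simp
    have env: "(s(b := f w ?e)) (loc i) = s (loc i)" for i
      using loc[of i] by simp
    have 2: "run k w d (poly r m) (0, s(b := f w ?e), y) (0, s(b := f w ?e, b + 1 := g w ?e), y)"
      using computesD[OF d, of k "s(b := f w ?e)" w m "poly r m" y] k z w sm unfolding env by simp
    let ?u = "s(b := f w ?e, b + 1 := g w ?e)"
    have *: "?u(b := h (?u b) (?u (b + 1)), b + 1 := 0) = s(b := h (f w ?e) (g w ?e))"
      using z by (auto simp: fun_eq_iff)
    have 3: "run k w d' (a * g w ?e + 1) (0, ?u, y) (0, s(b := h (f w ?e) (g w ?e)), y)"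
      using op[of k w ?u y] k unfolding * by simp
    have "a * g w ?e \<le> a * poly p m" using v by (rule mult_le_mono2)
    then show "run k w (Seq c (Seq d d')) (poly (q + r + [:a:] * p + [:3:]) m) (0, s, y)
       (0, s(b := h (f w ?e) (g w ?e)), y)"
      by (intro run_mono[OF run_Seq[OF 1 run_Seq[OF 2 3]]]) simp
  qed
  then show ?thesis by blast
qed

text \<open>\<open>loc\<close> and \<open>b\<close> vary in the induction, since a sum keeps its
  bound variable in a fresh counter and evaluates its body above it.\<close>

lemma definable_computes:
  "definable f \<Longrightarrow> (\<And>i. loc i < b) \<Longrightarrow> \<exists>c K q. computes f loc b c K q"
proof (induction f arbitrary: loc b rule: definable.induct)
  case (definable_var i)
  let ?r = "loc i"
  have "computes (\<lambda>w e. e i) loc b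
    (Seq (for_loop ?r (Seq (inc b) (inc (Suc b)))) (for_loop (Suc b) (inc ?r))) (b + 2) [:3, 16:]"
    unfolding computes_def
  proof (intro allI impI)
    fix k and w :: "bool list" and s :: "nat \<Rightarrow> nat" and y m
    assume k: "b + 2 \<le> k" and z: "\<forall>r\<ge>b. s r = 0" and m: "\<forall>i. s (loc i) \<le> m"
    then show "run k w (Seq (for_loop ?r (Seq (inc b) (inc (Suc b)))) (for_loop (Suc b) (inc ?r)))
      (poly [:3, 16:] m) (0, s, y) (0, s(b := s (loc i)), y)"
      using definable_var[of i] by (intro run_mono[OF run_copy]) auto
  qed
  then show ?case by blast
next
  case definable_one
  have "computes (\<lambda>w e. 1) loc b (inc b) (b + 1) [:3:]"
    unfolding computes_def
  proof (intro allI impI)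
    fix k and w :: "bool list" and s :: "nat \<Rightarrow> nat" and y m
    assume k: "b + 1 \<le> k" and z: "\<forall>r\<ge>b. s r = 0"
    then show "run k w (inc b) (poly [:3:] m) (0, s, y) (0, s(b := 1), y)"
      using run_inc[of b k w 0 s y] by simp
  qed
  then show ?case by blast
next
  case definable_length
  have "computes (\<lambda>w e. length w) loc b (input_len b) (b + 2) [:3, 20:]"
    unfolding computes_def
  proof (intro allI impI)
    fix k and w :: "bool list" and s :: "nat \<Rightarrow> nat" and y m
    assume k: "b + 2 \<le> k" and z: "\<forall>r\<ge>b. s r = 0" and m: "length w \<le> m"
    have *: "s(b := x, Suc b := 0) = s(b := x)" "s(b := 0) = s" "s(Suc b := 0) = s" for x
      using z by (auto simp: fun_eq_iff)
    show "run k w (input_len b) (poly [:3, 20:] m) (0, s, y) (0, s(b := length w), y)"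
      using run_mono[OF run_input_len[of b k w s y], of "poly [:3, 20:] m"] k m unfolding * by simp
  qed
  then show ?case by blast
next
  case (definable_bit f)
  obtain c K q where c: "computes f loc b c K q" using definable_bit.IH[of loc b] definable_bit.prems by blast
  obtain p :: "nat poly" where p: "\<And>w e m. length w \<le> m \<Longrightarrow> (\<And>i. e i \<le> m) \<Longrightarrow> f w e \<le> poly p m"
    using definable_bound[OF definable_bit.hyps] by meson
  let ?c = "Seq (for_loop b (Seq (inc (Suc b)) input_right))
       (Seq (Cond 0 2 (inc b) skip) (for_loop (Suc b) input_left))"
  have "computes (\<lambda>w e. of_bool (f w e < length w \<and> w ! f w e)) loc b (Seq c ?c) (K + b + 2)
     (q + [:12:] * p + [:10:])"
    unfolding computes_def
  proof (intro allI impI)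
    fix k and w :: "bool list" and s :: "nat \<Rightarrow> nat" and y m
    assume k: "K + b + 2 \<le> k" and z: "\<forall>r\<ge>b. s r = 0" and w: "length w \<le> m" and sm: "\<forall>i. s (loc i) \<le> m"
    let ?v = "f w (\<lambda>i. s (loc i))"
    have v: "?v \<le> poly p m" by (rule p[OF w]) (use sm in simp)
    have 1: "run k w c (poly q m) (0, s, y) (0, s(b := ?v), y)"
      using computesD[OF c] k z w sm by simp
    have 2: "run k w ?c (12 * poly p m + 9) (0, s(b := ?v), y)
       (0, s(b := of_bool (?v < length w \<and> w ! ?v)), y)"
      using run_mono[OF run_input_bit[of b k "s(b := ?v)" w y], of "12 * poly p m + 9"] k z v by simp
    show "run k w (Seq c ?c) (poly (q + [:12:] * p + [:10:]) m) (0, s, y)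
       (0, s(b := of_bool (?v < length w \<and> w ! ?v)), y)"
      by (rule run_mono[OF run_Seq[OF 1 2]]) simp
  qed
  then show ?case by blast
next
  case (definable_add f g)
  have op: "run k w (for_loop (b + 1) (inc b)) (6 * s (b + 1) + 1) (0, s, y)
      (0, s(b := (+) (s b) (s (b + 1)), b + 1 := 0), y)" if "b + 2 \<le> k" for k w s y
    using that run_add[of "b + 1" k b s "6 * s (b + 1) + 1" w 0 y] by simp
  show ?case
    by (rule computes_binary[where f = f and g = g and h = "(+)" and a = 6,
          OF definable_add.prems definable_add.hyps(2) definable_add.IH(1)[OF definable_add.prems]
            definable_add.IH(2)[OF trans_less_add1[OF definable_add.prems]] op])
next
  case (definable_diff f g)
  have op: "run k w (for_loop (b + 1) (if_zero b skip (dec b))) (5 * s (b + 1) + 1) (0, s, y)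
      (0, s(b := (-) (s b) (s (b + 1)), b + 1 := 0), y)" if "b + 2 \<le> k" for k w s y
    using that run_sub[of "b + 1" k b s "5 * s (b + 1) + 1" w 0 y] by simp
  show ?case
    by (rule computes_binary[where f = f and g = g and h = "(-)" and a = 5,
          OF definable_diff.prems definable_diff.hyps(2) definable_diff.IH(1)[OF definable_diff.prems]
            definable_diff.IH(2)[OF trans_less_add1[OF definable_diff.prems]] op])
next
  case (definable_sum f g)
  obtain cf Kf qf where cf: "computes f loc (b + 1) cf Kf qf"
    using definable_sum.IH(1)[of loc "b + 1"] definable_sum.prems by (meson trans_less_add1)
  have "case_nat (b + 2) loc i < b + 3" for i
    using definable_sum.prems[of "i - 1"] by (cases i) auto
  then obtain cg Kg qg where cg: "computes g (case_nat (b + 2) loc) (b + 3) cg Kg qg"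
    using definable_sum.IH(2) by blast
  obtain pf :: "nat poly" where pf: "\<And>w e m. length w \<le> m \<Longrightarrow> (\<And>i. e i \<le> m) \<Longrightarrow> f w e \<le> poly pf m"
    using definable_bound[OF definable_sum.hyps(1)] by meson
  obtain pg :: "nat poly" where pg: "\<And>w e m. length w \<le> m \<Longrightarrow> (\<And>i. e i \<le> m) \<Longrightarrow> g w e \<le> poly pg m"
    using definable_bound[OF definable_sum.hyps(2)] by meson
  show ?case
    using computes_sum[OF definable_sum.prems cf cg pf pg] by blast
qed

text \<open>\<open>f\<close> gives the length of the output and \<open>g\<close> its bits. Counter 0
  stays zero and serves as every free variable, counter 1 is the output position, counter 2 drives
  the loop, and counter 3 receives the bit.\<close>

theorem definable_poly_time:
  assumes f: "definable f" and g: "definable g"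
    and F: "\<And>w. F w = map (\<lambda>i. g w (case_nat i (\<lambda>_. 0)) \<noteq> 0) [0..<f w (\<lambda>_. 0)]"
  shows "poly_time F"
proof -
  obtain cf Kf qf where cf: "computes f (\<lambda>_. 0) 2 cf Kf qf"
    using definable_computes[OF f, of "\<lambda>_. 0" 2] by auto
  let ?loc = "case_nat 1 (\<lambda>_. 0) :: nat \<Rightarrow> nat"
  have "?loc i < 3" for i by (cases i) auto
  then obtain cg Kg qg where cg: "computes g ?loc 3 cg Kg qg"
    using definable_computes[OF g, of ?loc 3] by blast
  obtain pf :: "nat poly" where pf: "\<And>w e m. length w \<le> m \<Longrightarrow> (\<And>i. e i \<le> m) \<Longrightarrow> f w e \<le> poly pf m"
    using definable_bound[OF f] by meson
  obtain pg :: "nat poly" where pg: "\<And>w e m. length w \<le> m \<Longrightarrow> (\<And>i. e i \<le> m) \<Longrightarrow> g w e \<le> poly pg m"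
    using definable_bound[OF g] by meson
  let ?k = "Kf + Kg + 4"
  \<comment> \<open>A nonzero value may exceed 1, so counter 3 is cleared by a loop before
    \<open>True\<close> is emitted.\<close>
  let ?body = "Seq cg (Seq (if_zero 3 (emit ?k False) (Seq (for_loop 3 skip) (emit ?k True))) (inc 1))"
  let ?c = "Seq cf (for_loop 2 ?body)"
  let ?q = "qf + (pcompose qg ([:0, 1:] + pf) + [:4:] * pcompose pg ([:0, 1:] + pf) + [:12:]) * pf + [:2:]"
  have main: "run ?k w ?c (poly ?q (length w)) (0, \<lambda>_. 0, [])
      (0, (\<lambda>_. 0)(1 := f w (\<lambda>_. 0)), F w)" for w
  proof -
    let ?m = "length w" and ?n = "f w (\<lambda>_. 0)"
    let ?m' = "?m + poly pf ?m"
    let ?T = "poly qg ?m' + (Suc (4 * poly pg ?m' + 1 + 1 + 1) + 3 + 1) + 1"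
    let ?Y = "\<lambda>i. map (\<lambda>i. g w (case_nat i (\<lambda>_. 0)) \<noteq> 0) [0..<i]"
    let ?S = "\<lambda>i. (\<lambda>_ :: nat. 0 :: nat)(1 := i)"
    have n: "?n \<le> poly pf ?m" by (rule pf) simp_all
    have 1: "run ?k w cf (poly qf ?m) (0, \<lambda>_. 0, []) (0, (\<lambda>_. 0)(2 := ?n), [])"
      using computesD[OF cf, of ?k "\<lambda>_. 0" w ?m "poly qf ?m" "[]"] by simp
    have 2: "run ?k w (for_loop 2 ?body) ((?T + 3) * poly pf ?m + 1) (0, (\<lambda>_. 0)(2 := ?n), [])
       (0, ?S ?n, F w)"
    proof (rule run_for_loop'[where S = ?S and P = "\<lambda>_. 0" and Y = ?Y and T = ?T])
      fix i assume i: "i < ?n"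
      let ?s = "(?S i)(2 := ?n - Suc i)" and ?v = "g w (case_nat i (\<lambda>_. 0))"
      have env: "(\<lambda>j. ?s (?loc j)) = case_nat i (\<lambda>_. 0)"
        by (auto simp: fun_eq_iff split: nat.splits)
      have env_le: "case_nat i (\<lambda>_. 0) j \<le> ?m'" for j
        using i n by (cases j) auto
      have v: "?v \<le> poly pg ?m'" by (rule pg) (use env_le in auto)
      have A: "run ?k w cg (poly qg ?m') (0, ?s, ?Y i) (0, ?s(3 := ?v), ?Y i)"
        using computesD[OF cg, of ?k ?s w ?m' "poly qg ?m'" "?Y i"] env_le unfolding fun_cong[OF env] env
        by auto
      have z: "?s(3 := 0) = ?s" by (auto simp: fun_eq_iff)
      have B: "run ?k w (if_zero 3 (emit ?k False) (Seq (for_loop 3 skip) (emit ?k True)))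
         (Suc (4 * poly pg ?m' + 1 + 1 + 1)) (0, ?s(3 := ?v), ?Y i) (0, ?s, ?Y (Suc i))"
      proof (rule run_if_zero)
        show "run ?k w (if (?s(3 := ?v)) 3 = 0 then emit ?k False else Seq (for_loop 3 skip) (emit ?k True))
           (4 * poly pg ?m' + 1 + 1 + 1) (0, ?s(3 := ?v), ?Y i) (0, ?s, ?Y (Suc i))"
        proof (cases "?v = 0")
          case True
          have "run ?k w (emit ?k False) (4 * poly pg ?m' + 1 + 1 + 1) (0, ?s, ?Y i) (0, ?s, ?Y i @ [False])"
            by (rule run_mono[OF run_emit]) simp
          moreover have "?Y (Suc i) = ?Y i @ [False]" using True by simp
          ultimately show ?thesis unfolding True z by simp
        next
          case False
          have "run ?k w (for_loop 3 skip) (4 * poly pg ?m' + 1) (0, ?s(3 := ?v), ?Y i) (0, (?s(3 := ?v))(3 := 0), ?Y i)"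
            using v by (intro run_clear) auto
          from run_Seq[OF this run_emit[where b = True]] show ?thesis
            using False unfolding fun_upd_upd z by simp
        qed
      qed simp
      have C: "run ?k w (inc 1) 3 (0, ?s, ?Y (Suc i)) (0, (?S (Suc i))(2 := ?n - Suc i), ?Y (Suc i))"
      proof -
        have *: "?s(1 := Suc (?s 1)) = (?S (Suc i))(2 := ?n - Suc i)" by (auto simp: fun_eq_iff)
        show ?thesis using run_inc[of 1 ?k w 0 ?s "?Y (Suc i)"] unfolding * by simp
      qed
      show "run ?k w ?body ?T (0, (?S i)(2 := ?n - Suc i), ?Y i) (0, (?S (Suc i))(2 := ?n - Suc i), ?Y (Suc i))"
        using run_Seq[OF A run_Seq[OF B C]] .
    qed (use n in \<open>auto simp: fun_eq_iff F intro!: mult_le_mono2\<close>)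
    show ?thesis
      by (rule run_mono[OF run_Seq[OF 1 2]]) (simp add: poly_pcompose algebra_simps)
  qed
  show ?thesis
  proof (rule poly_time_exec[of "?k + 2" ?q ?c])
    fix w
    have init: "(written w, 0) # replicate (?k + 2 - 1) (\<lambda>_. 0, 0) = tapes ?k w (0, \<lambda>_. 0, [])"
      by (intro nth_equalityI) (auto simp: counter_def written_def nth_Cons nth_append fun_eq_iff split: nat.splits)
    obtain t where t: "t \<le> poly ?q (length w)"
      "exec ?c (tapes ?k w (0, \<lambda>_. 0, [])) t (tapes ?k w (0, (\<lambda>_. 0)(1 := f w (\<lambda>_. 0)), F w))"
      using main[of w] unfolding run_def by blast
    show "\<exists>t ts. t \<le> poly ?q (length w) \<and>
      exec ?c ((written w, 0) # replicate (?k + 2 - 1) (\<lambda>_. 0, 0)) t ts \<and>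
      (\<forall>i\<in>{0..int (length (F w))}. fst (last ts) i = written (F w) i)"
      unfolding init by (intro exI conjI, rule t(1), rule t(2)) simp
  qed simp
qed

section \<open>Closure properties of definable functions\<close>

lemma definable_rename: "definable f \<Longrightarrow> definable (\<lambda>w e. f w (\<lambda>i. e (\<rho> i)))"
proof (induction arbitrary: \<rho> rule: definable.induct)
  case (definable_var i)
  show ?case by (rule definable.definable_var)
next
  case definable_one
  show ?case by (rule definable.definable_one)
next
  case definable_length
  show ?case by (rule definable.definable_length)
next
  case (definable_bit f)
  show ?case by (rule definable.definable_bit[OF definable_bit.IH])
next
  case (definable_add f g)
  show ?case by (rule definable.definable_add[OF definable_add.IH])
next
  case (definable_diff f g)
  show ?case by (rule definable.definable_diff[OF definable_diff.IH])
next
  case (definable_sum f g)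
  \<comment> \<open>Under the sum, index 0 is the bound variable and stays fixed, while all other
    variables move up by one.\<close>
  let ?\<rho> = "case_nat 0 (\<lambda>i. Suc (\<rho> i))"
  have *: "(\<lambda>j. case_nat i e (?\<rho> j)) = case_nat i (\<lambda>i. e (\<rho> i))" for i and e :: "nat \<Rightarrow> nat"
  proof
    show "case_nat i e (?\<rho> j) = case_nat i (\<lambda>i. e (\<rho> i)) j" for j
      by (cases j) auto
  qed
  show ?case
    using definable.definable_sum[OF definable_sum.IH(1)[of \<rho>] definable_sum.IH(2)[of ?\<rho>]]
    by (simp only: *)
qed

text \<open>Going under a sum requires shifting the substituted terms past the bound variable, which
  is an instance of renaming.\<close>

lemma definable_subst:
  "definable f \<Longrightarrow> (\<And>i. definable (\<psi> i)) \<Longrightarrow> definable (\<lambda>w e. f w (\<lambda>i. \<psi> i w e))"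
proof (induction arbitrary: \<psi> rule: definable.induct)
  case (definable_var i)
  then show ?case .
next
  case definable_one
  show ?case by (rule definable.definable_one)
next
  case definable_length
  show ?case by (rule definable.definable_length)
next
  case (definable_bit f)
  show ?case by (rule definable.definable_bit[OF definable_bit.IH[OF definable_bit.prems]])
next
  case (definable_add f g)
  show ?case
    by (rule definable.definable_add[OF definable_add.IH(1)[OF definable_add.prems]
          definable_add.IH(2)[OF definable_add.prems]])
next
  case (definable_diff f g)
  show ?case
    by (rule definable.definable_diff[OF definable_diff.IH(1)[OF definable_diff.prems]
          definable_diff.IH(2)[OF definable_diff.prems]])
next
  case (definable_sum f g)
  let ?\<psi> = "\<lambda>i w e. case i of 0 \<Rightarrow> e 0 | Suc j \<Rightarrow> \<psi> j w (\<lambda>k. e (Suc k))"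
  have "definable (?\<psi> i)" for i
  proof (cases i)
    case 0
    then show ?thesis by (simp add: definable.definable_var)
  next
    case (Suc j)
    then show ?thesis using definable_rename[OF definable_sum.prems, of j Suc] by simp
  qed
  note * = definable.definable_sum[OF definable_sum.IH(1)[OF definable_sum.prems] definable_sum.IH(2)[of ?\<psi>, OF this]]
  have "(\<lambda>j. ?\<psi> j w (case_nat i e)) = case_nat i (\<lambda>i. \<psi> i w e)" for i w e
  proof
    show "?\<psi> j w (case_nat i e) = case_nat i (\<lambda>i. \<psi> i w e) j" for j
      by (cases j) auto
  qed
  then show ?case using * by (simp only:)
qed

text \<open>An introduction rule that turns an ordinary bound variable into index 0 of the
  environment, so that nested sums can be handled without mentioning
  \<open>case_nat\<close>.\<close>

lemma definable_Sum:
  assumes "definable f" "definable (\<lambda>w e. h w (\<lambda>i. e (Suc i)) (e 0))"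
  shows "definable (\<lambda>w e. \<Sum>i<f w e. h w e i)"
  using definable_sum[OF assms] by simp

lemma definable_const: "definable (\<lambda>w e. c)"
proof (induction c)
  case 0
  show ?case using definable_diff[OF definable_one definable_one] by simp
next
  case (Suc c)
  show ?case using definable_add[OF Suc definable_one] by simp
qed

lemma definable_mult:
  assumes f: "definable f" and g: "definable g"
  shows "definable (\<lambda>w e. f w e * g w e)"
  using definable_Sum[OF f definable_rename[OF g, of Suc]] by simp

lemma definable_power: "definable f \<Longrightarrow> definable (\<lambda>w e. f w e ^ k)"
  by (induction k) (simp_all add: definable_const definable_mult)

lemma definable_finite_sum:
  "finite A \<Longrightarrow> (\<And>a. a \<in> A \<Longrightarrow> definable (f a)) \<Longrightarrow> definable (\<lambda>w e. \<Sum>a\<in>A. f a w e)"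
proof (induction A rule: finite_induct)
  case empty
  show ?case by (simp add: definable_const)
next
  case (insert a A)
  have "definable (\<lambda>w e. f a w e + (\<Sum>a\<in>A. f a w e))"
    by (rule definable_add[OF insert.prems insert.IH[OF insert.prems]]) (rule insertI1, erule insertI2)
  then show ?case using insert.hyps by simp
qed

section \<open>Predicates with definable characteristic function\<close>

definition decidable :: "(bool list \<Rightarrow> (nat \<Rightarrow> nat) \<Rightarrow> bool) \<Rightarrow> bool" where
  "decidable P \<longleftrightarrow> definable (\<lambda>w e. of_bool (P w e))"

lemma decidable_subst:
  "decidable P \<Longrightarrow> (\<And>i. definable (\<psi> i)) \<Longrightarrow> decidable (\<lambda>w e. P w (\<lambda>i. \<psi> i w e))"
  unfolding decidable_def by (rule definable_subst[where f = "\<lambda>w e. of_bool (P w e)" and \<psi> = \<psi>])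

lemma decidable_rename: "decidable P \<Longrightarrow> decidable (\<lambda>w e. P w (\<lambda>i. e (\<rho> i)))"
  unfolding decidable_def by (rule definable_rename[where f = "\<lambda>w e. of_bool (P w e)" and \<rho> = \<rho>])

lemma decidable_not: "decidable P \<Longrightarrow> decidable (\<lambda>w e. \<not> P w e)"
proof -
  have *: "of_bool (\<not> p) = (1 - of_bool p :: nat)" for p by simp
  show "decidable P \<Longrightarrow> decidable (\<lambda>w e. \<not> P w e)"
    unfolding decidable_def * by (rule definable_diff[OF definable_one])
qed

lemma decidable_conj: "decidable P \<Longrightarrow> decidable Q \<Longrightarrow> decidable (\<lambda>w e. P w e \<and> Q w e)"
  unfolding decidable_def of_bool_conj by (rule definable_mult)

lemma decidable_disj:
  assumes "decidable P" "decidable Q"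
  shows "decidable (\<lambda>w e. P w e \<or> Q w e)"
proof -
  have "decidable (\<lambda>w e. \<not> (\<not> P w e \<and> \<not> Q w e))"
    by (intro decidable_not decidable_conj assms)
  then show ?thesis by (simp only: de_Morgan_conj not_not)
qed

lemma decidable_imp: "decidable P \<Longrightarrow> decidable Q \<Longrightarrow> decidable (\<lambda>w e. P w e \<longrightarrow> Q w e)"
  unfolding imp_conv_disj by (intro decidable_disj decidable_not)

lemma decidable_iff: "decidable P \<Longrightarrow> decidable Q \<Longrightarrow> decidable (\<lambda>w e. P w e \<longleftrightarrow> Q w e)"
  unfolding iff_conv_conj_imp by (intro decidable_conj decidable_imp)

lemma decidable_const: "decidable (\<lambda>w e. b)"
  unfolding decidable_def by (rule definable_const)

lemma decidable_le: "definable f \<Longrightarrow> definable g \<Longrightarrow> decidable (\<lambda>w e. f w e \<le> g w e)"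
proof -
  have *: "of_bool (x \<le> y) = (1 - (x - y) :: nat)" for x y :: nat by simp
  show "definable f \<Longrightarrow> definable g \<Longrightarrow> decidable (\<lambda>w e. f w e \<le> g w e)"
    unfolding decidable_def * by (intro definable_diff definable_one)
qed

lemma decidable_less: "definable f \<Longrightarrow> definable g \<Longrightarrow> decidable (\<lambda>w e. f w e < g w e)"
  unfolding not_le[symmetric] by (intro decidable_not decidable_le)

lemma decidable_eq: "definable f \<Longrightarrow> definable g \<Longrightarrow> decidable (\<lambda>w e. f w e = g w e)"
  unfolding order_eq_iff by (intro decidable_conj decidable_le)

lemma decidable_ex:
  assumes "definable f" "decidable (\<lambda>w e. P w (\<lambda>i. e (Suc i)) (e 0))"
  shows "decidable (\<lambda>w e. \<exists>i<f w e. P w e i)"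
proof -
  \<comment> \<open>Truncated subtraction taken twice is the sign function, which turns the number
    of witnesses into a truth value.\<close>
  have *: "of_bool (\<exists>i<n. Q i) = (1 - (1 - (\<Sum>i<n. of_bool (Q i))) :: nat)" for n and Q :: "nat \<Rightarrow> bool"
  proof (cases "\<exists>i<n. Q i")
    case True
    then obtain i where "i < n" "Q i" by blast
    then have "(\<Sum>i<n. of_bool (Q i) :: nat) \<noteq> 0" by auto
    then have "1 - (1 - (\<Sum>i<n. of_bool (Q i))) = (1 :: nat)" by arith
    then show ?thesis using True by (simp only: of_bool_eq)
  qed auto
  show ?thesis using assms unfolding decidable_def *
    by (intro definable_diff definable_one definable_Sum)
qed

lemma decidable_all:
  assumes "definable f" "decidable (\<lambda>w e. P w (\<lambda>i. e (Suc i)) (e 0))"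
  shows "decidable (\<lambda>w e. \<forall>i<f w e. P w e i)"
proof -
  have "decidable (\<lambda>w e. \<not> (\<exists>i<f w e. \<not> P w e i))"
    by (intro decidable_not decidable_ex assms)
  then show ?thesis by simp
qed

lemma decidable_finite_ball:
  "finite A \<Longrightarrow> (\<And>a. a \<in> A \<Longrightarrow> decidable (P a)) \<Longrightarrow> decidable (\<lambda>w e. \<forall>a\<in>A. P a w e)"
proof (induction A rule: finite_induct)
  case empty
  show ?case by (simp add: decidable_const)
next
  case (insert a A)
  have "decidable (\<lambda>w e. P a w e \<and> (\<forall>a\<in>A. P a w e))"
    by (rule decidable_conj[OF insert.prems insert.IH[OF insert.prems]]) (rule insertI1, erule insertI2)
  then show ?case by simp
qed

lemma decidable_finite_bex:
  assumes "finite A" "\<And>a. a \<in> A \<Longrightarrow> decidable (P a)"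
  shows "decidable (\<lambda>w e. \<exists>a\<in>A. P a w e)"
proof -
  have "decidable (\<lambda>w e. \<not> (\<forall>a\<in>A. \<not> P a w e))"
    by (intro decidable_not decidable_finite_ball assms)
  then show ?thesis by simp
qed

lemma definable_if:
  assumes "decidable P" "definable f" "definable g"
  shows "definable (\<lambda>w e. if P w e then f w e else g w e)"
proof -
  have *: "(if p then x else y) = of_bool p * x + (1 - of_bool p) * y" for p and x y :: nat by simp
  show ?thesis using assms unfolding decidable_def *
    by (intro definable_add definable_mult definable_diff definable_one)
qed

text \<open>The quotient is the number of positive multiples of \<open>c\<close> up to the dividend,
  and hence a bounded sum of truth values.\<close>

lemma definable_div_const:
  assumes f: "definable f"
  shows "definable (\<lambda>w e. f w e div c)"
proof (cases "c = 0")
  case True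
  then show ?thesis using definable_const[of 0] by simp
next
  case False
  have "x div c = (\<Sum>i<x. of_bool ((i + 1) * c \<le> x))" for x
  proof -
    have "(\<Sum>i<x. of_bool ((i + 1) * c \<le> x) :: nat) = card {i\<in>{..<x}. (i + 1) * c \<le> x}"
      by (simp add: sum.If_cases Int_def flip: of_bool_def)
    also have "{i\<in>{..<x}. (i + 1) * c \<le> x} = {..<x div c}"
    proof -
      have "(i + 1) * c \<le> x \<longleftrightarrow> i < x div c" for i
        using False less_eq_div_iff_mult_less_eq[of c "i + 1" x] by (simp add: Suc_le_eq)
      moreover have "i < x" if "i < x div c" for i
        using that div_le_dividend[of x c] by (rule less_le_trans)
      ultimately show ?thesis by blast
    qed
    finally show ?thesis by simp
  qed
  then show ?thesis
    using definable_Sum[OF f, of "\<lambda>w e i. of_bool ((i + 1) * c \<le> f w e)"]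
      decidable_le[OF definable_mult[OF definable_add[OF definable_var[of 0] definable_one] definable_const[of c]]
        definable_rename[OF f, of Suc]]
    unfolding decidable_def by simp
qed

lemma definable_mod_const:
  assumes f: "definable f"
  shows "definable (\<lambda>w e. f w e mod c)"
  unfolding minus_mult_div_eq_mod[symmetric]
  by (intro definable_diff definable_mult definable_const definable_div_const f)

text \<open>The position of the bit is variable 0, and the arguments of \<open>F\<close> are shifted
  behind it. The length test is part of the predicate because \<open>!\<close> says nothing beyond
  the end of a list.\<close>

definition def_string :: "(bool list \<Rightarrow> (nat \<Rightarrow> nat) \<Rightarrow> bool list) \<Rightarrow> bool" where
  "def_string F \<longleftrightarrow> definable (\<lambda>w e. length (F w e)) \<and>
     decidable (\<lambda>w e. e 0 < length (F w (\<lambda>i. e (Suc i))) \<and> F w (\<lambda>i. e (Suc i)) ! e 0)"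

lemma def_string_length: "def_string F \<Longrightarrow> definable (\<lambda>w e. length (F w e))"
  by (simp add: def_string_def)

lemma def_string_nth:
  assumes F: "def_string F" and f: "definable f"
  shows "decidable (\<lambda>w e. f w e < length (F w e) \<and> F w e ! f w e)"
proof -
  have "definable ((\<lambda>i. case i of 0 \<Rightarrow> f | Suc j \<Rightarrow> \<lambda>w e. e j) i)" for i
    using f by (cases i) (simp_all add: definable_var)
  from decidable_subst[OF conjunct2[OF F[unfolded def_string_def]], of "\<lambda>i. case i of 0 \<Rightarrow> f | Suc j \<Rightarrow> \<lambda>w e. e j", OF this]
  show ?thesis by simp
qed

lemma def_string_subst:
  assumes F: "def_string F" and \<psi>: "\<And>i. definable (\<psi> i)"
  shows "def_string (\<lambda>w e. F w (\<lambda>i. \<psi> i w e))"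
  unfolding def_string_def
proof
  show "definable (\<lambda>w e. length (F w (\<lambda>i. \<psi> i w e)))"
    by (rule definable_subst[OF def_string_length[OF F] \<psi>])
  let ?\<psi> = "\<lambda>i w e. case i of 0 \<Rightarrow> e 0 | Suc j \<Rightarrow> \<psi> j w (\<lambda>k. e (Suc k))"
  have "definable (?\<psi> i)" for i
    using \<psi> definable_rename[OF \<psi>, of _ Suc] by (cases i) (simp_all add: definable_var)
  from decidable_subst[OF conjunct2[OF F[unfolded def_string_def]], of ?\<psi>, OF this]
  show "decidable (\<lambda>w e. e 0 < length (F w (\<lambda>i. \<psi> i w (\<lambda>i. e (Suc i)))) \<and>
      F w (\<lambda>i. \<psi> i w (\<lambda>i. e (Suc i))) ! e 0)" by simp
qed

lemma def_string_rename: "def_string F \<Longrightarrow> def_string (\<lambda>w e. F w (\<lambda>i. e (\<rho> i)))"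
  by (rule def_string_subst[where F = F and \<psi> = "\<lambda>i w e. e (\<rho> i)", OF _ definable_var])

text \<open>A definable function consults its input only through the length and single bits, and
  both can be replaced by those of \<open>F w\<close>. This lets reductions be composed without
  composing machines.\<close>

lemma definable_comp:
  assumes f: "definable f" and F: "def_string (\<lambda>w e. F w)"
  shows "definable (\<lambda>w e. f (F w) e)"
  using f
proof induction
  case (definable_var i)
  show ?case by (rule definable.definable_var)
next
  case definable_one
  show ?case by (rule definable.definable_one)
next
  case definable_length
  show ?case using def_string_length[OF F] .
next
  case (definable_bit f)
  show ?case using def_string_nth[OF F definable_bit.IH] unfolding decidable_def .
next
  case (definable_add f g)
  show ?case by (rule definable.definable_add[OF definable_add.IH])
next
  case (definable_diff f g)
  show ?case by (rule definable.definable_diff[OF definable_diff.IH])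
next
  case (definable_sum f g)
  show ?case by (rule definable.definable_sum[OF definable_sum.IH])
qed

lemma decidable_comp: "decidable P \<Longrightarrow> def_string (\<lambda>w e. F w) \<Longrightarrow> decidable (\<lambda>w e. P (F w) e)"
  unfolding decidable_def by (rule definable_comp[where f = "\<lambda>w e. of_bool (P w e)" and F = F])

lemma def_string_comp:
  "def_string F \<Longrightarrow> def_string (\<lambda>w e. G w) \<Longrightarrow> def_string (\<lambda>w e. F (G w) e)"
  unfolding def_string_def[of F] def_string_def[of "\<lambda>w e. F (G w) e"]
  using definable_comp[of "\<lambda>w e. length (F w e)" G]
    decidable_comp[of "\<lambda>w e. e 0 < length (F w (\<lambda>i. e (Suc i))) \<and> F w (\<lambda>i. e (Suc i)) ! e 0" G]
  by simp

lemma def_string_input: "def_string (\<lambda>w e. w)"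
  unfolding def_string_def decidable_def
  by (intro conjI definable_length definable_bit definable_var)

lemma def_string_poly_time:
  assumes F: "def_string (\<lambda>w e. F w)"
  shows "poly_time F"
proof (rule definable_poly_time)
  show "definable (\<lambda>w e. length (F w))" by (rule def_string_length[OF F])
  show "definable (\<lambda>w e. of_bool (e 0 < length (F w) \<and> F w ! e 0))"
    using F unfolding def_string_def decidable_def by simp
  show "F w = map (\<lambda>i. of_bool (case_nat i (\<lambda>_. 0) 0 < length (F w) \<and> F w ! case_nat i (\<lambda>_. 0) 0) \<noteq> (0 :: nat))
      [0..<length (F w)]" for w
    by (intro nth_equalityI) auto
qed

lemma def_string_Nil: "def_string (\<lambda>w e. [])"
  unfolding def_string_def by (simp add: definable_const decidable_const)

lemma def_string_single:
  assumes "decidable P"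
  shows "def_string (\<lambda>w e. [P w e])"
proof -
  have "(e 0 < length [P w e'] \<and> [P w e'] ! e 0) \<longleftrightarrow> e 0 = 0 \<and> P w e'" for w and e e' :: "nat \<Rightarrow> nat"
    by (auto simp: nth_Cons')
  then show ?thesis unfolding def_string_def
    by (simp only: list.size) (intro conjI definable_const decidable_conj decidable_eq definable_var decidable_rename[OF assms])
qed

lemma def_string_append:
  assumes F: "def_string F" and G: "def_string G"
  shows "def_string (\<lambda>w e. F w e @ G w e)"
proof -
  have *: "(i < length (xs @ ys) \<and> (xs @ ys) ! i) \<longleftrightarrow>
      (i < length xs \<and> xs ! i) \<or> (length xs \<le> i \<and> (i - length xs < length ys \<and> ys ! (i - length xs)))"
    for i and xs ys :: "bool list"
    by (auto simp: nth_append)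
  note F' = def_string_rename[OF F, of Suc] and G' = def_string_rename[OF G, of Suc]
  show ?thesis unfolding def_string_def *
    using definable_add[OF def_string_length[OF F] def_string_length[OF G]]
    by (auto intro!: decidable_disj decidable_conj decidable_le def_string_nth[OF F'] def_string_nth[OF G']
        definable_diff definable_var def_string_length[OF F'])
qed

lemma def_string_const: "def_string (\<lambda>w e. xs)"
proof (induction xs)
  case Nil
  show ?case by (rule def_string_Nil)
next
  case (Cons x xs)
  show ?case using def_string_append[OF def_string_single[OF decidable_const[of x]] Cons] by simp
qed

lemma def_string_if:
  assumes P: "decidable P" and F: "def_string F" and G: "def_string G"
  shows "def_string (\<lambda>w e. if P w e then F w e else G w e)"
proof -
  have *: "(i < length (if p then xs else ys) \<and> (if p then xs else ys) ! i) \<longleftrightarrow>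
      (p \<and> (i < length xs \<and> xs ! i)) \<or> (\<not> p \<and> (i < length ys \<and> ys ! i))"
    for i p and xs ys :: "bool list"
    by auto
  note F' = def_string_rename[OF F, of Suc] and G' = def_string_rename[OF G, of Suc]
  have "length (if p then xs else ys) = (if p then length xs else length ys)" for p and xs ys :: "bool list"
    by simp
  then have "definable (\<lambda>w e. length (if P w e then F w e else G w e))"
    by (simp only:) (intro definable_if def_string_length P F G)
  then show ?thesis unfolding def_string_def *
    by (intro conjI decidable_disj decidable_conj decidable_not
         decidable_rename[OF P] def_string_nth[OF F'] def_string_nth[OF G'] definable_var)
qed

text \<open>Locates position \<open>i\<close> by guessing its block \<open>c\<close>: the lengths of
  the earlier blocks form a bounded sum, so that the bit becomes a bounded quantification.\<close>

lemma nth_concat_upt: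
  "(i < length (concat (map f [0..<n])) \<and> concat (map f [0..<n]) ! i) \<longleftrightarrow>
    (\<exists>c<n. (\<Sum>d<c. length (f d)) \<le> i \<and>
       (i - (\<Sum>d<c. length (f d)) < length (f c) \<and> f c ! (i - (\<Sum>d<c. length (f d)))))"
proof (induction n)
  case (Suc n)
  have l: "length (concat (map f [0..<m])) = (\<Sum>d<m. length (f d))" for m
    by (induction m) auto
  show ?case
    using Suc.IH by (auto simp: nth_append less_Suc_eq l)
qed simp

lemma length_concat_upt: "length (concat (map f [0..<n])) = (\<Sum>d<n. length (f d))"
  by (induction n) auto

lemma def_string_concat:
  assumes N: "definable N" and F: "def_string (\<lambda>w e. F w (\<lambda>i. e (Suc i)) (e 0))"
  shows "def_string (\<lambda>w e. concat (map (F w e) [0..<N w e]))"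
proof -
  have S: "definable (\<lambda>w e. \<Sum>d<f w e. length (F w (\<lambda>i. e (\<rho> i)) d))" if "definable f" for f \<rho>
  proof (rule definable_Sum[OF that])
    show "definable (\<lambda>w e. length (F w (\<lambda>i. e (Suc (\<rho> i))) (e 0)))"
      using definable_rename[OF def_string_length[OF F], of "case_nat 0 (\<lambda>i. Suc (\<rho> i))"] by simp
  qed
  have F': "def_string (\<lambda>w e. F w (\<lambda>i. e (Suc (Suc i))) (e 0))"
    using def_string_rename[OF F, of "case_nat 0 (\<lambda>i. Suc (Suc i))"] by simp
  show ?thesis
    unfolding def_string_def
  proof
    show "definable (\<lambda>w e. length (concat (map (F w e) [0..<N w e])))"
      unfolding length_concat_upt using S[OF N, of id] by simp
    show "decidable (\<lambda>w e. e 0 < length (concat (map (F w (\<lambda>i. e (Suc i))) [0..<N w (\<lambda>i. e (Suc i))])) \<and>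
       concat (map (F w (\<lambda>i. e (Suc i))) [0..<N w (\<lambda>i. e (Suc i))]) ! e 0)"
      unfolding nth_concat_upt
      by (intro decidable_ex decidable_conj decidable_le definable_rename[OF N] S def_string_nth[OF F']
          definable_diff definable_var)
  qed
qed

lemma decidable_string_eq:
  assumes F: "def_string F" and G: "def_string G"
  shows "decidable (\<lambda>w e. F w e = G w e)"
proof -
  have *: "xs = ys \<longleftrightarrow> length xs = length ys \<and>
      (\<forall>i<length xs. (i < length xs \<and> xs ! i) \<longleftrightarrow> (i < length ys \<and> ys ! i))" for xs ys :: "bool list"
    by (auto simp: list_eq_iff_nth_eq)
  show ?thesis unfolding *
    by (intro decidable_conj decidable_eq decidable_all decidable_iff def_string_length F G
        def_string_nth[OF def_string_rename[OF F]] def_string_nth[OF def_string_rename[OF G]] definable_var)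
qed

section \<open>Definable labels, tuples and tables\<close>

definition def_label :: "(bool list \<Rightarrow> (nat \<Rightarrow> nat) \<Rightarrow> label) \<Rightarrow> bool" where
  "def_label L \<longleftrightarrow> decidable (\<lambda>w e. L w e = One) \<and> decidable (\<lambda>w e. L w e = Star)"

lemma def_label_eq:
  assumes "def_label L"
  shows "decidable (\<lambda>w e. L w e = c)"
proof (cases c)
  case Zero
  have "L w e = Zero \<longleftrightarrow> \<not> L w e = One \<and> \<not> L w e = Star" for w e
    by (cases "L w e") simp_all
  moreover have "decidable (\<lambda>w e. \<not> L w e = One \<and> \<not> L w e = Star)"
    using assms unfolding def_label_def by (intro decidable_conj decidable_not) simp_all
  ultimately show ?thesis unfolding Zero by (simp only:)
qed (use assms in \<open>auto simp: def_label_def\<close>)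

lemma def_label_subst:
  assumes L: "def_label L" and \<psi>: "\<And>i. definable (\<psi> i)"
  shows "def_label (\<lambda>w e. L w (\<lambda>i. \<psi> i w e))"
  unfolding def_label_def
  using decidable_subst[OF def_label_eq[OF L, of One] \<psi>] decidable_subst[OF def_label_eq[OF L, of Star] \<psi>]
  by (rule conjI)

lemma def_label_const: "def_label (\<lambda>w e. c)"
  unfolding def_label_def by (intro conjI decidable_const)

lemma def_label_if:
  assumes "decidable P" "def_label L" "def_label L'"
  shows "def_label (\<lambda>w e. if P w e then L w e else L' w e)"
proof -
  have *: "((if p then x else y) = c) \<longleftrightarrow> (p \<and> x = c) \<or> (\<not> p \<and> y = c)" for p and x y c :: label
    by auto
  show ?thesis unfolding def_label_def *
    by (intro conjI decidable_disj decidable_conj decidable_not def_label_eq assms)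
qed

lemma label_bits_eq: "label_bits l = [l = Star] @ [l = One]"
  by (cases l) auto

lemma def_string_label_bits: "def_label L \<Longrightarrow> def_string (\<lambda>w e. label_bits (L w e))"
  unfolding label_bits_eq by (intro def_string_append def_string_single def_label_eq)

definition def_tuple :: "nat \<Rightarrow> (bool list \<Rightarrow> (nat \<Rightarrow> nat) \<Rightarrow> nat list) \<Rightarrow> bool" where
  "def_tuple k \<tau> \<longleftrightarrow> (\<forall>w e. length (\<tau> w e) = k) \<and> (\<forall>i<k. definable (\<lambda>w e. \<tau> w e ! i))"

lemma def_tuple_rename:
  assumes "def_tuple k \<tau>"
  shows "def_tuple k (\<lambda>w e. \<tau> w (\<lambda>i. e (\<rho> i)))"
  unfolding def_tuple_def
proof (intro conjI allI impI)
  fix i assume "i < k"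
  then have "definable (\<lambda>w e. \<tau> w e ! i)"
    using assms by (simp add: def_tuple_def)
  then show "definable (\<lambda>w e. \<tau> w (\<lambda>i. e (\<rho> i)) ! i)"
    by (rule definable_rename)
qed (use assms in \<open>simp add: def_tuple_def\<close>)

lemma def_tuple_Nil: "def_tuple 0 (\<lambda>w e. [])"
  by (simp add: def_tuple_def)

lemma def_tuple_snoc:
  assumes \<tau>: "def_tuple k \<tau>" and f: "definable f"
  shows "def_tuple (Suc k) (\<lambda>w e. \<tau> w e @ [f w e])"
  unfolding def_tuple_def
proof (intro conjI allI impI)
  fix i assume "i < Suc k"
  then show "definable (\<lambda>w e. (\<tau> w e @ [f w e]) ! i)"
    using \<tau> f by (cases "i = k") (auto simp: def_tuple_def nth_append)
qed (use \<tau> in \<open>simp add: def_tuple_def\<close>)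

lemma def_tuple_vars: "def_tuple k (\<lambda>w e. map e [0..<k])"
  by (simp add: def_tuple_def definable_var)

lemma def_tuple_map:
  assumes \<tau>: "def_tuple k \<tau>" and f: "definable (\<lambda>w e. f w (e 0))"
  shows "def_tuple k (\<lambda>w e. map (f w) (\<tau> w e))"
  unfolding def_tuple_def
proof (intro conjI allI impI)
  fix i assume i: "i < k"
  have "definable (\<lambda>w e. f w (\<tau> w e ! i))"
    using definable_subst[OF f, of "\<lambda>_ w e. \<tau> w e ! i"] i \<tau> by (simp add: def_tuple_def)
  moreover have "map (f w) (\<tau> w e) ! i = f w (\<tau> w e ! i)" for w e
    using i \<tau> by (simp add: def_tuple_def)
  ultimately show "definable (\<lambda>w e. map (f w) (\<tau> w e) ! i)" by simp
qed (use \<tau> in \<open>simp add: def_tuple_def\<close>)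

text \<open>By substitution it suffices to treat the tuple of the first \<open>k\<close> variables.
  This is why later obligations are stated for \<open>map e [0..<ar R]\<close> only.\<close>

lemma def_label_tuple:
  assumes L: "def_label (\<lambda>w e. L w (map e [0..<k]))" and \<tau>: "def_tuple k \<tau>"
  shows "def_label (\<lambda>w e. L w (\<tau> w e))"
proof -
  let ?\<psi> = "\<lambda>i w e. if i < k then \<tau> w e ! i else 0"
  have "definable (?\<psi> i)" for i
    using \<tau> by (cases "i < k") (auto simp: def_tuple_def definable_const)
  from def_label_subst[OF L, of ?\<psi>, OF this]
  have "def_label (\<lambda>w e. L w (map (\<lambda>i. ?\<psi> i w e) [0..<k]))" .
  moreover have "map (\<lambda>i. ?\<psi> i w e) [0..<k] = \<tau> w e" for w e
    using \<tau> by (intro nth_equalityI) (auto simp: def_tuple_def)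
  ultimately show ?thesis by simp
qed

lemma decidable_tuple:
  assumes P: "decidable (\<lambda>w e. P w (e k) (map e [0..<k]))" and \<tau>: "def_tuple k \<tau>" and a: "definable a"
  shows "decidable (\<lambda>w e. P w (a w e) (\<tau> w e))"
proof -
  let ?\<psi> = "\<lambda>i w e. if i < k then \<tau> w e ! i else a w e"
  have "definable (?\<psi> i)" for i
    using \<tau> a by (cases "i < k") (auto simp: def_tuple_def)
  from decidable_subst[OF P, of ?\<psi>, OF this]
  have "decidable (\<lambda>w e. P w (a w e) (map (\<lambda>i. ?\<psi> i w e) [0..<k]))" by simp
  moreover have "map (\<lambda>i. ?\<psi> i w e) [0..<k] = \<tau> w e" for w e
    using \<tau> by (intro nth_equalityI) (auto simp: def_tuple_def)
  ultimately show ?thesis by simp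
qed

lemma product_lists_Suc:
  "product_lists (replicate (Suc k) xs) =
    concat (map (\<lambda>x. map (Cons x) (product_lists (replicate k xs))) xs)"
  by simp

lemma concat_map_concat:
  "concat (map f (concat (map g xs))) = concat (map (\<lambda>x. concat (map f (g x))) xs)"
  by (induction xs) auto

lemma def_string_table:
  assumes L: "def_label (\<lambda>w e. L w (map e [0..<K]))" and N: "definable (\<lambda>w e. N w)"
  shows "def_string (\<lambda>w e. concat (map (\<lambda>t. label_bits (L w t)) (product_lists (replicate K [0..<N w]))))"
proof -
  \<comment> \<open>The table is produced by \<open>K\<close> nested concatenations. The prefix
    \<tau> collects the entries already fixed by the outer ones, and \<open>k\<close> positions are
    still open.\<close>
  have "def_string (\<lambda>w e. concat (map (\<lambda>t. label_bits (L w (\<tau> w e @ t))) (product_lists (replicate k [0..<N w]))))"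
    if "def_tuple j \<tau>" "j + k = K" for j k \<tau>
    using that
  proof (induction k arbitrary: j \<tau>)
    case 0
    then show ?case using def_string_label_bits[OF def_label_tuple[OF L, of \<tau>]] by simp
  next
    case (Suc k)
    have *: "concat (map (\<lambda>t. label_bits (L w (\<tau> w e @ t))) (product_lists (replicate (Suc k) [0..<N w]))) =
        concat (map (\<lambda>x. concat (map (\<lambda>t. label_bits (L w ((\<tau> w e @ [x]) @ t)))
          (product_lists (replicate k [0..<N w])))) [0..<N w])" for w e
      unfolding product_lists_Suc concat_map_concat by (simp add: comp_def)
    have "def_tuple (Suc j) (\<lambda>w e. \<tau> w (\<lambda>i. e (Suc i)) @ [e 0])"
      by (intro def_tuple_snoc def_tuple_rename[OF Suc.prems(1)] definable_var)
    from Suc.IH[OF this] Suc.prems show ?case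
      unfolding * by (intro def_string_concat N) simp
  qed
  from this[OF def_tuple_Nil, of K] show ?thesis by simp
qed

lemma tuples_0: "tuples A 0 = {[]}"
  by (auto simp: tuples_def)

lemma tuples_Suc: "tuples A (Suc k) = {x # t | x t. x \<in> A \<and> t \<in> tuples A k}"
  by (auto simp: tuples_def length_Suc_conv)

text \<open>Variable \<open>K\<close>, the first one not occupied by the tuple, carries the
  parameter \<open>a\<close>. The quantifier is peeled off one position at a time, with the chosen
  entries collected in a prefix.\<close>

lemma decidable_all_tuples:
  assumes P: "decidable (\<lambda>w e. P w (e K) (map e [0..<K]))" and N: "definable (\<lambda>w e. N w)"
    and a: "definable a"
  shows "decidable (\<lambda>w e. \<forall>t\<in>tuples {..<N w} K. P w (a w e) t)"
proof -
  have "decidable (\<lambda>w e. \<forall>t\<in>tuples {..<N w} k. P w (a w e) (\<tau> w e @ t))"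
    if "def_tuple j \<tau>" "j + k = K" "definable a" for j k \<tau> a
    using that
  proof (induction k arbitrary: j \<tau> a)
    case 0
    then show ?case using decidable_tuple[OF P, of \<tau> a] by (simp add: tuples_0)
  next
    case (Suc k)
    have *: "(\<forall>t\<in>tuples {..<N w} (Suc k). P w (a w e) (\<tau> w e @ t)) \<longleftrightarrow>
        (\<forall>x<N w. \<forall>t\<in>tuples {..<N w} k. P w (a w e) ((\<tau> w e @ [x]) @ t))" for w e
      by (auto simp: tuples_Suc)
    have "def_tuple (Suc j) (\<lambda>w e. \<tau> w (\<lambda>i. e (Suc i)) @ [e 0])"
      by (intro def_tuple_snoc def_tuple_rename[OF Suc.prems(1)] definable_var)
    from Suc.IH[OF this _ definable_rename[OF Suc.prems(3), of Suc]] Suc.prems show ?case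
      unfolding * by (intro decidable_all N) simp
  qed
  from this[OF def_tuple_Nil, of K a] a show ?thesis by simp
qed

section \<open>Encodings\<close>

text \<open>The rank in lexicographic order: the tuple read as a number in base
  \<open>n\<close>.\<close>

fun tuple_index :: "nat \<Rightarrow> nat list \<Rightarrow> nat" where
  "tuple_index n [] = 0"
| "tuple_index n (x # t) = x * n ^ length t + tuple_index n t"

text \<open>The number of leading \<open>True\<close> bits, which encodes the size of the domain. It
  is written as a bounded sum so as to be definable, and it is meaningful for every string.\<close>

definition unary_prefix :: "bool list \<Rightarrow> nat" where
  "unary_prefix w = (\<Sum>i<length w. of_bool (\<forall>j<Suc i. j < length w \<and> w ! j))"

lemma unary_prefix_eq: "unary_prefix (replicate n True @ False # ys) = n"
proof -
  let ?w = "replicate n True @ False # ys"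
  have "(\<forall>j<Suc i. j < length ?w \<and> ?w ! j) \<longleftrightarrow> i < n" if "i < length ?w" for i
  proof
    assume "\<forall>j<Suc i. j < length ?w \<and> ?w ! j"
    moreover have "\<not> ?w ! n" by (simp add: nth_append)
    ultimately show "i < n" using not_less_eq by blast
  qed (auto simp: nth_append)
  then have "unary_prefix ?w = (\<Sum>i<length ?w. of_bool (i < n))"
    unfolding unary_prefix_def by (intro sum.cong) auto
  also have "\<dots> = card ({..<length ?w} \<inter> {i. i < n})"
    by (simp only: of_bool_def sum.If_cases[OF finite_lessThan]) simp
  also have "{..<length ?w} \<inter> {i. i < n} = {..<n}" by auto
  finally show ?thesis by simp
qed

lemma length_concat_const:
  "(\<And>x. x \<in> set xs \<Longrightarrow> length (f x) = m) \<Longrightarrow> length (concat (map f xs)) = m * length xs"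
  by (induction xs) auto

lemma concat_const_bound:
  fixes i m :: nat
  assumes "i < l" "j < m"
  shows "i * m + j < l * m"
proof -
  have "i * m + j < Suc i * m" using assms(2) by simp
  also have "\<dots> \<le> l * m" using assms(1) by (intro mult_le_mono1) simp
  finally show ?thesis .
qed

lemma nth_concat_const:
  assumes "\<And>x. x \<in> set xs \<Longrightarrow> length (f x) = m" "i < length xs" "j < m"
  shows "concat (map f xs) ! (i * m + j) = f (xs ! i) ! j"
  using assms
proof (induction xs arbitrary: i)
  case (Cons x xs)
  show ?case
  proof (cases i)
    case 0
    then show ?thesis using Cons.prems by (simp add: nth_append)
  next
    case (Suc i')
    then show ?thesis using Cons.prems Cons.IH[of i'] by (simp add: nth_append)
  qed
qed simp

lemma length_product_upt: "length (product_lists (replicate k [0..<n])) = n ^ k"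
proof (induction k)
  case (Suc k)
  then show ?case
    unfolding product_lists_Suc
    using length_concat_const[of "[0..<n]" "\<lambda>x. map (Cons x) (product_lists (replicate k [0..<n]))" "n ^ k"]
    by simp
qed simp

lemma definable_Suc: "definable f \<Longrightarrow> definable (\<lambda>w e. Suc (f w e))"
  using definable_add[OF _ definable_one] by simp

lemma tuple_index_less: "t \<in> tuples {..<n} k \<Longrightarrow> tuple_index n t < n ^ k"
proof (induction k arbitrary: t)
  case 0
  then show ?case by (simp add: tuples_0)
next
  case (Suc k)
  then obtain x t' where t: "t = x # t'" "x < n" "t' \<in> tuples {..<n} k"
    by (auto simp: tuples_Suc)
  then show ?case
    using concat_const_bound[of x n "tuple_index n t'" "n ^ k"] Suc.IH[of t'] by (simp add: tuples_def)
qed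

lemma nth_product_upt:
  "t \<in> tuples {..<n} k \<Longrightarrow> product_lists (replicate k [0..<n]) ! tuple_index n t = t"
proof (induction k arbitrary: t)
  case 0
  then show ?case by (simp add: tuples_0)
next
  case (Suc k)
  then obtain x t' where t: "t = x # t'" "x < n" "t' \<in> tuples {..<n} k"
    by (auto simp: tuples_Suc)
  let ?f = "\<lambda>x. map (Cons x) (product_lists (replicate k [0..<n]))"
  have "length t' = k" using t(3) by (simp add: tuples_def)
  then show ?case
    unfolding product_lists_Suc t(1)
    using nth_concat_const[of "[0..<n]" ?f "n ^ k" x "tuple_index n t'"] t tuple_index_less[OF t(3)] Suc.IH[OF t(3)]
    by (simp add: length_product_upt)
qed

lemma set_product_upt: "set (product_lists (replicate k [0..<n])) = tuples {..<n} k"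
proof (induction k)
  case 0
  show ?case by (simp add: tuples_0)
next
  case (Suc k)
  then show ?case unfolding product_lists_Suc tuples_Suc by auto
qed

lemma product_lists_map:
  "product_lists (replicate k (map f xs)) = map (map f) (product_lists (replicate k xs))"
proof (induction k)
  case (Suc k)
  then show ?case unfolding product_lists_Suc by (simp add: map_concat comp_def)
qed simp

locale signature =
  fixes \<sigma> :: "'r::linorder set" and ar :: "'r \<Rightarrow> nat"
  assumes finite_signature: "finite \<sigma>"
begin

definition table :: "nat \<Rightarrow> ('r \<Rightarrow> nat list \<Rightarrow> label) \<Rightarrow> 'r \<Rightarrow> bool list" where
  "table n v R = concat (map (\<lambda>t. label_bits (v R t)) (product_lists (replicate (ar R) [0..<n])))"

definition enc :: "nat \<Rightarrow> ('r \<Rightarrow> nat list \<Rightarrow> label) \<Rightarrow> bool list" where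
  "enc n v = replicate n True @ [False] @ concat (map (table n v) (sorted_list_of_set \<sigma>))"

text \<open>The \<open>1\<close> skips the separator after the unary size, and the factor 2 is the
  number of bits per label.\<close>

definition offset :: "bool list \<Rightarrow> 'r \<Rightarrow> nat list \<Rightarrow> nat" where
  "offset w R t = unary_prefix w + 1 +
     2 * ((\<Sum>R'\<in>{R'\<in>\<sigma>. R' < R}. unary_prefix w ^ ar R') + tuple_index (unary_prefix w) t)"

text \<open>The decoder is total: on strings that encode nothing, bits out of range read as
  \<open>False\<close>.\<close>

definition lab :: "bool list \<Rightarrow> 'r \<Rightarrow> nat list \<Rightarrow> label" where
  "lab w R t =
     (if offset w R t < length w \<and> w ! offset w R t then Star
      else if Suc (offset w R t) < length w \<and> w ! Suc (offset w R t) then One else Zero)"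

abbreviation size_of :: "bool list \<Rightarrow> nat" where "size_of \<equiv> unary_prefix"

lemma enc_neq_Nil [simp]: "enc n v \<noteq> []"
  by (simp add: enc_def)

lemma size_enc [simp]: "size_of (enc n v) = n"
  unfolding enc_def append_Cons append_Nil by (rule unary_prefix_eq)

lemma length_table: "length (table n v R) = 2 * n ^ ar R"
  unfolding table_def
  by (subst length_concat_const[of _ _ 2]) (auto simp: length_product_upt label_bits_eq)

lemma nth_table:
  assumes "t \<in> tuples {..<n} (ar R)" "b < 2"
  shows "table n v R ! (2 * tuple_index n t + b) = label_bits (v R t) ! b"
  unfolding table_def
  using nth_concat_const[of "product_lists (replicate (ar R) [0..<n])" "\<lambda>t. label_bits (v R t)" 2 "tuple_index n t" b]
    assms tuple_index_less[OF assms(1)] nth_product_upt[OF assms(1)]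
  by (simp add: length_product_upt label_bits_eq mult.commute)

text \<open>The symbols are sorted, so the tables in front of that of \<open>R\<close> are exactly
  those of the smaller symbols. This gives the position without referring to the sorted
  list.\<close>

lemma nth_tables:
  assumes R: "R \<in> \<sigma>" and j: "j < length (f R)"
  shows "concat (map f (sorted_list_of_set \<sigma>)) ! ((\<Sum>R'\<in>{R'\<in>\<sigma>. R' < R}. length (f R')) + j) = f R ! j"
    and "(\<Sum>R'\<in>{R'\<in>\<sigma>. R' < R}. length (f R')) + j < length (concat (map f (sorted_list_of_set \<sigma>)))"
proof -
  have "R \<in> set (sorted_list_of_set \<sigma>)" using R finite_signature by simp
  then obtain xs ys where l: "sorted_list_of_set \<sigma> = xs @ R # ys"
    by (meson split_list)
  have "sorted (xs @ R # ys)" "distinct (xs @ R # ys)" unfolding l[symmetric] by simp_all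
  then have s: "\<forall>x\<in>set xs. x < R" "\<forall>y\<in>set ys. R < y" "distinct xs"
    by (auto simp: sorted_append order_less_le)
  have "\<sigma> = set (xs @ R # ys)" unfolding l[symmetric] using finite_signature by simp
  then have "{R'\<in>\<sigma>. R' < R} = set xs" using s by (auto dest: less_asym)
  then have "(\<Sum>R'\<in>{R'\<in>\<sigma>. R' < R}. length (f R')) = length (concat (map f xs))"
    using s(3) by (simp add: length_concat sum_list_distinct_conv_sum_set comp_def)
  then show "concat (map f (sorted_list_of_set \<sigma>)) ! ((\<Sum>R'\<in>{R'\<in>\<sigma>. R' < R}. length (f R')) + j) = f R ! j"
    "(\<Sum>R'\<in>{R'\<in>\<sigma>. R' < R}. length (f R')) + j < length (concat (map f (sorted_list_of_set \<sigma>)))"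
    using j unfolding l by (simp_all add: nth_append)
qed

lemma lab_enc [simp]:
  assumes R: "R \<in> \<sigma>" and t: "t \<in> tuples {..<n} (ar R)"
  shows "lab (enc n v) R t = v R t"
proof -
  let ?c = "concat (map (table n v) (sorted_list_of_set \<sigma>))"
  let ?o = "(\<Sum>R'\<in>{R'\<in>\<sigma>. R' < R}. 2 * n ^ ar R') + 2 * tuple_index n t"
  have o: "offset (enc n v) R t = Suc n + ?o"
    by (simp add: offset_def sum_distrib_left)
  have "2 * tuple_index n t + b < length (table n v R)" if "b < 2" for b
    using tuple_index_less[OF t] that by (simp add: length_table)
  then have A: "?o + b < length ?c \<and> ?c ! (?o + b) = label_bits (v R t) ! b" if "b < 2" for b
    using nth_tables[OF R, of "2 * tuple_index n t + b" "table n v"] nth_table[OF t that, of v] that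
    by (simp add: length_table add.assoc)
  have "enc n v ! (Suc n + i) = ?c ! i" "Suc n + i < length (enc n v) \<longleftrightarrow> i < length ?c" for i
    by (simp_all add: enc_def nth_append)
  from this[of ?o] this[of "?o + 1"] A[of 0] A[of 1] show ?thesis
    unfolding lab_def o by (cases "v R t") auto
qed

lemma enc_cong:
  assumes "\<And>R t. R \<in> \<sigma> \<Longrightarrow> t \<in> tuples {..<n} (ar R) \<Longrightarrow> u R t = v R t"
  shows "enc n u = enc n v"
proof -
  have "table n u R = table n v R" if "R \<in> \<sigma>" for R
    unfolding table_def using assms[OF that]
    by (intro arg_cong[where f = concat] map_cong) (auto simp: set_product_upt)
  then show ?thesis
    unfolding enc_def using finite_signature by (auto intro!: arg_cong[where f = concat])
qed

lemma definable_size: "definable (\<lambda>w e. size_of w)"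
  unfolding unary_prefix_def
  by (rule definable_Sum[OF definable_length])
    (fold decidable_def, intro decidable_all definable_add definable_one decidable_const definable_var
      def_string_nth[OF def_string_input] definable_Suc)

end

section \<open>Reductions between the problems\<close>

lemma definable_tuple_index:
  assumes "definable (\<lambda>w e. n w)"
  shows "definable (\<lambda>w e. tuple_index (n w) (map e is))"
proof (induction "is")
  case Nil
  show ?case by (simp add: definable_const)
next
  case (Cons i "is")
  show ?case
    using definable_add[OF definable_mult[OF definable_var[of i] definable_power[OF assms, of "length is"]] Cons]
    by simp
qed

text \<open>Used instead of \<open>poly_reduces\<close> because it is transitive by
  \<open>def_string_comp\<close>; it is turned into polynomial time only at the very end.\<close>

definition def_reduces :: "problem \<Rightarrow> problem \<Rightarrow> bool" where
  "def_reduces L L' \<longleftrightarrow> (\<exists>F. def_string (\<lambda>w e. F w) \<and> (\<forall>x. x \<in> L \<longleftrightarrow> F x \<in> L'))"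

lemma def_reduces_refl: "def_reduces L L"
  unfolding def_reduces_def by (intro exI[of _ "\<lambda>w. w"] conjI def_string_input) simp

lemma def_reduces_trans: "def_reduces L L' \<Longrightarrow> def_reduces L' L'' \<Longrightarrow> def_reduces L L''"
proof -
  assume "def_reduces L L'" "def_reduces L' L''"
  then obtain F G where F: "def_string (\<lambda>w e. F w)" "\<And>x. x \<in> L \<longleftrightarrow> F x \<in> L'"
    and G: "def_string (\<lambda>w e. G w)" "\<And>x. x \<in> L' \<longleftrightarrow> G x \<in> L''"
    unfolding def_reduces_def by metis
  have "def_string (\<lambda>w e. G (F w))" by (rule def_string_comp[OF G(1) F(1)])
  moreover have "\<forall>x. x \<in> L \<longleftrightarrow> G (F x) \<in> L''" using F(2) G(2) by simp
  ultimately show ?thesis unfolding def_reduces_def by (intro exI[of _ "\<lambda>w. G (F w)"] conjI)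
qed

lemma def_reduces_poly_reduces: "def_reduces L L' \<Longrightarrow> poly_reduces L L'"
  unfolding def_reduces_def poly_reduces_def using def_string_poly_time by blast

lemma def_reduces_nontrivial:
  assumes L: "decidable (\<lambda>w e. w \<in> L)" and "x \<in> L'" "y \<notin> L'"
  shows "def_reduces L L'"
proof -
  let ?F = "\<lambda>w. if w \<in> L then x else y"
  have "def_string (\<lambda>w e. ?F w)"
    by (rule def_string_if[OF L def_string_const def_string_const])
  then show ?thesis
    unfolding def_reduces_def using assms(2,3) by (intro exI[of _ ?F]) simp
qed

context signature
begin

lemma definable_offset: "definable (\<lambda>w e. offset w R (map e is))"
  unfolding offset_def
  by (intro definable_add definable_mult definable_const definable_finite_sum definable_power
      definable_size definable_tuple_index) (use finite_signature in auto)

lemma def_label_lab: "def_label (\<lambda>w e. lab w R (map e is))"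
  unfolding lab_def
  by (intro def_label_if def_label_const def_string_nth[OF def_string_input] definable_Suc definable_offset)

lemma def_string_enc:
  assumes N: "definable (\<lambda>w e. N w)"
    and V: "\<And>R. R \<in> \<sigma> \<Longrightarrow> def_label (\<lambda>w e. V w R (map e [0..<ar R]))"
  shows "def_string (\<lambda>w e. enc (N w) (V w))"
proof -
  have pre: "def_string (\<lambda>w e. replicate (N w) True)"
  proof -
    have "replicate n True = concat (map (\<lambda>_. [True]) [0..<n])" for n
      by (simp add: map_replicate_const)
    then show ?thesis
      using def_string_concat[OF N, of "\<lambda>w e i. [True]", OF def_string_const] by simp
  qed
  have "def_string (\<lambda>w e. concat (map (table (N w) (V w)) Rs))" if "set Rs \<subseteq> \<sigma>" for Rs
    using that
  proof (induction Rs)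
    case Nil
    show ?case by (simp add: def_string_const)
  next
    case (Cons R Rs)
    have "def_string (\<lambda>w e. table (N w) (V w) R @ concat (map (table (N w) (V w)) Rs))"
    proof (rule def_string_append)
      show "def_string (\<lambda>w e. table (N w) (V w) R)"
        unfolding table_def by (rule def_string_table[OF V N]) (use Cons.prems in auto)
      show "def_string (\<lambda>w e. concat (map (table (N w) (V w)) Rs))"
        by (rule Cons.IH) (use Cons.prems in auto)
    qed
    then show ?case by simp
  qed
  then show ?thesis
    unfolding enc_def using pre finite_signature
    by (intro def_string_append def_string_const) auto
qed

text \<open>A string is an encoding iff decoding and encoding it again gives it back, which makes
  validity decidable.\<close>

definition valid :: "bool list \<Rightarrow> bool" where
  "valid w \<longleftrightarrow> w = enc (size_of w) (lab w)"

definition hom :: "nat \<Rightarrow> ('r \<Rightarrow> nat list \<Rightarrow> label) \<Rightarrow> nat \<Rightarrow> ('r \<Rightarrow> nat list \<Rightarrow> label) \<Rightarrow> (nat \<Rightarrow> nat) \<Rightarrow> bool" where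
  "hom m u n v h \<longleftrightarrow> (\<forall>x<m. h x < n) \<and>
     (\<forall>R\<in>\<sigma>. \<forall>t\<in>tuples {..<m} (ar R). u R t \<le> v R (map h t))"

definition maps_to where
  "maps_to m u n v \<longleftrightarrow> (\<exists>h. hom m u n v h)"

text \<open>The symbols of \<open>S\<close> are exempt: only they may carry stars. Sets between the
  empty one and \<sigma> give the intermediate problems.\<close>

definition star_free :: "'r set \<Rightarrow> nat \<Rightarrow> ('r \<Rightarrow> nat list \<Rightarrow> label) \<Rightarrow> bool" where
  "star_free S m u \<longleftrightarrow> (\<forall>R\<in>\<sigma> - S. \<forall>t\<in>tuples {..<m} (ar R). u R t \<noteq> Star)"

text \<open>\<open>lang {}\<close> is \<open>MP\<close> and \<open>lang \<sigma>\<close> is \<open>MP_star\<close>.\<close>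

definition lang :: "'r set \<Rightarrow> nat \<Rightarrow> ('r \<Rightarrow> nat list \<Rightarrow> label) \<Rightarrow> problem" where
  "lang S n v = {enc m u | m u. star_free S m u \<and> maps_to m u n v}"

lemma map_in_tuples: "t \<in> tuples {..<m} k \<Longrightarrow> (\<And>x. x < m \<Longrightarrow> h x < n) \<Longrightarrow> map h t \<in> tuples {..<n} k"
  by (auto simp: tuples_def)

lemma hom_cong:
  assumes "\<And>R t. R \<in> \<sigma> \<Longrightarrow> t \<in> tuples {..<m} (ar R) \<Longrightarrow> u R t = u' R t"
    and "\<And>R t. R \<in> \<sigma> \<Longrightarrow> t \<in> tuples {..<n} (ar R) \<Longrightarrow> v R t = v' R t"
  shows "hom m u n v h \<longleftrightarrow> hom m u' n v' h"
proof (cases "\<forall>x<m. h x < n")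
  case True
  then have "u R t \<le> v R (map h t) \<longleftrightarrow> u' R t \<le> v' R (map h t)"
    if "R \<in> \<sigma>" "t \<in> tuples {..<m} (ar R)" for R t
    using assms(1)[OF that] assms(2)[OF that(1) map_in_tuples[OF that(2)]] by simp
  then show ?thesis unfolding hom_def by auto
qed (auto simp: hom_def)

lemma star_free_lab_enc [simp]: "star_free S m (lab (enc m u)) \<longleftrightarrow> star_free S m u"
  unfolding star_free_def by auto

lemma maps_to_lab_enc [simp]:
  "maps_to m (lab (enc m u)) n v \<longleftrightarrow> maps_to m u n v"
  "maps_to m u n (lab (enc n v)) \<longleftrightarrow> maps_to m u n v"
proof -
  have "hom m (lab (enc m u)) n v h \<longleftrightarrow> hom m u n v h" "hom m u n (lab (enc n v)) h \<longleftrightarrow> hom m u n v h" for h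
    by (intro hom_cong; simp)+
  then show "maps_to m (lab (enc m u)) n v \<longleftrightarrow> maps_to m u n v"
    "maps_to m u n (lab (enc n v)) \<longleftrightarrow> maps_to m u n v"
    unfolding maps_to_def by blast+
qed

lemma valid_enc [simp]: "valid (enc m u)"
  unfolding valid_def by (auto intro!: enc_cong)

lemma lang_lab_enc [simp]: "lang S n (lab (enc n v)) = lang S n v"
  unfolding lang_def by simp

lemma in_lang_iff:
  "x \<in> lang S n v \<longleftrightarrow> valid x \<and> star_free S (size_of x) (lab x) \<and> maps_to (size_of x) (lab x) n v"
proof
  assume "x \<in> lang S n v"
  then show "valid x \<and> star_free S (size_of x) (lab x) \<and> maps_to (size_of x) (lab x) n v"
    unfolding lang_def by auto
next
  assume "valid x \<and> star_free S (size_of x) (lab x) \<and> maps_to (size_of x) (lab x) n v"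
  then show "x \<in> lang S n v"
    unfolding lang_def valid_def by blast
qed

lemma enc_in_lang_iff: "enc m u \<in> lang S n v \<longleftrightarrow> star_free S m u \<and> maps_to m u n v"
  by (simp add: in_lang_iff)

lemma Nil_notin_lang: "[] \<notin> lang S n v"
  by (auto simp: lang_def dest: sym)

lemma decidable_valid: "decidable (\<lambda>w e. valid w)"
  unfolding valid_def
  by (intro decidable_string_eq def_string_input def_string_enc definable_size def_label_lab)

lemma decidable_star_free: "decidable (\<lambda>w e. star_free S (size_of w) (lab w))"
  unfolding star_free_def
proof (intro decidable_finite_ball)
  fix R
  show "decidable (\<lambda>w e. \<forall>t\<in>tuples {..<size_of w} (ar R). lab w R t \<noteq> Star)"
    by (rule decidable_all_tuples[where P = "\<lambda>w a t. lab w R t \<noteq> Star", OF _ definable_size definable_one])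
      (intro decidable_not def_label_eq def_label_lab)
qed (use finite_signature in auto)

text \<open>\<open>N\<close> and \<open>V\<close> describe the new instance. Failure of
  \<open>C\<close> certifies a no-instance. Such inputs, and strings that are not instances at all,
  are sent to the empty string, which lies in no language \<open>lang\<close>.\<close>

lemma def_reduces_langI:
  assumes N: "definable (\<lambda>w e. N (size_of w) (lab w))"
    and V: "\<And>R. R \<in> \<sigma> \<Longrightarrow> def_label (\<lambda>w e. V (size_of w) (lab w) R (map e [0..<ar R]))"
    and C: "decidable (\<lambda>w e. C (size_of w) (lab w))"
    and ok: "\<And>m u. star_free S m u \<Longrightarrow> C m u \<Longrightarrow> star_free S' (N m u) (V m u)"
      "\<And>m u. star_free S m u \<Longrightarrow> C m u \<Longrightarrow> maps_to (N m u) (V m u) n' v' \<longleftrightarrow> maps_to m u n v"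
    and bad: "\<And>m u. star_free S m u \<Longrightarrow> \<not> C m u \<Longrightarrow> \<not> maps_to m u n v"
  shows "def_reduces (lang S n v) (lang S' n' v')"
proof -
  let ?C = "\<lambda>w. valid w \<and> star_free S (size_of w) (lab w) \<and> C (size_of w) (lab w)"
  let ?F = "\<lambda>w. if ?C w then enc (N (size_of w) (lab w)) (V (size_of w) (lab w)) else []"
  have "decidable (\<lambda>w e. ?C w)"
    by (intro decidable_conj decidable_valid decidable_star_free C)
  from def_string_if[OF this def_string_enc[OF N V] def_string_const[of "[]"]]
  have "def_string (\<lambda>w e. ?F w)" by simp
  moreover have "x \<in> lang S n v \<longleftrightarrow> ?F x \<in> lang S' n' v'" for x
    using ok bad by (auto simp: in_lang_iff[of x] enc_in_lang_iff Nil_notin_lang)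
  ultimately show ?thesis
    unfolding def_reduces_def by (intro exI[of _ ?F] conjI allI)
qed

section \<open>Agreement with the problems and families of the statement\<close>

definition nat_struct :: "nat \<Rightarrow> ('r \<Rightarrow> nat list \<Rightarrow> label) \<Rightarrow> (nat, 'r, label) struct" where
  "nat_struct n v = \<lparr>univ = {..<n}, rel = v\<rparr>"

lemma encode_eq_enc:
  "encode \<sigma> ar xs G = enc (length xs) (\<lambda>R t. rel G R (map ((!) xs) t))"
proof -
  have *: "product_lists (replicate k xs) = map (map ((!) xs)) (product_lists (replicate k [0..<length xs]))" for k
    using product_lists_map[of k "(!) xs" "[0..<length xs]"] by (simp add: map_nth)
  show ?thesis
    unfolding encode_def enc_def table_def * by (simp add: comp_def)
qed

lemma encode_nat_struct: "encode \<sigma> ar [0..<n] (nat_struct n v) = enc n v"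
proof -
  have "map ((!) [0..<n]) t = t" if "t \<in> tuples {..<n} k" for t k
    using that by (intro map_idI) (auto simp: tuples_def)
  then show ?thesis
    unfolding encode_eq_enc by (auto simp: nat_struct_def intro!: enc_cong)
qed

lemma enumerates_nat_struct: "enumerates [0..<n] (nat_struct n v)"
  by (auto simp: enumerates_def nat_struct_def)

definition index_of :: "'b list \<Rightarrow> 'b \<Rightarrow> nat" where
  "index_of xs y = (SOME j. j < length xs \<and> xs ! j = y)"

lemma index_of: "y \<in> set xs \<Longrightarrow> index_of xs y < length xs \<and> xs ! index_of xs y = y"
  unfolding index_of_def by (rule someI_ex) (auto simp: in_set_conv_nth)

lemma homomorphic_iff_maps_to:
  assumes xs: "enumerates xs G" and ys: "enumerates ys H"
  shows "homomorphic \<sigma> ar G H \<longleftrightarrow>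
    maps_to (length xs) (\<lambda>R t. rel G R (map ((!) xs) t)) (length ys) (\<lambda>R t. rel H R (map ((!) ys) t))"
proof
  have uG: "univ G = set xs" "distinct xs" and uH: "univ H = set ys"
    using xs ys by (auto simp: enumerates_def)
  {
    assume "homomorphic \<sigma> ar G H"
    then obtain h where "is_hom \<sigma> ar G H h"
      unfolding homomorphic_def ..
    then have h: "h ` set xs \<subseteq> set ys"
      "\<And>R t. R \<in> \<sigma> \<Longrightarrow> t \<in> tuples (set xs) (ar R) \<Longrightarrow> rel G R t \<le> rel H R (map h t)"
      unfolding is_hom_def uG uH by simp_all
    let ?h = "\<lambda>i. index_of ys (h (xs ! i))"
    have i: "?h i < length ys \<and> ys ! ?h i = h (xs ! i)" if "i < length xs" for i
      using h(1) that by (intro index_of) (simp add: image_subset_iff)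
    have "hom (length xs) (\<lambda>R t. rel G R (map ((!) xs) t)) (length ys) (\<lambda>R t. rel H R (map ((!) ys) t)) ?h"
      unfolding hom_def
    proof (intro conjI ballI allI impI)
      fix R t assume R: "R \<in> \<sigma>" and t: "t \<in> tuples {..<length xs} (ar R)"
      have "map ((!) xs) t \<in> tuples (set xs) (ar R)" using t by (auto simp: tuples_def)
      from h(2)[OF R this] have "rel G R (map ((!) xs) t) \<le> rel H R (map h (map ((!) xs) t))" .
      also have "map h (map ((!) xs) t) = map ((!) ys) (map ?h t)"
        using i t by (auto simp: tuples_def)
      finally show "rel G R (map ((!) xs) t) \<le> rel H R (map ((!) ys) (map ?h t))" .
    qed (use i in auto)
    then show "maps_to (length xs) (\<lambda>R t. rel G R (map ((!) xs) t)) (length ys) (\<lambda>R t. rel H R (map ((!) ys) t))"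
      unfolding maps_to_def by blast
  }
  {
    assume "maps_to (length xs) (\<lambda>R t. rel G R (map ((!) xs) t)) (length ys) (\<lambda>R t. rel H R (map ((!) ys) t))"
    then obtain h where "hom (length xs) (\<lambda>R t. rel G R (map ((!) xs) t)) (length ys) (\<lambda>R t. rel H R (map ((!) ys) t)) h"
      unfolding maps_to_def ..
    then have h: "\<And>i. i < length xs \<Longrightarrow> h i < length ys"
      "\<And>R t. R \<in> \<sigma> \<Longrightarrow> t \<in> tuples {..<length xs} (ar R) \<Longrightarrow>
         rel G R (map ((!) xs) t) \<le> rel H R (map ((!) ys) (map h t))"
      unfolding hom_def by simp_all
    let ?h = "\<lambda>x. ys ! h (index_of xs x)"
    have "is_hom \<sigma> ar G H ?h"
      unfolding is_hom_def uG uH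
    proof (intro conjI ballI)
      show "?h ` set xs \<subseteq> set ys"
      proof (rule image_subsetI)
        fix x assume "x \<in> set xs"
        then show "?h x \<in> set ys" using h(1)[of "index_of xs x"] index_of[of x xs] by simp
      qed
      fix R t assume R: "R \<in> \<sigma>" and t: "t \<in> tuples (set xs) (ar R)"
      have i: "index_of xs x < length xs \<and> xs ! index_of xs x = x" if "x \<in> set t" for x
        using t that by (intro index_of) (auto simp: tuples_def)
      let ?t = "map (index_of xs) t"
      have "?t \<in> tuples {..<length xs} (ar R)" using t i by (auto simp: tuples_def)
      from h(2)[OF R this] have "rel G R (map ((!) xs) ?t) \<le> rel H R (map ((!) ys) (map h ?t))" .
      moreover have "map ((!) xs) ?t = t" unfolding map_map comp_def by (rule map_idI) (use i in simp)
      ultimately show "rel G R t \<le> rel H R (map ?h t)" by (simp add: comp_def)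
    qed
    then show "homomorphic \<sigma> ar G H" unfolding homomorphic_def by blast
  }
qed

lemma hom_problem_eq_lang:
  assumes ys: "enumerates ys H" and P: "S = {} \<and> P = P01 \<or> S = \<sigma> \<and> P = Pstar"
  shows "hom_problem P \<sigma> ar H = lang S (length ys) (\<lambda>R t. rel H R (map ((!) ys) t))"
    (is "_ = lang S ?n ?v")
proof (intro set_eqI iffI)
  have Pc: "l \<in> P01 \<longleftrightarrow> l \<noteq> Star" "l \<in> Pstar" for l
    by (cases l; simp add: P01_def Pstar_def)+
  {
    fix w assume "w \<in> hom_problem P \<sigma> ar H"
    then obtain xs and G :: "(nat, 'r, label) struct" where w: "w = encode \<sigma> ar xs G" "is_structure P \<sigma> ar G" "enumerates xs G" "homomorphic \<sigma> ar G H"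
      unfolding hom_problem_def by blast
    have "rel G R (map ((!) xs) t) \<noteq> Star" if "R \<in> \<sigma> - S" "t \<in> tuples {..<length xs} (ar R)" for R t
    proof -
      have "univ G = set xs" using w(3) by (simp add: enumerates_def)
      then have "map ((!) xs) t \<in> tuples (univ G) (ar R)"
        using that by (auto simp: tuples_def)
      then show ?thesis using w(2) P that Pc by (auto simp: is_structure_def)
    qed
    then show "w \<in> lang S ?n ?v"
      unfolding w(1) encode_eq_enc enc_in_lang_iff homomorphic_iff_maps_to[OF w(3) ys, symmetric]
      using w(4) by (simp add: star_free_def)
  }
  {
    fix w assume "w \<in> lang S ?n ?v"
    then obtain m u where w: "w = enc m u" "star_free S m u" "maps_to m u ?n ?v"
      unfolding lang_def by blast
    have "map ((!) [0..<m]) t = t" if "t \<in> tuples {..<m} k" for t k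
      using that by (intro map_idI) (auto simp: tuples_def)
    then have "hom m (\<lambda>R t. rel (nat_struct m u) R (map ((!) [0..<m]) t)) ?n ?v h \<longleftrightarrow> hom m u ?n ?v h" for h
      by (intro hom_cong) (auto simp: nat_struct_def)
    then have "homomorphic \<sigma> ar (nat_struct m u) H"
      using homomorphic_iff_maps_to[OF enumerates_nat_struct[of m u] ys] w(3) by (simp add: maps_to_def)
    moreover have "is_structure P \<sigma> ar (nat_struct m u)"
      using w(2) P Pc by (auto simp: is_structure_def nat_struct_def star_free_def)
    ultimately show "w \<in> hom_problem P \<sigma> ar H"
      unfolding hom_problem_def w(1) encode_nat_struct[symmetric]
      using enumerates_nat_struct by blast
  }
qed

definition target :: "nat \<Rightarrow> ('r \<Rightarrow> nat list \<Rightarrow> label) \<Rightarrow> bool" where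
  "target n v \<longleftrightarrow> \<not> (\<exists>x<n. \<forall>R\<in>\<sigma>. v R (replicate (ar R) x) = Star)"

lemma target_lab_enc [simp]: "target n (lab (enc n v)) \<longleftrightarrow> target n v"
proof -
  have "replicate (ar R) x \<in> tuples {..<n} (ar R)" if "x < n" for x R
    using that by (auto simp: tuples_def)
  then show ?thesis unfolding target_def by auto
qed

lemma families_eq:
  "MP_family \<sigma> ar = {(enc n v, lang {} n v) | n v. target n v}"
  "MP_star_family \<sigma> ar = {(enc n v, lang \<sigma> n v) | n v. target n v}"
proof -
  have 1: "target (length xs) (\<lambda>R t. rel H R (map ((!) xs) t))" if "is_target \<sigma> ar H" "enumerates xs H" for xs and H :: "(nat, 'r, label) struct"
    using that by (force simp: target_def is_target_def enumerates_def map_replicate)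
  have 2: "is_target \<sigma> ar (nat_struct n v)" if "target n v" for n v
  proof -
    have "l \<in> Pstar" for l by (cases l) (auto simp: Pstar_def)
    then show ?thesis using that by (auto simp: target_def is_target_def nat_struct_def is_structure_def)
  qed
  \<comment> \<open>\<open>lang\<close> depends on the target only through its encoding, so it is
    enough that the two descriptions of the target have the same encoding.\<close>
  have l: "lang S (length [0..<n]) (\<lambda>R t. rel (nat_struct n v) R (map ((!) [0..<n]) t)) = lang S n v" for S n v
  proof -
    have "lang S (length [0..<n]) (\<lambda>R t. rel (nat_struct n v) R (map ((!) [0..<n]) t)) =
        lang S n (lab (encode \<sigma> ar [0..<n] (nat_struct n v)))"
      unfolding encode_eq_enc by simp
    then show ?thesis unfolding encode_nat_struct by simp
  qed
  note M = hom_problem_eq_lang[OF _ disjI1[OF conjI[OF refl refl]]] hom_problem_eq_lang[OF _ disjI2[OF conjI[OF refl refl]]]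
  show "MP_family \<sigma> ar = {(enc n v, lang {} n v) | n v. target n v}"
  proof (intro set_eqI iffI)
    fix p assume "p \<in> MP_family \<sigma> ar"
    then show "p \<in> {(enc n v, lang {} n v) | n v. target n v}"
      unfolding MP_family_def MP_def using 1 M(1) encode_eq_enc by fastforce
  next
    fix p assume "p \<in> {(enc n v, lang {} n v) | n v. target n v}"
    then obtain n v where p: "p = (enc n v, lang {} n v)" "target n v" by blast
    then have "p = (encode \<sigma> ar [0..<n] (nat_struct n v), MP \<sigma> ar (nat_struct n v))"
      unfolding MP_def M(1)[OF enumerates_nat_struct] l encode_nat_struct by simp
    then show "p \<in> MP_family \<sigma> ar"
      unfolding MP_family_def using 2[OF p(2)] enumerates_nat_struct by blast
  qed
  show "MP_star_family \<sigma> ar = {(enc n v, lang \<sigma> n v) | n v. target n v}"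
  proof (intro set_eqI iffI)
    fix p assume "p \<in> MP_star_family \<sigma> ar"
    then show "p \<in> {(enc n v, lang \<sigma> n v) | n v. target n v}"
      unfolding MP_star_family_def MP_star_def using 1 M(2) encode_eq_enc by fastforce
  next
    fix p assume "p \<in> {(enc n v, lang \<sigma> n v) | n v. target n v}"
    then obtain n v where p: "p = (enc n v, lang \<sigma> n v)" "target n v" by blast
    then have "p = (encode \<sigma> ar [0..<n] (nat_struct n v), MP_star \<sigma> ar (nat_struct n v))"
      unfolding MP_star_def M(2)[OF enumerates_nat_struct] l encode_nat_struct by simp
    then show "p \<in> MP_star_family \<sigma> ar"
      unfolding MP_star_family_def using 2[OF p(2)] enumerates_nat_struct by blast
  qed
qed

end

section \<open>Simulating stars\<close>

lemma label_le_simps [simp]: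
  "l \<le> Star" "l \<le> Zero \<longleftrightarrow> l = Zero" "l \<le> One \<longleftrightarrow> l = One" "Star \<le> l \<longleftrightarrow> l = Star"
  by (cases l; simp add: less_eq_label_def)+

lemma label_both: "Zero \<le> l \<Longrightarrow> One \<le> l \<Longrightarrow> l = Star"
  by (auto simp: less_eq_label_def)

lemma tuplesD:
  assumes "t \<in> tuples {..<m} k"
  shows "length t = k" "j < k \<Longrightarrow> t ! j < m"
  using assms nth_mem[of j t] by (auto simp: tuples_def simp del: nth_mem)

text \<open>Counting as in lower bounds for Ramsey numbers. There are at most
  \<open>2 ^ (2 * N)\<close> pairs of sets of size \<open>s\<close>, and each pair makes at most
  \<open>2 * 2 ^ (N * N - s * s)\<close> patterns constant. The first hypothesis keeps the total
  below the number \<open>2 ^ (N * N)\<close> of all patterns.\<close>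

lemma exists_mixed_pattern:
  assumes s: "2 * N + 1 < s * s" "s \<le> N"
  obtains E :: "(nat \<times> nat) set" where "finite E"
    "\<And>A B. A \<subseteq> {..<N} \<Longrightarrow> B \<subseteq> {..<N} \<Longrightarrow> s \<le> card A \<Longrightarrow> s \<le> card B \<Longrightarrow>
       (\<exists>a\<in>A. \<exists>b\<in>B. (a, b) \<in> E) \<and> (\<exists>a\<in>A. \<exists>b\<in>B. (a, b) \<notin> E)"
proof -
  let ?X = "{..<N} \<times> {..<N}"
  let ?P = "{A. A \<subseteq> {..<N} \<and> card A = s}"
  \<comment> \<open>The patterns that are constant on the product of the pair. They are free outside
    its \<open>s * s\<close> entries, which gives the exponent \<open>N * N - s * s\<close> for each
    of the two constants.\<close>
  define bad where "bad = (\<lambda>(A, B). {E \<in> Pow ?X. E \<inter> (A \<times> B) = {}} \<union> {E \<in> Pow ?X. A \<times> B \<subseteq> E})"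
  have bad_card: "card (bad p) \<le> 2 ^ (N * N - s * s + 1)" if pP: "p \<in> ?P \<times> ?P" for p
  proof -
    obtain A B where p: "p = (A, B)" and AB: "A \<subseteq> {..<N}" "B \<subseteq> {..<N}" "card A = s" "card B = s"
      using pP by auto
    have c: "card (Pow (?X - A \<times> B)) = 2 ^ (N * N - s * s)"
    proof -
      have "card (?X - A \<times> B) = card ?X - card (A \<times> B)"
        using AB by (intro card_Diff_subset finite_SigmaI) (auto intro: finite_subset)
      then show ?thesis using AB by (simp add: card_Pow card_cartesian_product)
    qed
    have "bad p \<subseteq> Pow (?X - A \<times> B) \<union> (\<lambda>E. E \<union> A \<times> B) ` Pow (?X - A \<times> B)"
    proof
      fix E assume "E \<in> bad p"
      then consider "E \<subseteq> ?X" "E \<inter> (A \<times> B) = {}" | "E \<subseteq> ?X" "A \<times> B \<subseteq> E"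
        unfolding bad_def p by auto
      then show "E \<in> Pow (?X - A \<times> B) \<union> (\<lambda>E. E \<union> A \<times> B) ` Pow (?X - A \<times> B)"
      proof cases
        case 2
        then have "E = (E - A \<times> B) \<union> A \<times> B" "E - A \<times> B \<in> Pow (?X - A \<times> B)" by blast+
        then show ?thesis by blast
      qed blast
    qed
    then have "card (bad p) \<le> card (Pow (?X - A \<times> B)) + card ((\<lambda>E. E \<union> A \<times> B) ` Pow (?X - A \<times> B))"
      by (intro order_trans[OF card_mono card_Un_le]) auto
    also have "\<dots> \<le> 2 ^ (N * N - s * s) + 2 ^ (N * N - s * s)"
      using c card_image_le[of "Pow (?X - A \<times> B)" "\<lambda>E. E \<union> A \<times> B"] by auto
    finally show ?thesis by simp
  qed
  have P: "finite ?P" "card ?P \<le> 2 ^ N"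
  proof -
    have "?P \<subseteq> Pow {..<N}" by auto
    from card_mono[OF _ this] finite_subset[OF this] show "finite ?P" "card ?P \<le> 2 ^ N"
      by (auto simp: card_Pow)
  qed
  have "card (\<Union> (bad ` (?P \<times> ?P))) \<le> (\<Sum>p\<in>?P \<times> ?P. card (bad p))"
    using P by (intro card_UN_le) auto
  also have "\<dots> \<le> (\<Sum>p\<in>?P \<times> ?P. 2 ^ (N * N - s * s + 1))"
    by (intro sum_mono bad_card)
  also have "\<dots> = card ?P * card ?P * 2 ^ (N * N - s * s + 1)"
    by (simp add: card_cartesian_product)
  also have "\<dots> \<le> 2 ^ N * 2 ^ N * 2 ^ (N * N - s * s + 1)"
    using P(2) by (intro mult_le_mono) auto
  also have "\<dots> = 2 ^ (2 * N + 1 + (N * N - s * s))"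
    by (simp only: power_add[symmetric] mult_2 add.assoc add.commute[of 1])
  \<comment> \<open>\<open>s \<le> N\<close> ensures that the subtraction in the exponent is not
    truncated.\<close>
  also have "\<dots> < 2 ^ (N * N)"
  proof -
    have "s * s \<le> N * N" using s(2) by (intro mult_le_mono)
    then show ?thesis using s(1) by (intro power_strict_increasing) auto
  qed
  also have "\<dots> = card (Pow ?X)" by (simp add: card_Pow card_cartesian_product)
  finally have less: "card (\<Union> (bad ` (?P \<times> ?P))) < card (Pow ?X)" .
  have "\<Union> (bad ` (?P \<times> ?P)) \<subseteq> Pow ?X" by (auto simp: bad_def)
  then have fin: "finite (\<Union> (bad ` (?P \<times> ?P)))" by (rule finite_subset) simp
  have "\<not> Pow ?X \<subseteq> \<Union> (bad ` (?P \<times> ?P))"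
  proof
    assume "Pow ?X \<subseteq> \<Union> (bad ` (?P \<times> ?P))"
    from card_mono[OF fin this] less show False by simp
  qed
  then obtain E where "E \<in> Pow ?X" "E \<notin> \<Union> (bad ` (?P \<times> ?P))"
    by (meson subsetI)
  then have E: "E \<subseteq> ?X" "\<And>p. p \<in> ?P \<times> ?P \<Longrightarrow> E \<notin> bad p"
    by (simp, blast)
  show thesis
  proof
    show "finite E" using E(1) by (rule finite_subset) auto
    fix A B assume AB: "A \<subseteq> {..<N}" "B \<subseteq> {..<N}" "s \<le> card A" "s \<le> card B"
    \<comment> \<open>The count concerns sets of size exactly \<open>s\<close>; a mixed pattern on
      smaller sets is mixed on the larger ones.\<close>
    obtain A' where A': "A' \<subseteq> A" "card A' = s" using obtain_subset_with_card_n[OF AB(3)] by blast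
    obtain B' where B': "B' \<subseteq> B" "card B' = s" using obtain_subset_with_card_n[OF AB(4)] by blast
    have "(A', B') \<in> ?P \<times> ?P" using A' B' AB by auto
    from E(2)[OF this] E(1) have "E \<inter> (A' \<times> B') \<noteq> {}" "\<not> A' \<times> B' \<subseteq> E"
      unfolding bad_def by auto
    then show "(\<exists>a\<in>A. \<exists>b\<in>B. (a, b) \<in> E) \<and> (\<exists>a\<in>A. \<exists>b\<in>B. (a, b) \<notin> E)"
      using A'(1) B'(1) by blast
  qed
qed

lemma pigeonhole_fibre:
  fixes c :: "nat \<Rightarrow> nat"
  assumes "\<And>i. i < N \<Longrightarrow> c i < n" "n * s < N"
  shows "\<exists>x<n. s \<le> card {i. i < N \<and> c i = x}"
proof (rule ccontr)
  assume "\<not> ?thesis"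
  then have less: "\<And>x. x < n \<Longrightarrow> card {i. i < N \<and> c i = x} \<le> s" by force
  have "{..<N} = (\<Union>x<n. {i. i < N \<and> c i = x})" using assms(1) by auto
  then have "N = card (\<Union>x<n. {i. i < N \<and> c i = x})" by (metis card_lessThan)
  also have "\<dots> \<le> (\<Sum>x<n. card {i. i < N \<and> c i = x})" by (rule card_UN_le) simp
  also have "\<dots> \<le> (\<Sum>x<n. s)" using less by (intro sum_mono) simp
  finally show False using assms(2) by simp
qed

context signature
begin

section \<open>Removing stars of nullary symbols and of symbols of arity at least two\<close>

lemma star_free_mono: "star_free S m u \<Longrightarrow> S \<subseteq> S' \<Longrightarrow> star_free S' m u"
  by (auto simp: star_free_def)

text \<open>The identity alone would not do: an input with stars outside \<open>S\<close> may belong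
  to the larger language and has to be rejected first.\<close>

lemma lang_mono_reduces:
  assumes "S \<subseteq> S'"
  shows "def_reduces (lang S n v) (lang S' n v)"
  by (rule def_reduces_langI[where N = "\<lambda>m u. m" and V = "\<lambda>m u. u" and C = "\<lambda>m u. True"])
    (use assms in \<open>auto intro: definable_size def_label_lab decidable_const star_free_mono\<close>)

text \<open>A nullary star of the target lies above every label, so an input star there can be
  replaced by \<open>Zero\<close>. Where the target has no star, an input star proves that there is
  no homomorphism.\<close>

lemma lang_unused_stars_reduces:
  assumes v: "\<And>R. R \<in> \<sigma> - S \<Longrightarrow> ar R = 0 \<and> v R [] = Star \<or> (\<forall>t\<in>tuples {..<n} (ar R). v R t \<noteq> Star)"
  shows "def_reduces (lang \<sigma> n v) (lang S n v)"
proof -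
  define Z where "Z = {R \<in> \<sigma> - S. ar R = 0 \<and> v R [] = Star}"
  let ?V = "\<lambda>m u R t. if R \<in> Z \<and> u R t = Star then Zero else u R t"
  show ?thesis
  proof (rule def_reduces_langI[where N = "\<lambda>m u. m" and V = ?V and C = "star_free (S \<union> Z)"])
    show "def_label (\<lambda>w e. ?V (size_of w) (lab w) R (map e [0..<ar R]))" for R
      by (intro def_label_if decidable_conj decidable_const def_label_eq def_label_lab def_label_const)
    show "decidable (\<lambda>w e. star_free (S \<union> Z) (size_of w) (lab w))"
      by (rule decidable_star_free)
    fix m u
    show "star_free S m (?V m u)" if "star_free (S \<union> Z) m u"
      using that by (auto simp: star_free_def)
    have "?V m u R t \<le> v R (map h t) \<longleftrightarrow> u R t \<le> v R (map h t)" if "t \<in> tuples {..<m} (ar R)" for R t h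
      using that by (auto simp: Z_def tuples_0)
    then show "maps_to m (?V m u) n v \<longleftrightarrow> maps_to m u n v"
      unfolding maps_to_def hom_def by auto
    show "\<not> maps_to m u n v" if "\<not> star_free (S \<union> Z) m u"
    proof
      from that obtain R t where R: "R \<in> \<sigma>" "R \<notin> S" "R \<notin> Z" "t \<in> tuples {..<m} (ar R)" "u R t = Star"
        unfolding star_free_def by blast
      assume "maps_to m u n v"
      then obtain h where h: "hom m u n v h" unfolding maps_to_def ..
      then have "u R t \<le> v R (map h t)" using R unfolding hom_def by blast
      moreover have "map h t \<in> tuples {..<n} (ar R)"
        using h R(4) by (intro map_in_tuples) (auto simp: hom_def)
      ultimately show False using v[of R] R by (auto simp: Z_def)
    qed
  qed (rule definable_size)
qed

lemma lang_binary_stars_reduces: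
  assumes S: "\<And>R. R \<in> S \<Longrightarrow> 2 \<le> ar R"
  shows "def_reduces (lang S n v) (lang {} n v)"
proof -
  \<comment> \<open>With \<open>N = (n + 1) * s\<close> the requirement
    \<open>2 * N + 1 < s * s\<close> reduces to \<open>1 < s\<close>, and \<open>n * s < N\<close>
    is what the pigeonhole argument needs.\<close>
  define s where "s = 2 * n + 3"
  define N where "N = (n + 1) * s"
  have sN: "2 * N + 1 < s * s" "s \<le> N" "n * s < N" "0 < s" "0 < N"
    by (simp_all add: N_def s_def algebra_simps)
  obtain E :: "(nat \<times> nat) set" where E: "finite E"
    "\<And>A B. A \<subseteq> {..<N} \<Longrightarrow> B \<subseteq> {..<N} \<Longrightarrow> s \<le> card A \<Longrightarrow> s \<le> card B \<Longrightarrow>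
       (\<exists>a\<in>A. \<exists>b\<in>B. (a, b) \<in> E) \<and> (\<exists>a\<in>A. \<exists>b\<in>B. (a, b) \<notin> E)"
    by (rule exists_mixed_pattern[OF sN(1,2)]) (rule that)
  \<comment> \<open>Element \<open>y\<close> of the new input is copy \<open>y mod N\<close> of
    vertex \<open>y div N\<close>.\<close>
  let ?l = "\<lambda>u R t. u R (map (\<lambda>x. x div N) t)"
  let ?mixed = "\<lambda>R t. 2 \<le> ar R \<and> (\<exists>p\<in>E. t ! 0 mod N = fst p \<and> t ! 1 mod N = snd p)"
  let ?V = "\<lambda>m u R t. if ?l u R t = Star then if ?mixed R t then One else Zero else ?l u R t"
  show ?thesis
  proof (rule def_reduces_langI[where N = "\<lambda>m u. m * N" and V = ?V and C = "\<lambda>m u. True"])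
    show "definable (\<lambda>w e. size_of w * N)"
      by (intro definable_mult definable_size definable_const)
    fix R
    have l: "def_label (\<lambda>w e. lab w R (map (\<lambda>x. x div N) (map e [0..<ar R])))"
      by (rule def_label_tuple[OF def_label_lab def_tuple_map[OF def_tuple_vars]])
        (intro definable_div_const definable_var)
    have "decidable (\<lambda>w e. ?mixed R (map e [0..<ar R]))"
    proof (cases "2 \<le> ar R")
      case True
      then have *: "?mixed R (map e [0..<ar R]) \<longleftrightarrow> (\<exists>p\<in>E. e 0 mod N = fst p \<and> e 1 mod N = snd p)" for e
        by simp
      show ?thesis unfolding *
        by (intro decidable_finite_bex E(1) decidable_conj decidable_eq definable_mod_const definable_var definable_const)
    next
      case False
      then show ?thesis by (simp add: decidable_const)
    qed
    then show "def_label (\<lambda>w e. ?V (size_of w) (lab w) R (map e [0..<ar R]))"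
      by (intro def_label_if def_label_eq def_label_const l)
  next
    fix m u assume sf: "star_free S m u"
    show "star_free {} (m * N) (?V m u)" by (auto simp: star_free_def)
    show "maps_to (m * N) (?V m u) n v \<longleftrightarrow> maps_to m u n v"
    proof
      assume "maps_to m u n v"
      then obtain h where h: "hom m u n v h" unfolding maps_to_def ..
      have "hom (m * N) (?V m u) n v (\<lambda>y. h (y div N))"
        unfolding hom_def
      proof (intro conjI ballI allI impI)
        show "h (y div N) < n" if "y < m * N" for y
          using h less_mult_imp_div_less[OF that] by (simp add: hom_def)
        fix R t assume R: "R \<in> \<sigma>" "t \<in> tuples {..<m * N} (ar R)"
        have "map (\<lambda>x. x div N) t \<in> tuples {..<m} (ar R)"
          using R(2) by (rule map_in_tuples) (rule less_mult_imp_div_less)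
        then have "?l u R t \<le> v R (map h (map (\<lambda>x. x div N) t))" using h R(1) unfolding hom_def by blast
        then show "?V m u R t \<le> v R (map (\<lambda>y. h (y div N)) t)" by (auto simp: comp_def)
      qed
      then show "maps_to (m * N) (?V m u) n v" unfolding maps_to_def by blast
    next
      assume "maps_to (m * N) (?V m u) n v"
      then obtain h where h: "hom (m * N) (?V m u) n v h" unfolding maps_to_def ..
      have bound: "x * N + i < m * N" if "x < m" "i < N" for x i
        using that by (rule concat_const_bound)
      have "\<exists>y<n. s \<le> card {i. i < N \<and> h (x * N + i) = y}" if "x < m" for x
        using h bound[OF that] sN(3) by (intro pigeonhole_fibre) (auto simp: hom_def)
      then obtain a where a: "\<And>x. x < m \<Longrightarrow> a x < n \<and> s \<le> card {i. i < N \<and> h (x * N + i) = a x}" by metis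
      let ?F = "\<lambda>x. {i. i < N \<and> h (x * N + i) = a x}"
      have "?F x \<noteq> {}" if "x < m" for x
        using a[OF that] sN(4) by (auto simp del: Collect_empty_eq)
      then have "\<exists>i. i \<in> ?F x" if "x < m" for x using that by blast
      then obtain f where f: "\<And>x. x < m \<Longrightarrow> f x \<in> ?F x" by metis
      \<comment> \<open>\<open>g\<close> chooses copies from the large fibres, independently at each
        position. All choices have the same image \<open>map a t\<close>, so each of them gives a
        constraint on one and the same target label.\<close>
      have lift: "u R t = Star \<and> (if ?mixed R (map (\<lambda>j. t ! j * N + g j) [0..<ar R]) then One else Zero) \<le> v R (map a t)
          \<or> u R t \<noteq> Star \<and> u R t \<le> v R (map a t)"
        if R: "R \<in> \<sigma>" "t \<in> tuples {..<m} (ar R)" and g: "\<And>j. j < ar R \<Longrightarrow> g j \<in> ?F (t ! j)" for R t g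
      proof -
        let ?t = "map (\<lambda>j. t ! j * N + g j) [0..<ar R]"
        have len: "length t = ar R" and lt: "\<And>j. j < ar R \<Longrightarrow> t ! j < m"
          using tuplesD[OF R(2)] by auto
        have "?t \<in> tuples {..<m * N} (ar R)"
          using g lt bound by (auto simp: tuples_def)
        then have "?V m u R ?t \<le> v R (map h ?t)" using h R(1) unfolding hom_def by blast
        moreover have "map h ?t = map a t" using g len by (intro nth_equalityI) auto
        moreover have "map (\<lambda>x. x div N) ?t = t" using g len sN(5) by (intro nth_equalityI) auto
        ultimately show ?thesis by (auto split: if_splits)
      qed
      have "hom m u n v a"
        unfolding hom_def
      proof (intro conjI ballI allI impI)
        fix R t assume R: "R \<in> \<sigma>" "t \<in> tuples {..<m} (ar R)"
        have len: "length t = ar R" and lt: "\<And>j. j < ar R \<Longrightarrow> t ! j < m"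
          using tuplesD[OF R(2)] by auto
        show "u R t \<le> v R (map a t)"
        proof (cases "u R t = Star")
          case False
          then show ?thesis using lift[OF R, of "\<lambda>j. f (t ! j)"] f lt by blast
        next
          case True
          then have "R \<in> S" using sf R unfolding star_free_def by blast
          then have k: "2 \<le> ar R" by (rule S)
          have sub: "?F x \<subseteq> {..<N}" for x by auto
          \<comment> \<open>If \<open>t\<close> repeats a vertex in its first two positions, the two
            fibres coincide; the pattern lemma permits this.\<close>
          have "(\<exists>i\<in>?F (t ! 0). \<exists>j\<in>?F (t ! 1). (i, j) \<in> E) \<and> (\<exists>i\<in>?F (t ! 0). \<exists>j\<in>?F (t ! 1). (i, j) \<notin> E)"
            using k a[OF lt[of 0]] a[OF lt[of 1]] by (intro E(2) sub) auto
          then obtain i j i' j' where ij: "i \<in> ?F (t ! 0)" "j \<in> ?F (t ! 1)" "(i, j) \<in> E"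
            and ij': "i' \<in> ?F (t ! 0)" "j' \<in> ?F (t ! 1)" "(i', j') \<notin> E" by blast
          have val: "(if (p, q) \<in> E then One else Zero) \<le> v R (map a t)"
            if pq: "p \<in> ?F (t ! 0)" "q \<in> ?F (t ! 1)" for p q
          proof -
            \<comment> \<open>Only the first two copies enter the pattern. The later positions take
              the fixed choice \<open>f\<close> from their fibres.\<close>
            let ?g = "\<lambda>l. if l = 0 then p else if l = 1 then q else f (t ! l)"
            have "?g l \<in> ?F (t ! l)" if "l < ar R" for l using pq f[OF lt[OF that]] by auto
            from lift[OF R, of ?g, OF this] True
            have "(if ?mixed R (map (\<lambda>j. t ! j * N + ?g j) [0..<ar R]) then One else Zero) \<le> v R (map a t)" by blast
            moreover have "?mixed R (map (\<lambda>j. t ! j * N + ?g j) [0..<ar R]) \<longleftrightarrow> (p, q) \<in> E"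
            proof -
              have "p < N" "q < N" using pq by auto
              then show ?thesis using k by (auto intro: bexI[of _ "(p, q)"])
            qed
            ultimately show ?thesis by simp
          qed
          from val[OF ij(1,2)] val[OF ij'(1,2)] ij(3) ij'(3) have "v R (map a t) = Star"
            by (intro label_both) auto
          then show ?thesis by simp
        qed
      qed (use a in auto)
      then show "maps_to m u n v" unfolding maps_to_def by blast
    qed
  qed (use decidable_const in auto)
qed

text \<open>Every element is doubled, \<open>y\<close> being a copy of \<open>y div 2\<close>, even
  where \<open>U\<close> has no star. Such copies are harmless twins, and the uniform doubling
  avoids any renumbering.\<close>

definition split_stars :: "'r \<Rightarrow> ('r \<Rightarrow> nat list \<Rightarrow> label) \<Rightarrow> 'r \<Rightarrow> nat list \<Rightarrow> label" where
  "split_stars U v R t =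
     (if R = U \<and> v U (map (\<lambda>x. x div 2) t) = Star then if hd t mod 2 = 0 then Zero else One
      else v R (map (\<lambda>x. x div 2) t))"

text \<open>Halving an image can only raise labels in the target. Conversely, the label of
  \<open>x\<close> in \<open>U\<close> is 0 or 1 as the input is star-free, and it selects the
  parity of the copy to which \<open>x\<close> is sent.\<close>

lemma lang_split_stars:
  assumes U: "U \<in> \<sigma>" "ar U = 1"
  shows "lang {} (n * 2) (split_stars U v) = lang {} n v"
proof -
  have "maps_to m u (n * 2) (split_stars U v) \<longleftrightarrow> maps_to m u n v" if sf: "star_free {} m u" for m u
  proof
    assume "maps_to m u (n * 2) (split_stars U v)"
    then obtain h where h: "hom m u (n * 2) (split_stars U v) h" unfolding maps_to_def ..
    have "split_stars U v R t \<le> v R (map (\<lambda>x. x div 2) t)" for R t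
      by (auto simp: split_stars_def)
    then have "hom m u n v (\<lambda>x. h x div 2)"
      using h less_mult_imp_div_less[of _ n 2] unfolding hom_def
      by (fastforce simp: comp_def intro: order_trans)
    then show "maps_to m u n v" unfolding maps_to_def by blast
  next
    assume "maps_to m u n v"
    then obtain h where h: "hom m u n v h" unfolding maps_to_def ..
    let ?h = "\<lambda>x. h x * 2 + (if u U [x] = One then 1 else 0)"
    have d: "?h x div 2 = h x" "?h x mod 2 = 0 \<longleftrightarrow> u U [x] \<noteq> One" for x by auto
    have "hom m u (n * 2) (split_stars U v) ?h"
      unfolding hom_def
    proof (intro conjI ballI allI impI)
      show "?h x < n * 2" if "x < m" for x
        using h that concat_const_bound[of "h x" n "if u U [x] = One then 1 else 0" 2] by (simp add: hom_def)
      fix R t assume R: "R \<in> \<sigma>" "t \<in> tuples {..<m} (ar R)"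
      have le: "u R t \<le> v R (map h t)" and ns: "u R t \<noteq> Star"
        using h sf R unfolding hom_def star_free_def by auto
      have m: "map (\<lambda>x. x div 2) (map ?h t) = map h t" by (simp add: comp_def d)
      show "u R t \<le> split_stars U v R (map ?h t)"
      proof (cases "R = U \<and> v U (map h t) = Star")
        case True
        then obtain x where t: "t = [x]" using R(2) U(2) by (auto simp: tuples_def length_Suc_conv)
        show ?thesis
          unfolding split_stars_def m using True ns d(2)[of x] unfolding t
          by (cases "u U [x]") auto
      next
        case False
        then show ?thesis unfolding split_stars_def m using le by auto
      qed
    qed
    then show "maps_to m u (n * 2) (split_stars U v)" unfolding maps_to_def by blast
  qed
  then show ?thesis unfolding lang_def by blast
qed

text \<open>No tuple relates two elements, so their images can be chosen independently of each
  other, each from the fixed finite target.\<close>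

lemma decidable_lang_unary:
  assumes "\<And>R. R \<in> \<sigma> \<Longrightarrow> ar R \<le> 1"
  shows "decidable (\<lambda>w e. w \<in> lang S n v)"
proof -
  have maps: "maps_to m u n v \<longleftrightarrow>
      (\<forall>R\<in>\<sigma>. ar R = 0 \<longrightarrow> u R [] \<le> v R []) \<and>
      (\<forall>x<m. \<exists>y\<in>{..<n}. \<forall>R\<in>\<sigma>. ar R = 1 \<longrightarrow> u R [x] \<le> v R [y])" for m u
  proof
    assume "maps_to m u n v"
    then obtain h where h: "\<forall>x<m. h x < n"
      "\<And>R t. R \<in> \<sigma> \<Longrightarrow> t \<in> tuples {..<m} (ar R) \<Longrightarrow> u R t \<le> v R (map h t)"
      unfolding maps_to_def hom_def by auto
    have "u R [] \<le> v R []" if "R \<in> \<sigma>" "ar R = 0" for R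
      using h(2)[of R "[]"] that by (simp add: tuples_0)
    moreover have "u R [x] \<le> v R [h x]" if "R \<in> \<sigma>" "ar R = 1" "x < m" for R x
      using h(2)[of R "[x]"] that by (simp add: tuples_def)
    ultimately show "(\<forall>R\<in>\<sigma>. ar R = 0 \<longrightarrow> u R [] \<le> v R []) \<and>
      (\<forall>x<m. \<exists>y\<in>{..<n}. \<forall>R\<in>\<sigma>. ar R = 1 \<longrightarrow> u R [x] \<le> v R [y])"
      using h(1) by blast
  next
    assume A: "(\<forall>R\<in>\<sigma>. ar R = 0 \<longrightarrow> u R [] \<le> v R []) \<and>
      (\<forall>x<m. \<exists>y\<in>{..<n}. \<forall>R\<in>\<sigma>. ar R = 1 \<longrightarrow> u R [x] \<le> v R [y])"
    then have "\<forall>x. \<exists>y. x < m \<longrightarrow> y < n \<and> (\<forall>R\<in>\<sigma>. ar R = 1 \<longrightarrow> u R [x] \<le> v R [y])" by auto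
    then obtain h where h: "\<forall>x. x < m \<longrightarrow> h x < n \<and> (\<forall>R\<in>\<sigma>. ar R = 1 \<longrightarrow> u R [x] \<le> v R [h x])"
      by (rule choice[THEN exE])
    have "u R t \<le> v R (map h t)" if R: "R \<in> \<sigma>" "t \<in> tuples {..<m} (ar R)" for R t
    proof -
      consider "ar R = 0" | "ar R = 1" using assms[OF R(1)] by linarith
      then show ?thesis
      proof cases
        case 1
        then show ?thesis using A R by (simp add: tuples_0)
      next
        case 2
        then obtain x where "t = [x]" "x < m" using R(2) by (auto simp: tuples_def length_Suc_conv)
        then show ?thesis using h R(1) 2 by simp
      qed
    qed
    then have "hom m u n v h" using h unfolding hom_def by simp
    then show "maps_to m u n v" unfolding maps_to_def by blast
  qed
  have le: "l \<le> c \<longleftrightarrow> l = c \<or> c = Star" for l c :: label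
    by (rule less_eq_label_def)
  show ?thesis
    unfolding in_lang_iff maps le
    using def_label_lab[of _ "[]"] def_label_lab[of _ "[0]"] finite_signature
    by (intro decidable_conj decidable_valid decidable_star_free decidable_finite_ball decidable_imp
        decidable_const decidable_disj decidable_all definable_size decidable_finite_bex def_label_eq) auto
qed

text \<open>The empty structure is a yes-instance once its nullary symbols are labelled below those
  of the target; stars are avoided so that it is an input for every \<open>S\<close>.\<close>

lemma lang_nonempty: "\<exists>x. x \<in> lang S n v"
proof -
  let ?u = "\<lambda>R t. if v R t = Star then Zero else v R t"
  have "t = []" if "t \<in> tuples {..<0} k" for t :: "nat list" and k using that by (auto simp: tuples_def)
  then have "hom 0 ?u n v id" unfolding hom_def by auto
  moreover have "star_free S 0 ?u" by (auto simp: star_free_def)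
  ultimately show ?thesis unfolding lang_def maps_to_def by blast
qed

end

section \<open>Trading a unary symbol\<close>

definition flip :: "label \<Rightarrow> label" where
  "flip l = (if l = Zero then One else if l = One then Zero else Star)"

lemma flip_simps [simp]: "flip Zero = One" "flip One = Zero" "flip Star = Star"
  by (simp_all add: flip_def)

lemma flip_le_iff: "flip l \<le> l' \<longleftrightarrow> l \<le> flip l'"
  by (cases l; cases l') (auto simp: less_eq_label_def)

lemma decidable_ex_tuples:
  assumes "decidable (\<lambda>w e. P w (e K) (map e [0..<K]))" "definable (\<lambda>w e. N w)" "definable a"
  shows "decidable (\<lambda>w e. \<exists>t\<in>tuples {..<N w} K. P w (a w e) t)"
proof -
  have "decidable (\<lambda>w e. \<not> (\<forall>t\<in>tuples {..<N w} K. \<not> P w (a w e) t))"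
    by (intro decidable_not decidable_all_tuples assms)
  then show ?thesis by simp
qed

locale pinning = signature \<sigma> ar for \<sigma> :: "'r::linorder set" and ar +
  fixes U E :: 'r
  assumes U: "U \<in> \<sigma>" "ar U = 1" and E: "E \<in> \<sigma>" "2 \<le> ar E"
begin

text \<open>
  The new element \<open>n\<close> is the only one with label \<open>One\<close> in \<open>U\<close>, so it can be addressed; the old
  label of \<open>x\<close> in \<open>U\<close> is stored in the \<open>E\<close>-tuples starting with \<open>n, x\<close> and, negated, in those
  starting with \<open>x, n\<close>. The new element \<open>n + 1\<close> absorbs the elements of an input on which these
  tuples impose no constraint.
\<close>

definition pin :: "nat \<Rightarrow> ('r \<Rightarrow> nat list \<Rightarrow> label) \<Rightarrow> 'r \<Rightarrow> nat list \<Rightarrow> label" where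
  "pin n v R t =
     (if R = U then if t = [n] then One else Zero
      else if R = E \<and> t ! 0 = n \<and> t ! 1 \<noteq> n then if t ! 1 < n then v U [t ! 1] else Zero
      else if R = E \<and> t ! 0 \<noteq> n \<and> t ! 1 = n then if t ! 0 < n then flip (v U [t ! 0]) else Zero
      else if \<forall>x\<in>set t. x < n then v R t else Star)"

section \<open>Translating inputs over the old target into inputs over the pinned one\<close>

lemma E_neq_U [simp]: "E \<noteq> U" "U \<noteq> E"
  using U E by auto

lemma pin_U: "pin n v U t = (if t = [n] then One else Zero)"
  by (simp add: pin_def)

lemma pin_E_left: "y \<noteq> n \<Longrightarrow> t ! 0 = n \<Longrightarrow> t ! 1 = y \<Longrightarrow> pin n v E t = (if y < n then v U [y] else Zero)"
  by (simp add: pin_def)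

lemma pin_E_right: "y \<noteq> n \<Longrightarrow> t ! 0 = y \<Longrightarrow> t ! 1 = n \<Longrightarrow> pin n v E t = (if y < n then flip (v U [y]) else Zero)"
  by (simp add: pin_def)

lemma pin_old:
  assumes "R \<in> \<sigma>" "R \<noteq> U" "t \<in> tuples {..<n} (ar R)"
  shows "pin n v R t = v R t"
proof -
  have "\<not> (R = E \<and> (t ! 0 = n \<or> t ! 1 = n))"
    using tuplesD(2)[OF assms(3), of 0] tuplesD(2)[OF assms(3), of 1] E by auto
  then show ?thesis using assms by (auto simp: pin_def tuples_def)
qed

lemma pin_new:
  assumes "R \<noteq> U" "R = E \<longrightarrow> (t ! 0 = n \<longleftrightarrow> t ! 1 = n)" "\<not> (\<forall>x\<in>set t. x < n)"
  shows "pin n v R t = Star"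
  using assms by (auto simp: pin_def)

text \<open>The new elements \<open>m\<close> and \<open>m + 1\<close> are both marked by
  \<open>U\<close> and hence forced onto \<open>n\<close>. Two are needed because a star of
  \<open>x\<close> in \<open>U\<close> is expressed by demanding \<open>Zero\<close> through one of
  them and \<open>One\<close> through the other. \<open>Zero\<close> on the remaining new tuples
  outside \<open>U\<close> is a default, as the target has \<open>Star\<close> there.\<close>

definition forget_stars :: "nat \<Rightarrow> ('r \<Rightarrow> nat list \<Rightarrow> label) \<Rightarrow> 'r \<Rightarrow> nat list \<Rightarrow> label" where
  "forget_stars m u R t =
     (if R = U then if t = [m] \<or> t = [m + 1] then One else Zero
      else if R = E \<and> m \<le> t ! 0 \<and> t ! 1 < m then
        if u U [t ! 1] = Star then if t ! 0 = m then Zero else One else u U [t ! 1]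
      else if R = E \<and> t ! 0 < m \<and> m \<le> t ! 1 then
        if u U [t ! 0] = Star then if t ! 1 = m then One else Zero else flip (u U [t ! 0])
      else if \<forall>x\<in>set t. x < m then u R t else Zero)"

lemma forget_stars_old:
  assumes "R \<in> \<sigma>" "R \<noteq> U" "t \<in> tuples {..<m} (ar R)"
  shows "forget_stars m u R t = u R t"
proof -
  have "\<not> (R = E \<and> (m \<le> t ! 0 \<or> m \<le> t ! 1))"
    using tuplesD(2)[OF assms(3), of 0] tuplesD(2)[OF assms(3), of 1] E by auto
  then show ?thesis using assms by (auto simp: forget_stars_def tuples_def)
qed

lemma star_free_forget_stars:
  assumes "star_free (insert U S) m u" "E \<in> S"
  shows "star_free S (m + 2) (forget_stars m u)"
  unfolding star_free_def
proof (intro ballI)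
  fix R t assume R: "R \<in> \<sigma> - S" and t: "t \<in> tuples {..<m + 2} (ar R)"
  show "forget_stars m u R t \<noteq> Star"
  proof (cases "R \<noteq> U \<and> (\<forall>x\<in>set t. x < m)")
    case True
    then have "t \<in> tuples {..<m} (ar R)" using t by (auto simp: tuples_def)
    then show ?thesis using forget_stars_old[of R t m u] True R assms(1) by (auto simp: star_free_def)
  next
    case False
    then show ?thesis using R assms(2) by (auto simp: forget_stars_def)
  qed
qed

lemma hom_forget_stars:
  assumes hm: "hom m u n v h"
  shows "hom (m + 2) (forget_stars m u) (n + 2) (pin n v) (\<lambda>x. if x < m then h x else n)"
    (is "hom _ _ _ _ ?h")
  unfolding hom_def
proof (intro conjI ballI allI impI)
  have hn: "h x < n" if "x < m" for x using hm that by (simp add: hom_def)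
  show "?h x < n + 2" for x using hn[of x] by auto
  have hU: "u U [x] \<le> v U [h x]" if "x < m" for x
  proof -
    have "[x] \<in> tuples {..<m} (ar U)" using that U by (simp add: tuples_def)
    then have "u U [x] \<le> v U (map h [x])" using hm U(1) unfolding hom_def by blast
    then show ?thesis by simp
  qed
  fix R t assume R: "R \<in> \<sigma>" and t: "t \<in> tuples {..<m + 2} (ar R)"
  have h_eq: "?h x = n \<longleftrightarrow> m \<le> x" "?h x < n \<longleftrightarrow> x < m" for x using hn[of x] by auto
  consider (label) "R = U"
    | (left) "R = E" "m \<le> t ! 0" "t ! 1 < m"
    | (right) "R = E" "t ! 0 < m" "m \<le> t ! 1"
    | (old) "R \<noteq> U" "\<forall>x\<in>set t. x < m"
    | (new) "R \<noteq> U" "\<not> (\<forall>x\<in>set t. x < m)" "R = E \<longrightarrow> (m \<le> t ! 0 \<longleftrightarrow> m \<le> t ! 1)"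
    by (metis not_le)
  then show "forget_stars m u R t \<le> pin n v R (map ?h t)"
  proof cases
    case label
    then obtain x where "t = [x]" "x < m + 2"
      using t U(2) by (auto simp: tuples_def length_Suc_conv)
    then show ?thesis using label hn[of x] by (auto simp: forget_stars_def pin_U)
  next
    case left
    have len: "length t = ar E" using t left(1) by (simp add: tuples_def)
    have "map ?h t ! 0 = n" "map ?h t ! 1 = h (t ! 1)"
      using len E left by auto
    from pin_E_left[OF _ this] have "pin n v R (map ?h t) = v U [h (t ! 1)]"
      using hn[OF left(3)] left(1) by simp
    then show ?thesis using left hU[OF left(3)] by (auto simp: forget_stars_def)
  next
    case right
    have len: "length t = ar E" using t right(1) by (simp add: tuples_def)
    have "map ?h t ! 0 = h (t ! 0)" "map ?h t ! 1 = n"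
      using len E right by auto
    from pin_E_right[OF _ this] have "pin n v R (map ?h t) = flip (v U [h (t ! 0)])"
      using hn[OF right(2)] right(1) by simp
    then show ?thesis using right hU[OF right(2)] flip_le_iff[of "flip (u U [t ! 0])"]
      by (cases "u U [t ! 0]"; cases "v U [h (t ! 0)]") (auto simp: forget_stars_def less_eq_label_def)
  next
    case old
    then have t': "t \<in> tuples {..<m} (ar R)" using t by (auto simp: tuples_def)
    have m: "map ?h t = map h t" using old(2) by simp
    have "map h t \<in> tuples {..<n} (ar R)" using t' hn by (rule map_in_tuples)
    then show ?thesis
      unfolding m using forget_stars_old[OF R old(1) t'] pin_old[OF R old(1)] hm R t' by (simp add: hom_def)
  next
    case new
    have "pin n v R (map ?h t) = Star"
    proof (rule pin_new[OF new(1)])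
      show "R = E \<longrightarrow> (map ?h t ! 0 = n \<longleftrightarrow> map ?h t ! 1 = n)"
      proof
        assume "R = E"
        then have "0 < length t" "1 < length t" using t E by (auto simp: tuples_def)
        then show "map ?h t ! 0 = n \<longleftrightarrow> map ?h t ! 1 = n"
          using new(3) \<open>R = E\<close> by (simp add: h_eq del: One_nat_def)
      qed
      show "\<not> (\<forall>x\<in>set (map ?h t). x < n)" using new(2) h_eq(2) by auto
    qed
    then show ?thesis by simp
  qed
qed

text \<open>The labels in \<open>U\<close> force the two new elements onto \<open>n\<close> and keep
  all old ones off it. The \<open>E\<close>-tuples through the new elements then exclude
  \<open>n + 1\<close> as an image and enforce the old label in \<open>U\<close>.\<close>

lemma hom_of_forget_stars:
  assumes hm: "hom (m + 2) (forget_stars m u) (n + 2) (pin n v) h"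
  shows "hom m u n v h"
proof -
  have le: "forget_stars m u R t \<le> pin n v R (map h t)" if "R \<in> \<sigma>" "t \<in> tuples {..<m + 2} (ar R)" for R t
    using hm that by (simp add: hom_def)
  have hU: "forget_stars m u U [x] \<le> pin n v U [h x]" if "x < m + 2" for x
    using le[OF U(1), of "[x]"] that U(2) by (simp add: tuples_def)
  have new: "h x = n" if "x = m \<or> x = m + 1" for x
    using hU[of x] that by (auto simp: forget_stars_def pin_U split: if_splits)
  have not_n: "h x \<noteq> n" if "x < m" for x
    using hU[of x] that by (auto simp: forget_stars_def pin_U split: if_splits)
  let ?l = "\<lambda>x. if h x < n then v U [h x] else Zero"
  let ?l' = "\<lambda>x. if h x < n then flip (v U [h x]) else Zero"
  obtain k where k: "ar E = Suc (Suc k)" using E(2) by (metis add_2_eq_Suc le_Suc_ex)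
  \<comment> \<open>Only the first two entries determine the stored label, so the tuple may be
    padded with \<open>x\<close> up to the arity of \<open>E\<close>.\<close>
  have left: "forget_stars m u E (p # x # replicate k x) \<le> ?l x" if "x < m" "p = m \<or> p = m + 1" for x p
  proof -
    have "p # x # replicate k x \<in> tuples {..<m + 2} (ar E)"
      using that k by (auto simp: tuples_def)
    from le[OF E(1) this] show ?thesis
      using new[OF that(2)] not_n[OF that(1)] pin_E_left[of "h x" n "map h (p # x # replicate k x)" v] by simp
  qed
  have right: "forget_stars m u E (x # p # replicate k x) \<le> ?l' x" if "x < m" "p = m \<or> p = m + 1" for x p
  proof -
    have "x # p # replicate k x \<in> tuples {..<m + 2} (ar E)"
      using that k by (auto simp: tuples_def)
    from le[OF E(1) this] show ?thesis
      using new[OF that(2)] not_n[OF that(1)] pin_E_right[of "h x" n "map h (x # p # replicate k x)" v] by simp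
  qed
  \<comment> \<open>The element \<open>n + 1\<close> offers \<open>Zero\<close> on both sides. The
    label \<open>One\<close> is refused there by the left tuple, and \<open>Zero\<close> by the
    right one, where it appears as \<open>One\<close>. A star uses the left tuples through both new
    elements.\<close>
  have main: "h x < n \<and> u U [x] \<le> v U [h x]" if x: "x < m" for x
  proof (cases "u U [x]")
    case Zero
    then show ?thesis using right[OF x, of m] left[OF x, of m] x
      by (auto simp: forget_stars_def split: if_splits)
  next
    case One
    then show ?thesis using left[OF x, of m] x
      by (auto simp: forget_stars_def split: if_splits)
  next
    case Star
    then have "Zero \<le> ?l x" "One \<le> ?l x" using left[OF x, of m] left[OF x, of "m + 1"] x
      by (auto simp: forget_stars_def split: if_splits)
    then have "?l x = Star" by (rule label_both)
    then show ?thesis by (auto split: if_splits)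
  qed
  show "hom m u n v h"
    unfolding hom_def
  proof (intro conjI ballI allI impI)
    fix R t assume R: "R \<in> \<sigma>" and t: "t \<in> tuples {..<m} (ar R)"
    have t': "t \<in> tuples {..<m + 2} (ar R)" using t by (auto simp: tuples_def)
    have ht: "map h t \<in> tuples {..<n} (ar R)" using t by (rule map_in_tuples) (use main in blast)
    show "u R t \<le> v R (map h t)"
    proof (cases "R = U")
      case True
      then obtain x where "t = [x]" "x < m" using t U(2) by (auto simp: tuples_def length_Suc_conv)
      then show ?thesis using main True by simp
    next
      case False
      then show ?thesis using le[OF R t'] forget_stars_old[OF R False t] pin_old[OF R False ht] by simp
    qed
  qed (use main in blast)
qed

lemma def_label_lab_single: "definable a \<Longrightarrow> def_label (\<lambda>w e. lab w R [a w e])"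
  using def_label_tuple[where L = "\<lambda>w t. lab w R t" and k = 1 and \<tau> = "\<lambda>w e. [a w e]", OF def_label_lab]
  by (simp add: def_tuple_def)

lemma def_label_flip: "def_label L \<Longrightarrow> def_label (\<lambda>w e. flip (L w e))"
  unfolding flip_def by (intro def_label_if def_label_eq def_label_const)

lemma ar_E_nth [simp]: "map e [0..<ar E] ! 0 = e 0" "map e [0..<ar E] ! Suc 0 = e 1"
  using E by auto

lemma lang_reduces_pin:
  assumes "E \<in> S"
  shows "def_reduces (lang (insert U S) n v) (lang S (n + 2) (pin n v))"
proof (rule def_reduces_langI[where N = "\<lambda>m u. m + 2" and V = forget_stars and C = "\<lambda>m u. True"])
  show "definable (\<lambda>w e. size_of w + 2)" by (intro definable_add definable_size definable_const)
  show "decidable (\<lambda>w e. True)" by (rule decidable_const)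
  fix R assume "R \<in> \<sigma>"
  have vars: "map e [0..<ar U] = [e 0]" for e :: "nat \<Rightarrow> nat" using U by simp
  have all: "(\<forall>x\<in>set (map e [0..<ar R]). x < size_of w) \<longleftrightarrow> (\<forall>i\<in>{0..<ar R}. e i < size_of w)"
    for w and e :: "nat \<Rightarrow> nat" by simp
  note intros = def_label_if def_label_const decidable_conj decidable_disj decidable_eq decidable_le decidable_less
    definable_var definable_size definable_add definable_const def_label_lab_single def_label_flip def_label_lab
    def_label_eq decidable_finite_ball finite_atLeastLessThan
  show "def_label (\<lambda>w e. forget_stars (size_of w) (lab w) R (map e [0..<ar R]))"
  proof (cases "R = U")
    case True
    show ?thesis unfolding True forget_stars_def vars list.inject
      by (simp only: if_True simp_thms) (intro intros)
  next
    case False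
    show ?thesis
    proof (cases "R = E")
      case True
      show ?thesis unfolding True forget_stars_def all[unfolded True] One_nat_def ar_E_nth
        by (simp only: if_False simp_thms E_neq_U) (intro intros)
    next
      case F: False
      show ?thesis unfolding forget_stars_def all
        using False F by (simp only: if_False simp_thms) (intro intros)
    qed
  qed
next
  fix m u assume "star_free (insert U S) m u"
  then show "star_free S (m + 2) (forget_stars m u)" using assms by (rule star_free_forget_stars)
  show "maps_to (m + 2) (forget_stars m u) (n + 2) (pin n v) \<longleftrightarrow> maps_to m u n v"
    unfolding maps_to_def using hom_forget_stars hom_of_forget_stars by blast
qed simp

section \<open>Translating arbitrary inputs over the pinned target back\<close>

definition pinned :: "('r \<Rightarrow> nat list \<Rightarrow> label) \<Rightarrow> nat \<Rightarrow> bool" where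
  "pinned u y \<longleftrightarrow> u U [y] = One"

text \<open>If \<open>y\<close> goes to an old element, \<open>l\<close> is a lower bound that some
  \<open>E\<close>-tuple through a pinned element imposes on the label of that image in
  \<open>U\<close>; the flip undoes the negation in the second kind of tuple.\<close>

definition constrained :: "nat \<Rightarrow> ('r \<Rightarrow> nat list \<Rightarrow> label) \<Rightarrow> label \<Rightarrow> nat \<Rightarrow> bool" where
  "constrained m u l y \<longleftrightarrow> (\<exists>t\<in>tuples {..<m} (ar E).
     pinned u (t ! 0) \<and> t ! 1 = y \<and> u E t = l \<or> t ! 0 = y \<and> pinned u (t ! 1) \<and> flip (u E t) = l)"

text \<open>The absorbing element offers \<open>Zero\<close> in both storing positions. An unpinned
  element is thus kept away from it exactly by a storing tuple with another label; all other
  unpinned elements can be absorbed.\<close>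

definition retained :: "nat \<Rightarrow> ('r \<Rightarrow> nat list \<Rightarrow> label) \<Rightarrow> nat \<Rightarrow> bool" where
  "retained m u y \<longleftrightarrow> \<not> pinned u y \<and> (\<exists>t\<in>tuples {..<m} (ar E).
     (pinned u (t ! 0) \<and> t ! 1 = y \<or> t ! 0 = y \<and> pinned u (t ! 1)) \<and> u E t \<noteq> Zero)"

text \<open>The least upper bound of all constraints on \<open>y\<close>. For an unconstrained
  \<open>y\<close> the value \<open>Zero\<close> is arbitrary.\<close>

definition join_label :: "nat \<Rightarrow> ('r \<Rightarrow> nat list \<Rightarrow> label) \<Rightarrow> nat \<Rightarrow> label" where
  "join_label m u y =
     (if \<not> constrained m u Star y \<and> \<not> constrained m u One y then Zero
      else if \<not> constrained m u Star y \<and> \<not> constrained m u Zero y then One else Star)"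

text \<open>Elements that are not retained are not deleted, which would require renumbering the others, but
  turned into clones of the first retained one.\<close>

definition representative :: "nat \<Rightarrow> ('r \<Rightarrow> nat list \<Rightarrow> label) \<Rightarrow> nat \<Rightarrow> nat" where
  "representative m u y =
     (if retained m u y then y else \<Sum>i<m. of_bool (\<forall>j<Suc i. \<not> retained m u j))"

text \<open>Pinned elements are not retained, so they become clones as well. What their
  \<open>E\<close>-tuples demanded survives in the joined labels of \<open>U\<close>.\<close>

definition unpin :: "nat \<Rightarrow> ('r \<Rightarrow> nat list \<Rightarrow> label) \<Rightarrow> 'r \<Rightarrow> nat list \<Rightarrow> label" where
  "unpin m u R t =
     (if R = U then join_label m u (representative m u (hd t))
      else u R (map (representative m u) t))"

text \<open>The sum counts the indices before the first retained element: it is \<open>LEAST\<close>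
  in a definable form.\<close>

lemma representative:
  assumes "\<exists>y<m. retained m u y" "x < m"
  shows "representative m u x < m" "retained m u (representative m u x)"
proof -
  let ?y = "LEAST y. retained m u y"
  obtain y where y: "y < m" "retained m u y" using assms(1) by blast
  have r: "retained m u ?y" using y(2) by (rule LeastI)
  have "?y \<le> y" using y(2) by (rule Least_le)
  then have less: "?y < m" using y(1) by simp
  have "(\<forall>j<Suc i. \<not> retained m u j) \<longleftrightarrow> i < ?y" for i
    using r not_less_Least[of _ "retained m u"] by (metis le_less_linear less_Suc_eq_le order.strict_trans1)
  then have "(\<Sum>i<m. of_bool (\<forall>j<Suc i. \<not> retained m u j)) = (\<Sum>i<m. of_bool (i < ?y) :: nat)" by simp
  also have "\<dots> = card ({..<m} \<inter> {i. i < ?y})"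
    by (simp only: of_bool_def sum.If_cases[OF finite_lessThan]) simp
  also have "{..<m} \<inter> {i. i < ?y} = {..<?y}" using less by auto
  finally have "(\<Sum>i<m. of_bool (\<forall>j<Suc i. \<not> retained m u j)) = ?y" by simp
  then show "representative m u x < m" "retained m u (representative m u x)"
    using r less assms(2) by (simp_all add: representative_def)
qed

lemma retained_constrained:
  assumes "retained m u y"
  shows "\<exists>l. constrained m u l y"
  using assms unfolding retained_def constrained_def by blast

text \<open>At least one constraint is required, because the order on labels has no least element to
  serve as an empty join.\<close>

lemma join_label_le_iff:
  assumes "constrained m u l0 y"
  shows "join_label m u y \<le> l' \<longleftrightarrow> (\<forall>l. constrained m u l y \<longrightarrow> l \<le> l')"
proof -
  have all: "(\<forall>l. P l) \<longleftrightarrow> P Zero \<and> P One \<and> P Star" for P by (metis label.exhaust)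
  show ?thesis
    using assms unfolding join_label_def all by (cases l0; cases l') (auto simp: less_eq_label_def)
qed

lemma hom_unpin:
  assumes hm: "hom m u (n + 2) (pin n v) h" and sf: "star_free S m u" and US: "U \<notin> S"
    and ex: "\<exists>y<m. retained m u y"
  shows "hom m (unpin m u) n v (\<lambda>x. h (representative m u x))"
proof -
  let ?r = "representative m u"
  have le: "u R t \<le> pin n v R (map h t)" if "R \<in> \<sigma>" "t \<in> tuples {..<m} (ar R)" for R t
    using hm that by (simp add: hom_def)
  have hU: "u U [x] \<le> pin n v U [h x]" "u U [x] \<noteq> Star" if "x < m" for x
    using le[OF U(1), of "[x]"] sf US U that by (auto simp: tuples_def star_free_def)
  \<comment> \<open>Since \<open>U\<close> carries no stars in the input, every label in
    \<open>U\<close> is 0 or 1 and decides whether the image is \<open>n\<close>.\<close>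
  have hn: "pinned u x \<longleftrightarrow> h x = n" if "x < m" for x
    using hU[OF that] unfolding pinned_def pin_U by (cases "u U [x]") (auto split: if_splits)
  have E01: "t ! 0 < m" "t ! 1 < m" "map h t ! 0 = h (t ! 0)" "map h t ! 1 = h (t ! 1)"
    if "t \<in> tuples {..<m} (ar E)" for t
    using that E tuplesD[OF that] by auto
  \<comment> \<open>The first claim is vacuous unless the image is an old element; the second shows
    that a retained element does have an old image.\<close>
  have con: "l \<le> (if h y < n then v U [h y] else l)" "\<not> h y < n \<Longrightarrow> \<not> retained m u y"
    if y: "y < m" "\<not> pinned u y" and c: "constrained m u l y" for l y
  proof -
    have y': "h y \<noteq> n" using hn y by simp
    show "\<not> retained m u y" if "\<not> h y < n"
    proof
      assume "retained m u y"
      then obtain t where t: "t \<in> tuples {..<m} (ar E)" "u E t \<noteq> Zero"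
        "pinned u (t ! 0) \<and> t ! 1 = y \<or> t ! 0 = y \<and> pinned u (t ! 1)"
        unfolding retained_def by blast
      have "pin n v E (map h t) = Zero"
        using t(3) pin_E_left[OF y', of "map h t" v] pin_E_right[OF y', of "map h t" v] that
          E01[OF t(1)] hn by auto
      then show False using le[OF E(1) t(1)] t(2) by simp
    qed
    show "l \<le> (if h y < n then v U [h y] else l)"
    proof (cases "h y < n")
      case True
      obtain t where t: "t \<in> tuples {..<m} (ar E)"
        "pinned u (t ! 0) \<and> t ! 1 = y \<and> u E t = l \<or> t ! 0 = y \<and> pinned u (t ! 1) \<and> flip (u E t) = l"
        using c unfolding constrained_def by blast
      then have "l \<le> v U [h y]"
        using pin_E_left[OF y', of "map h t" v] pin_E_right[OF y', of "map h t" v] True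
          E01[OF t(1)] hn le[OF E(1) t(1)] flip_le_iff by auto
      then show ?thesis using True by simp
    qed simp
  qed
  have ret: "h z < n \<and> join_label m u z \<le> v U [h z]" if z: "z < m" "retained m u z" for z
  proof -
    have np: "\<not> pinned u z" using z(2) by (simp add: retained_def)
    obtain l0 where l0: "constrained m u l0 z" using retained_constrained[OF z(2)] by blast
    have "h z < n" using con(2)[OF z(1) np l0] z(2) by blast
    then show ?thesis
      using con(1)[OF z(1) np] unfolding join_label_le_iff[OF l0] by auto
  qed
  show ?thesis
    unfolding hom_def
  proof (intro conjI ballI allI impI)
    show "h (?r x) < n" if "x < m" for x
      using ret representative[OF ex that] by blast
    fix R t assume R: "R \<in> \<sigma>" and t: "t \<in> tuples {..<m} (ar R)"
    show "unpin m u R t \<le> v R (map (\<lambda>x. h (?r x)) t)"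
    proof (cases "R = U")
      case True
      then obtain x where "t = [x]" "x < m" using t U(2) by (auto simp: tuples_def length_Suc_conv)
      then show ?thesis using True ret representative[OF ex] by (simp add: unpin_def)
    next
      case False
      have t': "map ?r t \<in> tuples {..<m} (ar R)" using t by (rule map_in_tuples) (rule representative[OF ex])
      have "map h (map ?r t) \<in> tuples {..<n} (ar R)"
        unfolding map_map using t by (rule map_in_tuples) (use ret representative[OF ex] in auto)
      from pin_old[OF R False this] le[OF R t'] show ?thesis
        using False by (simp add: unpin_def comp_def)
    qed
  qed
qed

text \<open>\<open>g\<close> is assumed to be a homomorphism only if something is retained.
  Otherwise every element goes to one of the two new elements, and only the nullary symbols, covered
  by a separate hypothesis, still refer to \<open>v\<close>.\<close>

lemma hom_of_unpin:
  assumes hm: "\<exists>y<m. retained m u y \<Longrightarrow> hom m (unpin m u) n v g"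
    and nul: "\<And>R. R \<in> \<sigma> \<Longrightarrow> ar R = 0 \<Longrightarrow> u R [] \<le> v R []"
    and sf: "star_free S m u" and US: "U \<notin> S"
  shows "hom m u (n + 2) (pin n v) (\<lambda>y. if pinned u y then n else if retained m u y then g y else n + 1)"
    (is "hom _ _ _ _ ?h")
proof -
  have gn: "g y < n" if "y < m" "retained m u y" for y
    using hm that unfolding hom_def by blast
  have gU: "join_label m u y \<le> v U [g y]" if y: "y < m" "retained m u y" for y
  proof -
    have "hom m (unpin m u) n v g" using hm y by blast
    moreover have "[y] \<in> tuples {..<m} (ar U)" using y U by (simp add: tuples_def)
    ultimately have "unpin m u U [y] \<le> v U (map g [y])" using U(1) unfolding hom_def by blast
    then show ?thesis using y by (simp add: unpin_def representative_def)
  qed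
  have h_n: "?h y = n \<longleftrightarrow> pinned u y" "?h y < n \<longleftrightarrow> \<not> pinned u y \<and> retained m u y" if "y < m" for y
    using gn[OF that] by auto
  show ?thesis
    unfolding hom_def
  proof (intro conjI ballI allI impI)
    show "?h y < n + 2" if "y < m" for y using gn[OF that] by auto
    fix R t assume R: "R \<in> \<sigma>" and t: "t \<in> tuples {..<m} (ar R)"
    consider (label) "R = U"
      | (left) "R = E" "pinned u (t ! 0)" "\<not> pinned u (t ! 1)"
      | (right) "R = E" "\<not> pinned u (t ! 0)" "pinned u (t ! 1)"
      | (old) "R \<noteq> U" "\<forall>x\<in>set t. \<not> pinned u x \<and> retained m u x"
      | (new) "R \<noteq> U" "\<not> (\<forall>x\<in>set t. \<not> pinned u x \<and> retained m u x)" "R = E \<longrightarrow> (pinned u (t ! 0) \<longleftrightarrow> pinned u (t ! 1))"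
      by blast
    then show "u R t \<le> pin n v R (map ?h t)"
    proof cases
      case label
      then obtain x where x: "t = [x]" "x < m" using t U(2) by (auto simp: tuples_def length_Suc_conv)
      have "u U [x] \<noteq> Star" using sf US t label R x unfolding star_free_def by blast
      then show ?thesis
        using label x h_n(1)[OF x(2)] by (cases "u U [x]") (auto simp: pin_U pinned_def)
    next
      case left
      have t2: "t \<in> tuples {..<m} (ar E)" using t left(1) by simp
      have y: "t ! 0 < m" "t ! 1 < m" "length t = ar E" using tuplesD[OF t2] E by auto
      have m01: "map ?h t ! 0 = n" "map ?h t ! 1 = ?h (t ! 1)" using y E left by auto
      have p: "pin n v R (map ?h t) = (if ?h (t ! 1) < n then v U [?h (t ! 1)] else Zero)"
        using pin_E_left[OF _ m01] h_n(1)[OF y(2)] left by simp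
      show ?thesis
      proof (cases "retained m u (t ! 1)")
        case True
        have c: "constrained m u (u E t) (t ! 1)" unfolding constrained_def using t2 left by blast
        show ?thesis
          using gU[OF y(2) True] join_label_le_iff[OF c] c left h_n[OF y(2)] True unfolding p by simp
      next
        case False
        then have "u E t = Zero" using left t2 unfolding retained_def by blast
        moreover have "pin n v R (map ?h t) = Zero" using p h_n(2)[OF y(2)] False by simp
        ultimately show ?thesis using left(1) by simp
      qed
    next
      case right
      have t2: "t \<in> tuples {..<m} (ar E)" using t right(1) by simp
      have y: "t ! 0 < m" "t ! 1 < m" "length t = ar E" using tuplesD[OF t2] E by auto
      have m01: "map ?h t ! 0 = ?h (t ! 0)" "map ?h t ! 1 = n" using y E right by auto
      have p: "pin n v R (map ?h t) = (if ?h (t ! 0) < n then flip (v U [?h (t ! 0)]) else Zero)"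
        using pin_E_right[OF _ m01] h_n(1)[OF y(1)] right by simp
      show ?thesis
      proof (cases "retained m u (t ! 0)")
        case True
        have c: "constrained m u (flip (u E t)) (t ! 0)" unfolding constrained_def using t2 right by blast
        show ?thesis
          using gU[OF y(1) True] join_label_le_iff[OF c] c right h_n[OF y(1)] True
            flip_le_iff[of "u E t" "v U [g (t ! 0)]"] unfolding p by simp
      next
        case False
        then have "u E t = Zero" using right t2 unfolding retained_def by blast
        moreover have "pin n v R (map ?h t) = Zero" using p h_n(2)[OF y(1)] False by simp
        ultimately show ?thesis using right(1) by simp
      qed
    next
      case old
      have m: "map ?h t = map g t" using old(2) by simp
      have gt: "map g t \<in> tuples {..<n} (ar R)"
        using t gn old(2) by (auto simp: tuples_def)
      show ?thesis
      proof (cases "t = []")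
        case True
        then have "ar R = 0" using t by (simp add: tuples_def)
        then show ?thesis unfolding m using pin_old[OF R old(1) gt, of v] nul[OF R] True by simp
      next
        case False
        then obtain x where "x \<in> set t" by (cases t) auto
        then have "\<exists>y<m. retained m u y" using old(2) t by (auto simp: tuples_def)
        then have "unpin m u R t \<le> v R (map g t)" using hm R t unfolding hom_def by blast
        moreover have "map (representative m u) t = t"
          using old(2) by (intro map_idI) (simp add: representative_def)
        ultimately show ?thesis
          unfolding m using pin_old[OF R old(1) gt, of v] old(1) by (simp add: unpin_def)
      qed
    next
      case new
      have "pin n v R (map ?h t) = Star"
      proof (rule pin_new[OF new(1)])
        show "R = E \<longrightarrow> (map ?h t ! 0 = n \<longleftrightarrow> map ?h t ! 1 = n)"
        proof
          assume RE: "R = E"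
          then have t2: "t \<in> tuples {..<m} (ar E)" using t by simp
          have y: "t ! 0 < m" "t ! 1 < m" "length t = ar E" using tuplesD[OF t2] E by auto
          have "map ?h t ! 0 = ?h (t ! 0)" "map ?h t ! 1 = ?h (t ! 1)" using y E by auto
          then show "map ?h t ! 0 = n \<longleftrightarrow> map ?h t ! 1 = n"
            using h_n(1)[OF y(1)] h_n(1)[OF y(2)] new(3) RE by simp
        qed
        obtain x where x: "x \<in> set t" "\<not> (\<not> pinned u x \<and> retained m u x)" using new(2) by blast
        then have "x < m" using t by (auto simp: tuples_def)
        from h_n(2)[OF this] x(2) have "\<not> ?h x < n" by blast
        moreover have "?h x \<in> set (map ?h t)" using x(1) unfolding set_map by (rule imageI)
        ultimately show "\<not> (\<forall>x\<in>set (map ?h t). x < n)" by blast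
      qed
      then show ?thesis by simp
    qed
  qed
qed

lemma hom_nullary:
  assumes "hom m u n v h" "R \<in> \<sigma>" "ar R = 0"
  shows "u R [] \<le> v R []"
proof -
  have "[] \<in> tuples {..<m} (ar R)" using assms(3) by (simp add: tuples_def)
  then have "u R [] \<le> v R (map h [])" using assms(1,2) unfolding hom_def by blast
  then show ?thesis by simp
qed

text \<open>If nothing is retained there is no element to clone, and the translated input becomes
  the empty structure, in which only the nullary labels survive.\<close>

lemma maps_to_unpin:
  assumes sf: "star_free S m u" and US: "U \<notin> S"
  shows "maps_to (if \<exists>y<m. retained m u y then m else 0) (unpin m u) n v \<longleftrightarrow> maps_to m u (n + 2) (pin n v)"
    (is "maps_to ?m _ _ _ \<longleftrightarrow> _")
proof
  have U0: "R \<noteq> U" if "ar R = 0" for R using U that by auto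
  {
    assume "maps_to ?m (unpin m u) n v"
    then obtain g where g: "hom ?m (unpin m u) n v g"
      unfolding maps_to_def ..
    have nul: "u R [] \<le> v R []" if "R \<in> \<sigma>" "ar R = 0" for R
      using hom_nullary[OF g that] U0[OF that(2)] by (simp add: unpin_def)
    have "hom m (unpin m u) n v g" if "\<exists>y<m. retained m u y"
      using g unfolding if_P[OF that] .
    then have "hom m u (n + 2) (pin n v) (\<lambda>y. if pinned u y then n else if retained m u y then g y else n + 1)"
      using nul sf US by (rule hom_of_unpin)
    then show "maps_to m u (n + 2) (pin n v)"
      unfolding maps_to_def by (rule exI[where P = "hom m u (n + 2) (pin n v)"])
  }
  {
    assume "maps_to m u (n + 2) (pin n v)"
    then obtain h where h: "hom m u (n + 2) (pin n v) h" unfolding maps_to_def ..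
    show "maps_to ?m (unpin m u) n v"
    proof (cases "\<exists>y<m. retained m u y")
      case True
      show ?thesis
        unfolding if_P[OF True] maps_to_def by (rule exI[where P = "hom m (unpin m u) n v"]) (rule hom_unpin[OF h sf US True])
    next
      case False
      have "hom 0 (unpin m u) n v id"
        unfolding hom_def
      proof (intro conjI ballI allI impI)
        fix R t assume R: "R \<in> \<sigma>" and "t \<in> tuples {..<0::nat} (ar R)"
        then have t: "t = []" "ar R = 0" by (auto simp: tuples_def)
        have "[] \<in> tuples {..<n} (ar R)" using t by (simp add: tuples_def)
        from hom_nullary[OF h R t(2)] pin_old[OF R U0[OF t(2)] this] have "u R [] \<le> v R []" by simp
        then show "unpin m u R t \<le> v R (map id t)"
          using U0[OF t(2)] t(1) by (simp add: unpin_def)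
      qed simp
      then show ?thesis unfolding if_not_P[OF False] maps_to_def by (rule exI[where P = "hom 0 (unpin m u) n v"])
    qed
  }
qed

section \<open>Definability of the back translation and of the pinned target\<close>

lemma decidable_pinned: "definable a \<Longrightarrow> decidable (\<lambda>w e. pinned (lab w) (a w e))"
  unfolding pinned_def by (intro def_label_eq def_label_lab_single)

lemma decidable_constrained:
  "definable a \<Longrightarrow> decidable (\<lambda>w e. constrained (size_of w) (lab w) l (a w e))"
  unfolding constrained_def One_nat_def
  by (rule decidable_ex_tuples[where P = "\<lambda>w y t. pinned (lab w) (t ! 0) \<and> t ! Suc 0 = y \<and> lab w E t = l
        \<or> t ! 0 = y \<and> pinned (lab w) (t ! Suc 0) \<and> flip (lab w E t) = l", OF _ definable_size], unfold ar_E_nth)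
    (intro decidable_disj decidable_conj decidable_pinned decidable_eq definable_var def_label_eq def_label_flip def_label_lab)

lemma decidable_retained:
  "definable a \<Longrightarrow> decidable (\<lambda>w e. retained (size_of w) (lab w) (a w e))"
  unfolding retained_def One_nat_def
  by (rule decidable_conj, intro decidable_not decidable_pinned, assumption,
      rule decidable_ex_tuples[where P = "\<lambda>w y t. (pinned (lab w) (t ! 0) \<and> t ! Suc 0 = y
        \<or> t ! 0 = y \<and> pinned (lab w) (t ! Suc 0)) \<and> lab w E t \<noteq> Zero", OF _ definable_size], unfold ar_E_nth)
    (intro decidable_not decidable_disj decidable_conj decidable_pinned decidable_eq definable_var def_label_eq def_label_lab)

lemma definable_representative:
  assumes "definable a"
  shows "definable (\<lambda>w e. representative (size_of w) (lab w) (a w e))"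
  unfolding representative_def
proof (rule definable_if[OF decidable_retained[OF assms] assms])
  have "decidable (\<lambda>w e. \<forall>j<Suc (e 0). \<not> retained (size_of w) (lab w) j)"
    by (intro decidable_all definable_Suc definable_var decidable_not decidable_retained)
  then show "definable (\<lambda>w e. \<Sum>i<size_of w. of_bool (\<forall>j<Suc i. \<not> retained (size_of w) (lab w) j))"
    unfolding decidable_def by (intro definable_Sum definable_size)
qed

text \<open>Contradictory demands on one element join to \<open>Star\<close>. This is allowed
  because \<open>U\<close> belongs to the symbols that may carry stars in the new input.\<close>

lemma pin_reduces_lang:
  assumes US: "U \<notin> S"
  shows "def_reduces (lang S (n + 2) (pin n v)) (lang (insert U S) n v)"
proof (rule def_reduces_langI[where N = "\<lambda>m u. if \<exists>y<m. retained m u y then m else 0"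
      and V = unpin and C = "\<lambda>m u. True"])
  show "definable (\<lambda>w e. if \<exists>y<size_of w. retained (size_of w) (lab w) y then size_of w else 0)"
    by (intro definable_if decidable_ex decidable_retained definable_var definable_size definable_const)
  show "decidable (\<lambda>w e. True)" by (rule decidable_const)
  fix R assume "R \<in> \<sigma>"
  show "def_label (\<lambda>w e. unpin (size_of w) (lab w) R (map e [0..<ar R]))"
  proof (cases "R = U")
    case True
    have "hd (map e [0..<ar U]) = e 0" for e :: "nat \<Rightarrow> nat" using U by simp
    then show ?thesis
      unfolding True unpin_def join_label_def
      by (simp only: if_True simp_thms) (intro def_label_if def_label_const decidable_conj decidable_not
          decidable_constrained definable_representative definable_var)
  next
    case False
    have "def_label (\<lambda>w e. lab w R (map (representative (size_of w) (lab w)) (map e [0..<ar R])))"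
      by (rule def_label_tuple[OF def_label_lab def_tuple_map[OF def_tuple_vars]])
        (rule definable_representative[OF definable_var])
    then show ?thesis unfolding unpin_def using False by simp
  qed
next
  fix m u assume sf: "star_free S m u"
  show "star_free (insert U S) (if \<exists>y<m. retained m u y then m else 0) (unpin m u)"
    unfolding star_free_def
  proof (intro ballI)
    fix R t assume R: "R \<in> \<sigma> - insert U S"
      and t: "t \<in> tuples {..<if \<exists>y<m. retained m u y then m else 0} (ar R)"
    have "map (representative m u) t \<in> tuples {..<m} (ar R)"
    proof (cases "\<exists>y<m. retained m u y")
      case True
      then have "t \<in> tuples {..<m} (ar R)" using t by simp
      then show ?thesis by (rule map_in_tuples) (rule representative[OF True])
    next
      case False
      from t have "t \<in> tuples {..<0} (ar R)" unfolding if_not_P[OF False] .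
      then show ?thesis by (auto simp: tuples_def)
    qed
    then show "unpin m u R t \<noteq> Star" using R sf by (auto simp: unpin_def star_free_def)
  qed
  show "maps_to (if \<exists>y<m. retained m u y then m else 0) (unpin m u) n v \<longleftrightarrow> maps_to m u (n + 2) (pin n v)"
    by (rule maps_to_unpin[OF sf US])
qed simp

lemma target_pin: "target (n + 2) (pin n v)"
proof -
  have "pin n v U (replicate (ar U) x) \<noteq> Star" for x by (simp add: pin_U)
  then show ?thesis using U(1) unfolding target_def by blast
qed

lemma def_label_pin:
  "def_label (\<lambda>w e. pin (size_of w) (lab w) R (map e [0..<ar R]))"
proof (cases "R = U")
  case True
  have vars: "map e [0..<ar U] = [e 0]" for e :: "nat \<Rightarrow> nat" using U by simp
  show ?thesis
    unfolding True pin_U vars list.inject simp_thms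
    by (intro def_label_if def_label_const decidable_eq definable_var definable_size)
next
  case False
  have all: "(\<forall>x\<in>set (map e [0..<ar R]). x < size_of w) \<longleftrightarrow> (\<forall>i\<in>{0..<ar R}. e i < size_of w)"
    for w and e :: "nat \<Rightarrow> nat" by simp
  note intros = def_label_if def_label_const decidable_conj decidable_not decidable_eq decidable_less
    definable_var definable_size def_label_lab_single def_label_flip def_label_lab
    decidable_finite_ball finite_atLeastLessThan
  show ?thesis
  proof (cases "R = E")
    case True
    show ?thesis unfolding True pin_def all[unfolded True] One_nat_def ar_E_nth
      by (simp only: if_False simp_thms E_neq_U) (intro intros)
  next
    case F: False
    show ?thesis unfolding pin_def all
      using False F by (simp only: if_False simp_thms) (intro intros)
  qed
qed

end

section \<open>Equivalence of the families\<close>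

context signature
begin

lemma def_label_split_stars:
  assumes U: "ar U = 1"
  shows "def_label (\<lambda>w e. split_stars U (lab w) R (map e [0..<ar R]))"
proof -
  have l: "def_label (\<lambda>w e. lab w R (map (\<lambda>x. x div 2) (map e [0..<ar R])))"
    by (rule def_label_tuple[OF def_label_lab def_tuple_map[OF def_tuple_vars]])
      (intro definable_div_const definable_var)
  show ?thesis
  proof (cases "R = U")
    case True
    have vars: "hd (map e [0..<ar U]) = e 0" for e :: "nat \<Rightarrow> nat" using U by simp
    show ?thesis
      using l unfolding True split_stars_def vars
      by (intro def_label_if def_label_const decidable_conj decidable_const decidable_eq def_label_eq
          definable_mod_const definable_var definable_const)
  next
    case False
    then show ?thesis using l unfolding split_stars_def by simp
  qed
qed

text \<open>\<open>F\<close> works on encodings of targets and is chosen before the target.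
  Splitting at one symbol pulls the labels of the others back along \<open>div 2\<close>, so symbols
  already free of stars remain so.\<close>

lemma split_all_stars:
  assumes "finite T" "T \<subseteq> {R \<in> \<sigma>. ar R = 1}"
  shows "\<exists>F. def_string (\<lambda>w e. F w) \<and>
    (\<forall>w. valid w \<longrightarrow> target (size_of w) (lab w) \<longrightarrow>
      valid (F w) \<and> target (size_of (F w)) (lab (F w)) \<and>
      lang {} (size_of (F w)) (lab (F w)) = lang {} (size_of w) (lab w) \<and>
      (\<forall>R\<in>T. \<forall>t\<in>tuples {..<size_of (F w)} (ar R). lab (F w) R t \<noteq> Star))"
  using assms
proof (induction T rule: finite_induct)
  case empty
  show ?case by (intro exI[of _ "\<lambda>w. w"]) (simp add: def_string_input)
next
  case (insert U T)
  then obtain F where F: "def_string (\<lambda>w e. F w)"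
    and Fw: "\<And>w. valid w \<Longrightarrow> target (size_of w) (lab w) \<Longrightarrow>
      valid (F w) \<and> target (size_of (F w)) (lab (F w)) \<and>
      lang {} (size_of (F w)) (lab (F w)) = lang {} (size_of w) (lab w) \<and>
      (\<forall>R\<in>T. \<forall>t\<in>tuples {..<size_of (F w)} (ar R). lab (F w) R t \<noteq> Star)" by auto
  have U: "U \<in> \<sigma>" "ar U = 1" and T: "T \<subseteq> \<sigma>" using insert.prems by auto
  let ?G = "\<lambda>w. enc (size_of w * 2) (split_stars U (lab w))"
  have "def_string (\<lambda>w e. ?G w)"
    by (intro def_string_enc definable_mult definable_size definable_const def_label_split_stars U)
  then have 1: "def_string (\<lambda>w e. ?G (F w))" by (rule def_string_comp[OF _ F])
  have 2: "valid (?G (F w)) \<and> target (size_of (?G (F w))) (lab (?G (F w))) \<and>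
      lang {} (size_of (?G (F w))) (lab (?G (F w))) = lang {} (size_of w) (lab w) \<and>
      (\<forall>R\<in>insert U T. \<forall>t\<in>tuples {..<size_of (?G (F w))} (ar R). lab (?G (F w)) R t \<noteq> Star)"
    if w: "valid w" "target (size_of w) (lab w)" for w
  proof -
    let ?n = "size_of (F w)" and ?v = "lab (F w)"
    have U_ns: "split_stars U ?v U t \<noteq> Star" for t by (simp add: split_stars_def)
    then have "target (?n * 2) (split_stars U ?v)" using U(1) unfolding target_def by blast
    moreover have "split_stars U ?v R t \<noteq> Star" if R: "R \<in> insert U T" and t: "t \<in> tuples {..<?n * 2} (ar R)" for R t
    proof (cases "R = U")
      case False
      have "map (\<lambda>x. x div 2) t \<in> tuples {..<?n} (ar R)"
        using t by (rule map_in_tuples) (rule less_mult_imp_div_less)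
      then show ?thesis using Fw[OF w] R False by (simp add: split_stars_def)
    qed (simp add: U_ns)
    moreover have "lang {} (?n * 2) (split_stars U ?v) = lang {} (size_of w) (lab w)"
      using lang_split_stars[OF U] Fw[OF w] by simp
    moreover have "insert U T \<subseteq> \<sigma>" using U(1) T by simp
    ultimately show ?thesis by (auto simp: subset_iff)
  qed
  show ?case
    by (rule exI[of _ "\<lambda>w. ?G (F w)"]) (rule conjI[OF 1 allI[OF impI[OF impI[OF 2]]]])
qed

text \<open>The symbol \<open>U\<close> is pinned first and the remaining ones afterwards, so
  \<open>U\<close> drops out of the star-carrying symbols at once. \<open>E\<close> stays in
  \<open>S\<close> throughout, available for storing labels at every stage.\<close>

lemma pin_all:
  assumes E: "E \<in> \<sigma>" "2 \<le> ar E" and S: "\<And>R. R \<in> S \<Longrightarrow> ar R \<noteq> 1" "E \<in> S"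
    and "finite T" "T \<subseteq> {R \<in> \<sigma>. ar R = 1}"
  shows "\<exists>F. def_string (\<lambda>w e. F w) \<and>
    (\<forall>w. valid w \<longrightarrow> target (size_of w) (lab w) \<longrightarrow>
      valid (F w) \<and> target (size_of (F w)) (lab (F w)) \<and>
      def_reduces (lang (S \<union> T) (size_of w) (lab w)) (lang S (size_of (F w)) (lab (F w))) \<and>
      def_reduces (lang S (size_of (F w)) (lab (F w))) (lang (S \<union> T) (size_of w) (lab w)))"
  using assms(5,6)
proof (induction T rule: finite_induct)
  case empty
  show ?case by (intro exI[of _ "\<lambda>w. w"]) (simp add: def_string_input def_reduces_refl)
next
  case (insert U T)
  then obtain F where F: "def_string (\<lambda>w e. F w)"
    and Fw: "\<And>w. valid w \<Longrightarrow> target (size_of w) (lab w) \<Longrightarrow>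
      valid (F w) \<and> target (size_of (F w)) (lab (F w)) \<and>
      def_reduces (lang (S \<union> T) (size_of w) (lab w)) (lang S (size_of (F w)) (lab (F w))) \<and>
      def_reduces (lang S (size_of (F w)) (lab (F w))) (lang (S \<union> T) (size_of w) (lab w))" by auto
  have U: "U \<in> \<sigma>" "ar U = 1" using insert.prems by auto
  interpret pinning \<sigma> ar U E by unfold_locales (use U E in auto)
  let ?G = "\<lambda>w. enc (size_of w + 2) (pin (size_of w) (lab w))"
  have G: "def_string (\<lambda>w e. ?G w)"
    by (intro def_string_enc definable_add definable_size definable_const def_label_pin)
  have 1: "def_string (\<lambda>w e. F (?G w))" by (rule def_string_comp[OF F G])
  have 2: "valid (F (?G w)) \<and> target (size_of (F (?G w))) (lab (F (?G w))) \<and>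
      def_reduces (lang (S \<union> insert U T) (size_of w) (lab w)) (lang S (size_of (F (?G w))) (lab (F (?G w)))) \<and>
      def_reduces (lang S (size_of (F (?G w))) (lab (F (?G w)))) (lang (S \<union> insert U T) (size_of w) (lab w))"
    if w: "valid w" "target (size_of w) (lab w)" for w
  proof -
    let ?n = "size_of w" and ?v = "lab w"
    have "target (size_of (?G w)) (lab (?G w))" using target_pin by simp
    note FG = Fw[OF valid_enc this]
    have ST: "E \<in> S \<union> T" "U \<notin> S \<union> T" using S U insert.hyps by auto
    have "lang (S \<union> T) (size_of (?G w)) (lab (?G w)) = lang (S \<union> T) (?n + 2) (pin ?n ?v)" by simp
    then have "def_reduces (lang (insert U (S \<union> T)) ?n ?v) (lang S (size_of (F (?G w))) (lab (F (?G w))))"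
      "def_reduces (lang S (size_of (F (?G w))) (lab (F (?G w)))) (lang (insert U (S \<union> T)) ?n ?v)"
      using def_reduces_trans[OF lang_reduces_pin[OF ST(1), of ?n ?v]]
        def_reduces_trans[OF _ pin_reduces_lang[OF ST(2), of ?n ?v]] FG
      by simp_all
    then show ?thesis
      using FG unfolding Un_insert_right by simp
  qed
  show ?case
    by (rule exI[of _ "\<lambda>w. F (?G w)"]) (rule conjI[OF 1 allI[OF impI[OF impI[OF 2]]]])
qed

lemma finds_equivI:
  assumes F: "def_string (\<lambda>w e. F w)"
    and Fw: "\<And>w. valid w \<Longrightarrow> target (size_of w) (lab w) \<Longrightarrow>
      valid (F w) \<and> target (size_of (F w)) (lab (F w)) \<and>
      def_reduces (lang S (size_of w) (lab w)) (lang S' (size_of (F w)) (lab (F w))) \<and>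
      def_reduces (lang S' (size_of (F w)) (lab (F w))) (lang S (size_of w) (lab w))"
  shows "finds_equiv {(enc n v, lang S n v) | n v. target n v} {(enc n v, lang S' n v) | n v. target n v}"
  unfolding finds_equiv_def
proof (intro exI[of _ F] conjI ballI)
  show "poly_time F" by (rule def_string_poly_time[OF F])
  fix p assume "p \<in> {(enc n v, lang S n v) | n v. target n v}"
  then obtain n v where p: "p = (enc n v, lang S n v)" "target n v" by blast
  let ?w = "enc n v"
  have "target (size_of ?w) (lab ?w)" using p(2) by simp
  note * = Fw[OF valid_enc this]
  have "(F ?w, lang S' (size_of (F ?w)) (lab (F ?w))) \<in> {(enc n v, lang S' n v) | n v. target n v}"
    using * unfolding valid_def by blast
  moreover have "poly_equiv (lang S n v) (lang S' (size_of (F ?w)) (lab (F ?w)))"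
    using * unfolding poly_equiv_def by (simp add: def_reduces_poly_reduces)
  ultimately show "case p of (d, L) \<Rightarrow> \<exists>L'. (F d, L') \<in> {(enc n v, lang S' n v) | n v. target n v} \<and> poly_equiv L L'"
    unfolding p(1) by blast
qed

lemma MP_finds_MP_star: "finds_equiv (MP_family \<sigma> ar) (MP_star_family \<sigma> ar)"
proof -
  have "finite {R \<in> \<sigma>. ar R = 1}" using finite_signature by simp
  from split_all_stars[OF this order_refl] obtain F where F: "def_string (\<lambda>w e. F w)"
    and Fw: "\<And>w. valid w \<Longrightarrow> target (size_of w) (lab w) \<Longrightarrow>
      valid (F w) \<and> target (size_of (F w)) (lab (F w)) \<and>
      lang {} (size_of (F w)) (lab (F w)) = lang {} (size_of w) (lab w) \<and>
      (\<forall>R\<in>{R \<in> \<sigma>. ar R = 1}. \<forall>t\<in>tuples {..<size_of (F w)} (ar R). lab (F w) R t \<noteq> Star)" by blast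
  have red: "def_reduces (lang \<sigma> n v) (lang {} n v)"
    if "\<forall>R\<in>{R \<in> \<sigma>. ar R = 1}. \<forall>t\<in>tuples {..<n} (ar R). v R t \<noteq> Star" for n v
  proof (rule def_reduces_trans)
    \<comment> \<open>The target has no unary star left, so an input with a unary star is a
      no-instance; a nullary symbol satisfies one of the two alternatives in any case.\<close>
    show "def_reduces (lang \<sigma> n v) (lang {R. 2 \<le> ar R} n v)"
    proof (rule lang_unused_stars_reduces)
      fix R assume R: "R \<in> \<sigma> - {R. 2 \<le> ar R}"
      then consider "ar R = 0" | "ar R = 1" by force
      then show "ar R = 0 \<and> v R [] = Star \<or> (\<forall>t\<in>tuples {..<n} (ar R). v R t \<noteq> Star)"
        using that R by cases (auto simp: tuples_0)
    qed
    show "def_reduces (lang {R. 2 \<le> ar R} n v) (lang {} n v)"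
      by (rule lang_binary_stars_reduces) simp
  qed
  have "valid (F w) \<and> target (size_of (F w)) (lab (F w)) \<and>
      def_reduces (lang {} (size_of w) (lab w)) (lang \<sigma> (size_of (F w)) (lab (F w))) \<and>
      def_reduces (lang \<sigma> (size_of (F w)) (lab (F w))) (lang {} (size_of w) (lab w))"
    if "valid w" "target (size_of w) (lab w)" for w
    using Fw[OF that] lang_mono_reduces[of "{}" \<sigma> "size_of (F w)" "lab (F w)"]
      red[of "size_of (F w)" "lab (F w)"] by simp
  then show ?thesis
    unfolding families_eq by (rule finds_equivI[OF F])
qed

lemma MP_star_finds_MP: "finds_equiv (MP_star_family \<sigma> ar) (MP_family \<sigma> ar)"
proof (cases "\<exists>E\<in>\<sigma>. 2 \<le> ar E")
  case True
  then obtain E where E: "E \<in> \<sigma>" "2 \<le> ar E" by blast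
  let ?S = "{R \<in> \<sigma>. 2 \<le> ar R}" and ?T = "{R \<in> \<sigma>. ar R = 1}"
  have "finite ?T" using finite_signature by simp
  from pin_all[OF E _ _ this order_refl, of ?S] E obtain F where F: "def_string (\<lambda>w e. F w)"
    and Fw: "\<And>w. valid w \<Longrightarrow> target (size_of w) (lab w) \<Longrightarrow>
      valid (F w) \<and> target (size_of (F w)) (lab (F w)) \<and>
      def_reduces (lang (?S \<union> ?T) (size_of w) (lab w)) (lang ?S (size_of (F w)) (lab (F w))) \<and>
      def_reduces (lang ?S (size_of (F w)) (lab (F w))) (lang (?S \<union> ?T) (size_of w) (lab w))"
    by auto
  have 1: "def_reduces (lang \<sigma> n v) (lang (?S \<union> ?T) n v)" for n v
  proof (rule lang_unused_stars_reduces)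
    fix R assume "R \<in> \<sigma> - (?S \<union> ?T)"
    then have "ar R = 0" by force
    then show "ar R = 0 \<and> v R [] = Star \<or> (\<forall>t\<in>tuples {..<n} (ar R). v R t \<noteq> Star)"
      by (auto simp: tuples_0)
  qed
  have 2: "def_reduces (lang (?S \<union> ?T) n v) (lang \<sigma> n v)" for n v
    by (rule lang_mono_reduces) auto
  have 3: "def_reduces (lang ?S n v) (lang {} n v)" for n v
    by (rule lang_binary_stars_reduces) simp
  have 4: "def_reduces (lang {} n v) (lang ?S n v)" for n v
    by (rule lang_mono_reduces) simp
  have "valid (F w) \<and> target (size_of (F w)) (lab (F w)) \<and>
      def_reduces (lang \<sigma> (size_of w) (lab w)) (lang {} (size_of (F w)) (lab (F w))) \<and>
      def_reduces (lang {} (size_of (F w)) (lab (F w))) (lang \<sigma> (size_of w) (lab w))"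
    if "valid w" "target (size_of w) (lab w)" for w
    using Fw[OF that] def_reduces_trans[OF def_reduces_trans[OF 1 _] 3]
      def_reduces_trans[OF def_reduces_trans[OF 4 _] 2] by simp
  then show ?thesis
    unfolding families_eq by (rule finds_equivI[OF F])
next
  case False
  then have le: "ar R \<le> 1" if "R \<in> \<sigma>" for R using that by force
  \<comment> \<open>All these problems are decidable by definable predicates, contain some string
    and omit the empty one. The target can therefore be kept as it is.\<close>
  have "def_reduces (lang S n v) (lang S' n v)" for S S' n v
  proof -
    obtain x where "x \<in> lang S' n v" using lang_nonempty by blast
    then show ?thesis
      using le by (intro def_reduces_nontrivial[OF decidable_lang_unary _ Nil_notin_lang])
  qed
  then show ?thesis
    unfolding families_eq by (intro finds_equivI[OF def_string_input]) simp
qed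

end

theorem mainTheorem3:
  fixes \<sigma> :: "'r::linorder set" and ar :: "'r \<Rightarrow> nat"
  assumes "finite \<sigma>"
  shows "families_poly_equiv (MP_family \<sigma> ar) (MP_star_family \<sigma> ar)"
proof -
  interpret signature \<sigma> ar by unfold_locales (rule assms)
  show ?thesis
    unfolding families_poly_equiv_def using MP_finds_MP_star MP_star_finds_MP by blast
qed

end
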